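(* Let $\Bbbk$ be a field of characteristic different from $2$ and let $A$ be a Hopf algebra over $\Bbbk$. Let $\mathsf{SD}(A)$ be the set of super-data for $A$, let $\sim$ be the equivalence relation on it given by the action of Hopf algebra automorphisms of $A$, and for $(g,\alpha)\in\mathsf{SD}(A)$ let $A^{\mathsf{coinv}(g,\alpha)}$ be the associated coinvariant subalgebra (all defined in the context). Then the assignment $(g,\alpha)\mapsto A^{\mathsf{coinv}(g,\alpha)}$ induces a bijection from $\mathsf{SD}(A)/\!\sim$ onto the set of isomorphism classes of Hopf superalgebras $\mathcal{H}$ over $\Bbbk$ such that $\mathcal{H}_{\bar1}\neq0$ and the bosonization $\widehat{\mathcal{H}}$ is isomorphic to $A$ as a Hopf algebra.
   Context: A Hopf superalgebra is a Hopf algebra in the category of $\mathbb{Z}_2$-graded vector spaces $V=V_{\bar0}\oplus V_{\bar1}$ with symmetry $v\otimes w\mapsto(-1)^{|v||w|}w\otimes v$ ($|v|\in\{0,1\}$ the parity); isomorphisms are parity-preserving. Write $\mathbb{Z}_2=\{e,\sigma\}$ multiplicatively. The bosonization of a Hopf superalgebra $\mathcal{H}$ is the Hopf algebra $\widehat{\mathcal{H}}=\mathcal{H}\otimes\Bbbk\mathbb{Z}_2$ (elements $h\#\sigma^i$) with product $(h\#\sigma^i)(h'\#\sigma^j)=(-1)^{i|h'|}hh'\#\sigma^{i+j}$, unit $1\#e$, $\Delta(h\#\sigma^i)=(h_{(1)}\#\sigma^{i+|h_{(2)}|})\otimes(h_{(2)}\#\sigma^i)$, $\varepsilon(h\#\sigma^i)=\varepsilon(h)$,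 $S(h\#\sigma^i)=(-1)^{i+|h|}S_{\mathcal H}(h)\#\sigma^{i+|h|}$ for homogeneous elements (the sign in $S$ is written as in the standard formula $S(h\#\sigma^i)=(1\#\sigma^{|h|+i})(S_{\mathcal H}(h)\#e)$). $\mathbf{G}(A)$ is the group of group-like elements of $A$; $A^\circ$ is the finite dual; $\mathbf{G}(A^\circ)$ is the group of algebra maps $A\to\Bbbk$. For an algebra map $\alpha:A\to\Bbbk$ and $a\in A$ put $\alpha\rightharpoonup a=a_{(1)}\alpha(a_{(2)})$, $a\leftharpoonup\alpha=\alpha(a_{(1)})a_{(2)}$. An admissible datum for $A$ is a pair $(g,\alpha)\in\mathbf{G}(A)\times\mathbf{G}(A^\circ)$ with $g$ and $\alpha$ of order $2$ and $\alpha(g)=-1$. A super-datum for $A$ is an admissible datum such that $g\notin Z(A)$ (the center of $A$) and $\alpha\rightharpoonup a\leftharpoonup\alpha=gag$ for all $a\in A$. For admissible data, $(g,\alpha)\sim(h,\beta)$ means there is a Hopf algebra automorphism $\varphi$ of $A$ with $\varphi(g)=h$ and $\alpha=\beta\circ\varphi$. For an admissible datum $(g,\alpha)$ let $\iota:\Bbbk\mathbb{Z}_2\to A$, $\sigma^i\mapsto g^i$, and $\pi:A\to\Bbbk\mathbb{Z}_2$, $\pi(a)=\frac{\varepsilon(a)}2(e+\sigma)+\frac{\alpha(a)}2(e-\sigma)$. The coinvariant subalgebra is $A^{\mathsf{coinv}(g,\alpha)}=\{b\in A\mid b_{(1)}\otimes\pi(b_{(2)})=b\otimes e\}$, a subalgebra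 of $A$, with comultiplication $b\mapsto b_{(1)}\,\iota(\pi(b_{(2)}))\otimes b_{(3)}$, counit $\varepsilon_A$ and antipode $b\mapsto\iota(\pi(b_{(1)}))S_A(b_{(2)})$. When $(g,\alpha)$ is a super-datum, it is a Hopf superalgebra with grading $\{b\mid gbg=(-1)^\epsilon b\}$ in degree $\bar\epsilon$.
   Formalization: The displayed sign (-1)^{i+|h|} in the antipode of the bosonization is a misprint (it gives S(1#σ) = -1#σ, which violates the antipode axiom); the antipode is taken to be S(h#σ^i) = (1#σ^{|h|+i})(S_H(h)#e), the standard formula quoted beside it. *)

theory Defs
  imports Complex_Main "HOL-Library.Z2" "HOL-Library.Function_Algebras" "HOL-Library.FuncSet"
begin

section \<open>Tensor products of vector spaces\<close>

text \<open>
  Vector spaces over the field \<open>'k\<close> are subspaces of an ambient type carrying a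
  \<^locale>\<open>vector_space\<close> structure.  A tensor is realised (as in Halmos, Finite-Dimensional
  Vector Spaces) as a functional on bilinear forms: \<open>v \<otimes> w\<close> is evaluation at \<open>(v, w)\<close>, and
  \<open>V \<otimes> W\<close> consists of the finite sums of such \<open>v \<otimes> w\<close>.  Over a field the natural
  map \<open>V \<otimes> W \<rightarrow> V' \<otimes> W'\<close> is injective for subspaces \<open>V \<subseteq> V'\<close> and \<open>W \<subseteq> W'\<close>, and
  here it is an inclusion.  The universal property of \<open>V \<otimes> W\<close> is lemma \<open>tensor_lift_sum\<close> below.
\<close>

definition linear_on ::
  "('k::field \<Rightarrow> 'a::ab_group_add \<Rightarrow> 'a) \<Rightarrow> ('k \<Rightarrow> 'b::ab_group_add \<Rightarrow> 'b) \<Rightarrow> 'a set \<Rightarrow> ('a \<Rightarrow> 'b) \<Rightarrow> bool"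
  where "linear_on s1 s2 V f \<longleftrightarrow>
    (\<forall>x\<in>V. \<forall>y\<in>V. f (x + y) = f x + f y) \<and> (\<forall>c. \<forall>x\<in>V. f (s1 c x) = s2 c (f x))"

definition bilinear_on ::
  "('k::field \<Rightarrow> 'a::ab_group_add \<Rightarrow> 'a) \<Rightarrow> ('k \<Rightarrow> 'b::ab_group_add \<Rightarrow> 'b) \<Rightarrow> ('k \<Rightarrow> 'c::ab_group_add \<Rightarrow> 'c)
    \<Rightarrow> 'a set \<Rightarrow> 'b set \<Rightarrow> ('a \<Rightarrow> 'b \<Rightarrow> 'c) \<Rightarrow> bool"
  where "bilinear_on s1 s2 s3 V W B \<longleftrightarrow>
    (\<forall>x\<in>V. linear_on s2 s3 W (B x)) \<and> (\<forall>y\<in>W. linear_on s1 s3 V (\<lambda>x. B x y))"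

type_synonym ('k, 'a, 'b) tensor = "('a \<Rightarrow> 'b \<Rightarrow> 'k) \<Rightarrow> 'k"

definition fscale :: "'k::field \<Rightarrow> ('i \<Rightarrow> 'k) \<Rightarrow> 'i \<Rightarrow> 'k"
  where "fscale c f = (\<lambda>i. c * f i)"

definition tens ::
  "('k::field \<Rightarrow> 'a::ab_group_add \<Rightarrow> 'a) \<Rightarrow> ('k \<Rightarrow> 'b::ab_group_add \<Rightarrow> 'b) \<Rightarrow> 'a \<Rightarrow> 'b \<Rightarrow> ('k, 'a, 'b) tensor"
  where "tens s1 s2 a b = (\<lambda>\<beta>. if bilinear_on s1 s2 (*) UNIV UNIV \<beta> then \<beta> a b else 0)"

definition tensor_space ::
  "('k::field \<Rightarrow> 'a::ab_group_add \<Rightarrow> 'a) \<Rightarrow> ('k \<Rightarrow> 'b::ab_group_add \<Rightarrow> 'b) \<Rightarrow> 'a set \<Rightarrow> 'b set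
    \<Rightarrow> ('k, 'a, 'b) tensor set"
  where "tensor_space s1 s2 V W =
    {t. \<exists>xs. set xs \<subseteq> V \<times> W \<and> t = (\<Sum>(a, b)\<leftarrow>xs. tens s1 s2 a b)}"

text \<open>The linear map on \<open>V \<otimes> W\<close> induced by a bilinear map \<open>B\<close> on \<open>V \<times> W\<close>.\<close>

definition tensor_lift ::
  "('k::field \<Rightarrow> 'a::ab_group_add \<Rightarrow> 'a) \<Rightarrow> ('k \<Rightarrow> 'b::ab_group_add \<Rightarrow> 'b) \<Rightarrow> 'a set \<Rightarrow> 'b set
    \<Rightarrow> ('a \<Rightarrow> 'b \<Rightarrow> 'c::ab_group_add) \<Rightarrow> ('k, 'a, 'b) tensor \<Rightarrow> 'c"
  where "tensor_lift s1 s2 V W B t =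
    (THE u. \<exists>xs. set xs \<subseteq> V \<times> W \<and> t = (\<Sum>(a, b)\<leftarrow>xs. tens s1 s2 a b) \<and> u = (\<Sum>(a, b)\<leftarrow>xs. B a b))"

lemma vector_space_mult: "vector_space ((*) :: 'k::field \<Rightarrow> 'k \<Rightarrow> 'k)"
  by unfold_locales (auto simp: algebra_simps)

lemma vector_space_fscale: "vector_space (fscale :: 'k::field \<Rightarrow> ('i \<Rightarrow> 'k) \<Rightarrow> 'i \<Rightarrow> 'k)"
  by unfold_locales (auto simp: algebra_simps fscale_def fun_eq_iff)

lemma bilinear_on_tens:
  assumes "vector_space s1" "vector_space s2"
  shows "bilinear_on s1 s2 fscale UNIV UNIV (tens s1 s2)"
  unfolding bilinear_on_def linear_on_def tens_def fscale_def by (auto simp: fun_eq_iff)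

lemma projection_onto_subspace:
  assumes "vector_space s" "module.subspace s V"
  obtains p where "range p \<subseteq> V" "linear_on s s UNIV p" "\<And>v. v \<in> V \<Longrightarrow> p v = v"
proof -
  interpret vector_space_pair s s using assms(1) by (simp add: vector_space_pair_def)
  have "Vector_Spaces.linear s s (\<lambda>x. x)"
    using vs1.linear_id by (simp add: id_def)
  from linear_exists_left_inverse_on[OF this assms(2)] obtain g where
    g: "g ` UNIV \<subseteq> V" "Vector_Spaces.linear s s g" "\<forall>v\<in>V. g v = v" by auto
  have "linear_on s s UNIV g"
    using g(2) by (simp add: linear_on_def Vector_Spaces.linear_iff)
  then show ?thesis using g that by auto
qed

lemma separating_functional:
  fixes s :: "'k::field \<Rightarrow> 'c::ab_group_add \<Rightarrow> 'c"
  assumes "vector_space s" "u \<noteq> 0"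
  obtains f where "linear_on s (*) UNIV f" "f u \<noteq> 0"
proof -
  interpret vector_space_pair s "(*) :: 'k \<Rightarrow> 'k \<Rightarrow> 'k"
    using assms(1) vector_space_mult by (simp add: vector_space_pair_def)
  have "vs1.independent {u}" using assms(2) by simp
  from linear_independent_extend[OF this, of "\<lambda>_. 1"] obtain g where
    g: "Vector_Spaces.linear s (*) g" "g u = 1" by auto
  then have "linear_on s (*) UNIV g" by (simp add: linear_on_def Vector_Spaces.linear_iff)
  then show ?thesis using g that by auto
qed

lemma linear_on_sum_list:
  assumes "linear_on s (*) UNIV (f :: 'c::ab_group_add \<Rightarrow> 'k::field)"
  shows "f (\<Sum>(a, b)\<leftarrow>xs. B a b) = (\<Sum>(a, b)\<leftarrow>xs. f (B a b))"
proof -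
  have add: "f (x + y) = f x + f y" for x y using assms by (simp add: linear_on_def)
  have "f 0 = 0" using add[of 0 0] by (metis add.right_neutral add_left_cancel)
  then show ?thesis by (induction xs) (auto simp: add)
qed

lemma sum_list_fun_apply: "(\<Sum>(a, b)\<leftarrow>xs. F a b) \<beta> = (\<Sum>(a, b)\<leftarrow>xs. F a b \<beta>)"
  by (induction xs) auto

lemma tensor_sum_unique:
  fixes B :: "'a::ab_group_add \<Rightarrow> 'b::ab_group_add \<Rightarrow> 'c::ab_group_add"
  assumes vs: "vector_space s1" "vector_space s2" "vector_space s3"
    and sub: "module.subspace s1 V" "module.subspace s2 W"
    and B: "bilinear_on s1 s2 s3 V W B"
    and xs: "set xs \<subseteq> V \<times> W" and ys: "set ys \<subseteq> V \<times> W"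
    and eq: "(\<Sum>(a, b)\<leftarrow>xs. tens s1 s2 a b) = (\<Sum>(a, b)\<leftarrow>ys. tens s1 s2 a b)"
  shows "(\<Sum>(a, b)\<leftarrow>xs. B a b) = (\<Sum>(a, b)\<leftarrow>ys. B a b)" (is "?u = ?v")
proof (rule ccontr)
  assume "?u \<noteq> ?v"
  then have "?u - ?v \<noteq> 0" by simp
  then obtain f where f: "linear_on s3 (*) UNIV f" "f (?u - ?v) \<noteq> 0"
    using separating_functional[OF vs(3)] by metis
  obtain p where p: "range p \<subseteq> V" "linear_on s1 s1 UNIV p" "\<And>v. v \<in> V \<Longrightarrow> p v = v"
    using projection_onto_subspace[OF vs(1) sub(1)] by metis
  obtain q where q: "range q \<subseteq> W" "linear_on s2 s2 UNIV q" "\<And>v. v \<in> W \<Longrightarrow> q v = v"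
    using projection_onto_subspace[OF vs(2) sub(2)] by metis
  define \<beta> where "\<beta> = (\<lambda>x y. f (B (p x) (q y)))"
  have pV: "p x \<in> V" and qW: "q y \<in> W" for x y using p(1) q(1) by auto
  have \<beta>: "bilinear_on s1 s2 (*) UNIV UNIV \<beta>"
    using B p(2) q(2) f(1) pV qW unfolding \<beta>_def bilinear_on_def linear_on_def by simp
  have val: "(\<Sum>(a, b)\<leftarrow>zs. tens s1 s2 a b) \<beta> = f (\<Sum>(a, b)\<leftarrow>zs. B a b)"
    if "set zs \<subseteq> V \<times> W" for zs
  proof -
    have "(\<Sum>(a, b)\<leftarrow>zs. tens s1 s2 a b) \<beta> = (\<Sum>(a, b)\<leftarrow>zs. f (B a b))"
      unfolding sum_list_fun_apply
      by (rule arg_cong[where f=sum_list], rule map_cong)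
        (use that p(3) q(3) \<beta> in \<open>auto simp: tens_def \<beta>_def\<close>)
    then show ?thesis by (simp add: linear_on_sum_list[OF f(1)])
  qed
  have "f ?u = f ?v" unfolding val[OF xs, symmetric] val[OF ys, symmetric] eq ..
  moreover have "f (?u - ?v + ?v) = f (?u - ?v) + f ?v"
    using f(1) unfolding linear_on_def by blast
  ultimately show False using f(2) by simp
qed

lemma tensor_lift_sum:
  assumes "vector_space s1" "vector_space s2" "vector_space s3"
    and "module.subspace s1 V" "module.subspace s2 W"
    and "bilinear_on s1 s2 s3 V W B" and "set xs \<subseteq> V \<times> W"
  shows "tensor_lift s1 s2 V W B (\<Sum>(a, b)\<leftarrow>xs. tens s1 s2 a b) = (\<Sum>(a, b)\<leftarrow>xs. B a b)"
  unfolding tensor_lift_def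
proof (rule the_equality)
  show "\<exists>ys. set ys \<subseteq> V \<times> W \<and>
      (\<Sum>(a, b)\<leftarrow>xs. tens s1 s2 a b) = (\<Sum>(a, b)\<leftarrow>ys. tens s1 s2 a b) \<and>
      (\<Sum>(a, b)\<leftarrow>xs. B a b) = (\<Sum>(a, b)\<leftarrow>ys. B a b)"
    using assms(7) by blast
next
  fix u
  assume "\<exists>ys. set ys \<subseteq> V \<times> W \<and>
      (\<Sum>(a, b)\<leftarrow>xs. tens s1 s2 a b) = (\<Sum>(a, b)\<leftarrow>ys. tens s1 s2 a b) \<and>
      u = (\<Sum>(a, b)\<leftarrow>ys. B a b)"
  then obtain ys where "set ys \<subseteq> V \<times> W"
    "(\<Sum>(a, b)\<leftarrow>xs. tens s1 s2 a b) = (\<Sum>(a, b)\<leftarrow>ys. tens s1 s2 a b)"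
    "u = (\<Sum>(a, b)\<leftarrow>ys. B a b)" by blast
  then show "u = (\<Sum>(a, b)\<leftarrow>xs. B a b)"
    by (simp only: tensor_sum_unique[OF assms])
qed


section \<open>Hopf algebras and Hopf superalgebras\<close>

text \<open>
  The underlying vector space is the subspace \<open>carrier\<close> of the ambient type; addition and zero are
  those of the type, and the values of the operations outside the carrier are irrelevant.
\<close>

record ('k, 'a) hopf =
  carrier :: "'a set"
  smult :: "'k \<Rightarrow> 'a \<Rightarrow> 'a"  (infixr "\<odot>\<index>" 75)
  mult :: "'a \<Rightarrow> 'a \<Rightarrow> 'a"  (infixl "\<cdot>\<index>" 70)
  unit_elt :: "'a"  ("\<one>\<index>")
  comult :: "'a \<Rightarrow> ('k, 'a, 'a) tensor"
  counit :: "'a \<Rightarrow> 'k"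
  antipode :: "'a \<Rightarrow> 'a"

record ('k, 'a) super_hopf = "('k, 'a) hopf" +
  grade :: "bit \<Rightarrow> 'a set"

abbreviation tensor_of :: "'a \<Rightarrow> ('k, 'a, 'm) hopf_scheme \<Rightarrow> 'a \<Rightarrow> ('k::field, 'a::ab_group_add, 'a) tensor"
    ("_ \<otimes>\<^bsub>_\<^esub> _" [66, 0, 66] 65)
  where "x \<otimes>\<^bsub>A\<^esub> y \<equiv> tens (smult A) (smult A) x y"

text \<open>\<open>sweedler A F x\<close> is \<open>F(x\<^sub>(\<^sub>1\<^sub>), x\<^sub>(\<^sub>2\<^sub>))\<close> in Sweedler notation.\<close>

abbreviation sweedler ::
  "('k::field, 'a::ab_group_add, 'm) hopf_scheme \<Rightarrow> ('a \<Rightarrow> 'a \<Rightarrow> 'c::ab_group_add) \<Rightarrow> 'a \<Rightarrow> 'c"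
  where "sweedler A F x \<equiv>
    tensor_lift (smult A) (smult A) (carrier A) (carrier A) F (comult A x)"

text \<open>
  The axioms that do not involve the symmetry of the category.  In \<open>coassoc\<close> both sides are
  written in \<open>A \<otimes> (A \<otimes> A)\<close>.
\<close>

locale hopf_core =
  fixes A :: "('k::field, 'a::ab_group_add, 'm) hopf_scheme" (structure)
  assumes vector_space_smult: "vector_space (smult A)"
    and subspace_carrier: "module.subspace (smult A) (carrier A)"
    and mult_closed: "\<And>x y. x \<in> carrier A \<Longrightarrow> y \<in> carrier A \<Longrightarrow> x \<cdot> y \<in> carrier A"
    and mult_bilinear: "bilinear_on (smult A) (smult A) (smult A) (carrier A) (carrier A) (mult A)"
    and mult_assoc: "\<And>x y z. x \<in> carrier A \<Longrightarrow> y \<in> carrier A \<Longrightarrow> z \<in> carrier A \<Longrightarrow>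
          (x \<cdot> y) \<cdot> z = x \<cdot> (y \<cdot> z)"
    and unit_closed: "\<one> \<in> carrier A"
    and unit_left: "\<And>x. x \<in> carrier A \<Longrightarrow> \<one> \<cdot> x = x"
    and unit_right: "\<And>x. x \<in> carrier A \<Longrightarrow> x \<cdot> \<one> = x"
    and comult_closed: "\<And>x. x \<in> carrier A \<Longrightarrow>
          comult A x \<in> tensor_space (smult A) (smult A) (carrier A) (carrier A)"
    and comult_linear: "linear_on (smult A) fscale (carrier A) (comult A)"
    and coassoc: "\<And>x. x \<in> carrier A \<Longrightarrow>
          sweedler A (\<lambda>u v. sweedler A (\<lambda>u1 u2. tens (smult A) fscale u1 (u2 \<otimes>\<^bsub>A\<^esub> v)) u) x
          = sweedler A (\<lambda>u v. tens (smult A) fscale u (comult A v)) x"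
    and counit_linear: "linear_on (smult A) (*) (carrier A) (counit A)"
    and counit_left: "\<And>x. x \<in> carrier A \<Longrightarrow> sweedler A (\<lambda>u v. counit A u \<odot> v) x = x"
    and counit_right: "\<And>x. x \<in> carrier A \<Longrightarrow> sweedler A (\<lambda>u v. counit A v \<odot> u) x = x"
    and counit_mult: "\<And>x y. x \<in> carrier A \<Longrightarrow> y \<in> carrier A \<Longrightarrow>
          counit A (x \<cdot> y) = counit A x * counit A y"
    and counit_unit: "counit A \<one> = 1"
    and comult_unit: "comult A \<one> = \<one> \<otimes>\<^bsub>A\<^esub> \<one>"
    and antipode_closed: "\<And>x. x \<in> carrier A \<Longrightarrow> antipode A x \<in> carrier A"
    and antipode_linear: "linear_on (smult A) (smult A) (carrier A) (antipode A)"
    and antipode_left: "\<And>x. x \<in> carrier A \<Longrightarrow>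
          sweedler A (\<lambda>u v. antipode A u \<cdot> v) x = counit A x \<odot> \<one>"
    and antipode_right: "\<And>x. x \<in> carrier A \<Longrightarrow>
          sweedler A (\<lambda>u v. u \<cdot> antipode A v) x = counit A x \<odot> \<one>"

locale hopf_algebra = hopf_core A for A :: "('k::field, 'a::ab_group_add, 'm) hopf_scheme" (structure) +
  assumes comult_mult: "\<And>x y. x \<in> carrier A \<Longrightarrow> y \<in> carrier A \<Longrightarrow>
          comult A (x \<cdot> y) =
            sweedler A (\<lambda>x1 x2. sweedler A (\<lambda>y1 y2. (x1 \<cdot> y1) \<otimes>\<^bsub>A\<^esub> (x2 \<cdot> y2)) y) x"

lemma UNIV_bit: "(UNIV :: bit set) = {0, 1}"
proof -
  have "i \<in> {0, 1}" for i :: bit by (cases i) simp_all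
  then show ?thesis by blast
qed

text \<open>\<open>parity_sign i\<close> is \<open>(-1)\<^sup>i\<close>.\<close>

definition parity_sign :: "bit \<Rightarrow> 'k::field"
  where "parity_sign i = (if i = 0 then 1 else - 1)"

definition homog_part :: "('k, 'a::ab_group_add, 'm) super_hopf_scheme \<Rightarrow> bit \<Rightarrow> 'a \<Rightarrow> 'a"
  where "homog_part H i x = (THE y. y \<in> grade H i \<and> x - y \<in> grade H (i + 1))"

text \<open>
  All structure maps are even.  In \<open>comult_mult_super\<close> the right-hand side is the product in
  \<open>H \<otimes> H\<close>, \<open>(x\<^sub>1 \<otimes> x\<^sub>2)(y\<^sub>1 \<otimes> y\<^sub>2) = (-1)\<^bsup>|x\<^sub>2||y\<^sub>1|\<^esup> x\<^sub>1y\<^sub>1 \<otimes> x\<^sub>2y\<^sub>2\<close>, extended from homogeneous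
  \<open>x\<^sub>2\<close>, \<open>y\<^sub>1\<close> by splitting them into homogeneous parts.
\<close>

locale hopf_superalgebra = hopf_core H
  for H :: "('k::field, 'a::ab_group_add, 'm) super_hopf_scheme" (structure) +
  assumes subspace_grade: "\<And>i. module.subspace (smult H) (grade H i)"
    and grade_sum: "carrier H = {x + y | x y. x \<in> grade H 0 \<and> y \<in> grade H 1}"
    and grade_inter: "grade H 0 \<inter> grade H 1 = {0}"
    and mult_grade: "\<And>i j x y. x \<in> grade H i \<Longrightarrow> y \<in> grade H j \<Longrightarrow> x \<cdot> y \<in> grade H (i + j)"
    and unit_grade: "\<one> \<in> grade H 0"
    and comult_grade: "\<And>k x. x \<in> grade H k \<Longrightarrow>
          \<exists>t. (\<forall>i. t i \<in> tensor_space (smult H) (smult H) (grade H i) (grade H (k - i))) \<and>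
              comult H x = (\<Sum>i\<in>UNIV. t i)"
    and counit_grade: "\<And>x. x \<in> grade H 1 \<Longrightarrow> counit H x = 0"
    and antipode_grade: "\<And>i x. x \<in> grade H i \<Longrightarrow> antipode H x \<in> grade H i"
    and comult_mult_super: "\<And>x y. x \<in> carrier H \<Longrightarrow> y \<in> carrier H \<Longrightarrow>
          comult H (x \<cdot> y) =
            sweedler H (\<lambda>x1 x2. sweedler H (\<lambda>y1 y2.
              \<Sum>i\<in>UNIV. \<Sum>j\<in>UNIV. fscale (parity_sign (i * j))
                ((x1 \<cdot> homog_part H j y1) \<otimes>\<^bsub>H\<^esub> (homog_part H i x2 \<cdot> y2))) y) x"

definition hopf_isomorphism ::
  "('k::field, 'a::ab_group_add, 'm) hopf_scheme \<Rightarrow> ('k, 'b::ab_group_add, 'n) hopf_scheme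
    \<Rightarrow> ('a \<Rightarrow> 'b) \<Rightarrow> bool"
  where "hopf_isomorphism A A' \<phi> \<longleftrightarrow>
    bij_betw \<phi> (carrier A) (carrier A') \<and>
    linear_on (smult A) (smult A') (carrier A) \<phi> \<and>
    (\<forall>x\<in>carrier A. \<forall>y\<in>carrier A. \<phi> (x \<cdot>\<^bsub>A\<^esub> y) = \<phi> x \<cdot>\<^bsub>A'\<^esub> \<phi> y) \<and>
    \<phi> \<one>\<^bsub>A\<^esub> = \<one>\<^bsub>A'\<^esub> \<and>
    (\<forall>x\<in>carrier A. comult A' (\<phi> x) = sweedler A (\<lambda>u v. \<phi> u \<otimes>\<^bsub>A'\<^esub> \<phi> v) x) \<and>
    (\<forall>x\<in>carrier A. counit A' (\<phi> x) = counit A x) \<and>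
    (\<forall>x\<in>carrier A. antipode A' (\<phi> x) = \<phi> (antipode A x))"

definition hopf_isomorphic ::
  "('k::field, 'a::ab_group_add, 'm) hopf_scheme \<Rightarrow> ('k, 'b::ab_group_add, 'n) hopf_scheme \<Rightarrow> bool"
  where "hopf_isomorphic A A' \<longleftrightarrow> (\<exists>\<phi>. hopf_isomorphism A A' \<phi>)"

definition super_isomorphic ::
  "('k::field, 'a::ab_group_add, 'm) super_hopf_scheme \<Rightarrow> ('k, 'b::ab_group_add, 'n) super_hopf_scheme \<Rightarrow> bool"
  where "super_isomorphic H H' \<longleftrightarrow>
    (\<exists>\<phi>. hopf_isomorphism H H' \<phi> \<and> (\<forall>i. \<forall>x\<in>grade H i. \<phi> x \<in> grade H' i))"


section \<open>Bosonization\<close>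

text \<open>
  The elements of \<open>H \<otimes> kZ\<^sub>2\<close> are the functions \<open>f\<close> from \<open>Z\<^sub>2 = {0, 1}\<close> (written additively, \<open>1\<close>
  standing for \<open>\<sigma>\<close>) to \<open>H\<close>, representing \<open>\<Sum>\<^sub>i f(i)#\<sigma>\<^sup>i\<close>; \<open>hash h i\<close> is \<open>h#\<sigma>\<^sup>i\<close>.  The structure
  maps are the linear extensions of the usual formulas on homogeneous elements.  For the antipode
  this is \<open>S(h#\<sigma>\<^sup>i) = (1#\<sigma>\<^bsup>|h|+i\<^esup>)(S(h)#e)\<close>, i.e. the sign is \<open>(-1)\<^bsup>(i+|h|)|h|\<^esup>\<close>.
\<close>

definition hash :: "'h::ab_group_add \<Rightarrow> bit \<Rightarrow> bit \<Rightarrow> 'h"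
  where "hash h i = (\<lambda>j. if j = i then h else 0)"

definition bos_smult :: "('k, 'h, 'm) super_hopf_scheme \<Rightarrow> 'k \<Rightarrow> (bit \<Rightarrow> 'h) \<Rightarrow> bit \<Rightarrow> 'h"
  where "bos_smult H c f = (\<lambda>i. c \<odot>\<^bsub>H\<^esub> f i)"

definition bos_mult ::
  "('k::field, 'h::ab_group_add, 'm) super_hopf_scheme \<Rightarrow> (bit \<Rightarrow> 'h) \<Rightarrow> (bit \<Rightarrow> 'h) \<Rightarrow> bit \<Rightarrow> 'h"
  where "bos_mult H f f' =
    (\<Sum>i\<in>UNIV. \<Sum>j\<in>UNIV. \<Sum>d\<in>UNIV.
      hash (parity_sign (i * d) \<odot>\<^bsub>H\<^esub> (f i \<cdot>\<^bsub>H\<^esub> homog_part H d (f' j))) (i + j))"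

definition bosonization ::
  "('k::field, 'h::ab_group_add, 'm) super_hopf_scheme \<Rightarrow> ('k, bit \<Rightarrow> 'h) hopf"
  where "bosonization H =
    \<lparr>carrier = {f. \<forall>i. f i \<in> carrier H},
     smult = bos_smult H,
     mult = bos_mult H,
     unit_elt = hash \<one>\<^bsub>H\<^esub> 0,
     comult = (\<lambda>f. \<Sum>i\<in>UNIV. sweedler H (\<lambda>u v. \<Sum>d\<in>UNIV.
       tens (bos_smult H) (bos_smult H) (hash u (i + d)) (hash (homog_part H d v) i)) (f i)),
     counit = (\<lambda>f. \<Sum>i\<in>UNIV. counit H (f i)),
     antipode = (\<lambda>f. \<Sum>i\<in>UNIV. \<Sum>d\<in>UNIV.
       bos_mult H (hash \<one>\<^bsub>H\<^esub> (d + i)) (hash (antipode H (homog_part H d (f i))) 0))\<rparr>"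


section \<open>Super-data\<close>

definition group_like :: "('k::field, 'a::ab_group_add, 'm) hopf_scheme \<Rightarrow> 'a set"
  where "group_like A =
    {g \<in> carrier A. comult A g = g \<otimes>\<^bsub>A\<^esub> g \<and> counit A g = 1}"

text \<open>Characters are extensional so that they are determined by their values on the carrier.\<close>

definition characters :: "('k::field, 'a::ab_group_add, 'm) hopf_scheme \<Rightarrow> ('a \<Rightarrow> 'k) set"
  where "characters A =
    {\<alpha> \<in> extensional (carrier A). linear_on (smult A) (*) (carrier A) \<alpha> \<and> \<alpha> \<one>\<^bsub>A\<^esub> = 1 \<and>
      (\<forall>x\<in>carrier A. \<forall>y\<in>carrier A. \<alpha> (x \<cdot>\<^bsub>A\<^esub> y) = \<alpha> x * \<alpha> y)}"

definition convolution ::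
  "('k::field, 'a::ab_group_add, 'm) hopf_scheme \<Rightarrow> ('a \<Rightarrow> 'k) \<Rightarrow> ('a \<Rightarrow> 'k) \<Rightarrow> 'a \<Rightarrow> 'k"
  where "convolution A \<alpha> \<beta> = restrict (sweedler A (\<lambda>u v. \<alpha> u * \<beta> v)) (carrier A)"

text \<open>The identity of the group of characters is the counit.\<close>

definition admissible_data :: "('k::field, 'a::ab_group_add, 'm) hopf_scheme \<Rightarrow> ('a \<times> ('a \<Rightarrow> 'k)) set"
  where "admissible_data A =
    {(g, \<alpha>). g \<in> group_like A \<and> \<alpha> \<in> characters A \<and>
      g \<noteq> \<one>\<^bsub>A\<^esub> \<and> g \<cdot>\<^bsub>A\<^esub> g = \<one>\<^bsub>A\<^esub> \<and>
      \<alpha> \<noteq> restrict (counit A) (carrier A) \<and> convolution A \<alpha> \<alpha> = restrict (counit A) (carrier A) \<and>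
      \<alpha> g = - 1}"

definition center :: "('k, 'a, 'm) hopf_scheme \<Rightarrow> 'a set"
  where "center A = {z \<in> carrier A. \<forall>x\<in>carrier A. z \<cdot>\<^bsub>A\<^esub> x = x \<cdot>\<^bsub>A\<^esub> z}"

definition act_left :: "('k::field, 'a::ab_group_add, 'm) hopf_scheme \<Rightarrow> ('a \<Rightarrow> 'k) \<Rightarrow> 'a \<Rightarrow> 'a"
  where "act_left A \<alpha> a = sweedler A (\<lambda>u v. \<alpha> v \<odot>\<^bsub>A\<^esub> u) a"

definition act_right :: "('k::field, 'a::ab_group_add, 'm) hopf_scheme \<Rightarrow> 'a \<Rightarrow> ('a \<Rightarrow> 'k) \<Rightarrow> 'a"
  where "act_right A a \<alpha> = sweedler A (\<lambda>u v. \<alpha> u \<odot>\<^bsub>A\<^esub> v) a"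

definition super_data :: "('k::field, 'a::ab_group_add, 'm) hopf_scheme \<Rightarrow> ('a \<times> ('a \<Rightarrow> 'k)) set"
  where "super_data A =
    {(g, \<alpha>) \<in> admissible_data A. g \<notin> center A \<and>
      (\<forall>a\<in>carrier A. act_right A (act_left A \<alpha> a) \<alpha> = g \<cdot>\<^bsub>A\<^esub> a \<cdot>\<^bsub>A\<^esub> g)}"

definition super_data_equiv ::
  "('k::field, 'a::ab_group_add, 'm) hopf_scheme \<Rightarrow> (('a \<times> ('a \<Rightarrow> 'k)) \<times> ('a \<times> ('a \<Rightarrow> 'k))) set"
  where "super_data_equiv A =
    {((g, \<alpha>), (h, \<beta>)). (g, \<alpha>) \<in> super_data A \<and> (h, \<beta>) \<in> super_data A \<and>
      (\<exists>\<phi>. hopf_isomorphism A A \<phi> \<and> \<phi> g = h \<and> (\<forall>a\<in>carrier A. \<alpha> a = \<beta> (\<phi> a)))}"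


section \<open>The coinvariant subalgebra\<close>

text \<open>The group algebra \<open>kZ\<^sub>2\<close> is the space of functions \<open>bit \<Rightarrow> 'k\<close>; \<open>kZ2_basis i\<close> is \<open>\<sigma>\<^sup>i\<close>.\<close>

definition kZ2_basis :: "bit \<Rightarrow> bit \<Rightarrow> 'k::field"
  where "kZ2_basis i = (\<lambda>j. if j = i then 1 else 0)"

definition kZ2_incl :: "('k, 'a::ab_group_add, 'm) hopf_scheme \<Rightarrow> 'a \<Rightarrow> (bit \<Rightarrow> 'k) \<Rightarrow> 'a"
  where "kZ2_incl A g f = f 0 \<odot>\<^bsub>A\<^esub> \<one>\<^bsub>A\<^esub> + f 1 \<odot>\<^bsub>A\<^esub> g"

definition kZ2_proj :: "('k::field, 'a, 'm) hopf_scheme \<Rightarrow> ('a \<Rightarrow> 'k) \<Rightarrow> 'a \<Rightarrow> bit \<Rightarrow> 'k"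
  where "kZ2_proj A \<alpha> a =
    fscale (counit A a / 2) (kZ2_basis 0 + kZ2_basis 1) + fscale (\<alpha> a / 2) (kZ2_basis 0 - kZ2_basis 1)"

definition coinv_carrier ::
  "('k::field, 'a::ab_group_add, 'm) hopf_scheme \<Rightarrow> 'a \<times> ('a \<Rightarrow> 'k) \<Rightarrow> 'a set"
  where "coinv_carrier A = (\<lambda>(g, \<alpha>).
    {b \<in> carrier A. sweedler A (\<lambda>u v. tens (smult A) fscale u (kZ2_proj A \<alpha> v)) b
      = tens (smult A) fscale b (kZ2_basis 0)})"

definition coinv ::
  "('k::field, 'a::ab_group_add, 'm) hopf_scheme \<Rightarrow> 'a \<times> ('a \<Rightarrow> 'k) \<Rightarrow> ('k, 'a) super_hopf"
  where "coinv A = (\<lambda>(g, \<alpha>).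
    \<lparr>carrier = coinv_carrier A (g, \<alpha>),
     smult = smult A,
     mult = mult A,
     unit_elt = \<one>\<^bsub>A\<^esub>,
     comult = sweedler A (\<lambda>u v. sweedler A (\<lambda>v1 v2.
       (u \<cdot>\<^bsub>A\<^esub> kZ2_incl A g (kZ2_proj A \<alpha> v1)) \<otimes>\<^bsub>A\<^esub> v2) v),
     counit = counit A,
     antipode = sweedler A (\<lambda>u v. kZ2_incl A g (kZ2_proj A \<alpha> u) \<cdot>\<^bsub>A\<^esub> antipode A v),
     grade = (\<lambda>i. {b \<in> coinv_carrier A (g, \<alpha>). g \<cdot>\<^bsub>A\<^esub> b \<cdot>\<^bsub>A\<^esub> g = parity_sign i \<odot>\<^bsub>A\<^esub> b})\<rparr>)"


section \<open>Isomorphism classes of Hopf superalgebras with given bosonization\<close>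

definition superization ::
  "('k::field, 'a::ab_group_add, 'm) hopf_scheme \<Rightarrow> ('k, 'h::ab_group_add) super_hopf \<Rightarrow> bool"
  where "superization A H \<longleftrightarrow>
    hopf_superalgebra H \<and> grade H 1 \<noteq> {0} \<and> hopf_isomorphic (bosonization H) A"

text \<open>
  Isomorphism classes are taken among the Hopf superalgebras living in a fixed ambient type.
\<close>

definition super_iso_class :: "('k::field, 'a::ab_group_add) super_hopf \<Rightarrow> ('k, 'a) super_hopf set"
  where "super_iso_class H = {H'. hopf_superalgebra H' \<and> super_isomorphic H H'}"

definition superization_classes ::
  "('k::field, 'a::ab_group_add, 'm) hopf_scheme \<Rightarrow> ('k, 'a) super_hopf set set"
  where "superization_classes A = super_iso_class ` {H. superization A H}"

end

(* Let L and R be the two actions of alpha on A, gamma the conjugation by g, and B the coinvariants.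
   As alpha has order 2, L is an involutive algebra automorphism and B is its fixed space; let E and
   N be the projections onto the eigenspaces of L for 1 and -1.  Since L g = - g, right
   multiplication by g exchanges these eigenspaces, so A = B + B g, and Q a = E a + N a g maps A
   onto B with Q (a g) = Q a.  Thus B with its comultiplication is the quotient coalgebra
   A/A(g - 1), and the coalgebra axioms of B are inherited from A along Q.  The super-datum
   condition R L = gamma says that R is the parity automorphism on B; moving alpha between the legs,
   a1 (x) R a2 = L a1 (x) a2, then produces the signs in the compatibility of product and coproduct.
   Facts about antipodes reduce to the uniqueness of the left convolution inverse of the identity.

   The map b # sigma^i |-> b g^i identifies the bosonization of B with A.  Conversely, an
   isomorphism psi from the bosonization of H to A yields the datum g = psi(1 # sigma),
   alpha = (eps (x) sgn) psi^-1, whose coinvariants are psi(H # e).  Finally, an isomorphism of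
   superalgebras from B to B' extends to A by b + c g |-> phi b + phi c g', which carries one datum
   to the other. *)

theory Submission
  imports Defs
begin

section \<open>Tensor products and Sweedler sums\<close>

text \<open>The maps \<open>kZ2_incl\<close> and \<open>kZ2_proj\<close> make A a Hopf algebra with
  a projection onto the group algebra of Z_2, so B is a priori a Hopf algebra only among the
  Yetter-Drinfeld modules over Z_2: g acts by \<gamma>, and R records the coaction. On B, where L is
  the identity, the super-datum condition reads R = \<gamma>; action and coaction then define one
  and the same grading, and the braiding becomes the sign rule. The obstacle to a direct
  verification is that the coproduct of A maps B into A (x) B and not into B (x) B. The right leg
  lies in B at no cost, because L acts on it. The left leg has to be moved there by Q, and iterated
  coproducts then involve Q x with x outside B; the rule Q (x g) = Q x keeps these computable.
  Division by 2 enters through the eigenspace projections and through the conclusion from x = - x to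
  x = 0. A Sweedler sum is meaningful only for a bilinear summand, so linearity is carried along
  throughout by the predicates \<open>lin\<close>, \<open>bil\<close> and
  \<open>tri\<close>.\<close>

lemma linear_on_zero:
  assumes "linear_on s1 s2 V f" "0 \<in> V"
  shows "f 0 = 0"
proof -
  have "f (0 + 0) = f 0 + f 0" using assms unfolding linear_on_def by blast
  then show ?thesis by simp
qed

lemma subspace_sum_list:
  assumes "vector_space s" "module.subspace s V" "\<And>a b. (a, b) \<in> set xs \<Longrightarrow> F a b \<in> V"
  shows "(\<Sum>(a, b)\<leftarrow>xs. F a b) \<in> V"
proof -
  interpret vector_space s by fact
  show ?thesis using assms(3)
    by (induction xs) (auto simp: subspace_0[OF assms(2)] intro!: subspace_add[OF assms(2)])
qed

lemma linear_on_subspace_sum_list: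
  assumes "vector_space s1" "module.subspace s1 V" "linear_on s1 s2 V f"
    and "\<And>a b. (a, b) \<in> set xs \<Longrightarrow> F a b \<in> V"
  shows "f (\<Sum>(a, b)\<leftarrow>xs. F a b) = (\<Sum>(a, b)\<leftarrow>xs. f (F a b))"
proof -
  interpret vector_space s1 by fact
  have 0: "f 0 = 0" using assms(3) linear_on_zero subspace_0[OF assms(2)] by metis
  show ?thesis using assms(4)
  proof (induction xs)
    case Nil then show ?case by (simp add: 0)
  next
    case (Cons p xs)
    obtain a b where p: "p = (a, b)" by (cases p)
    have "(\<Sum>(a, b)\<leftarrow>xs. F a b) \<in> V"
      by (rule subspace_sum_list[OF assms(1,2)]) (use Cons.prems in auto)
    moreover have "F a b \<in> V" using Cons.prems p by auto
    ultimately have "f (F a b + (\<Sum>(a, b)\<leftarrow>xs. F a b)) = f (F a b) + f (\<Sum>(a, b)\<leftarrow>xs. F a b)"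
      using assms(3) unfolding linear_on_def by blast
    moreover have "f (\<Sum>(a, b)\<leftarrow>xs. F a b) = (\<Sum>(a, b)\<leftarrow>xs. f (F a b))"
      using Cons by auto
    ultimately show ?case by (simp add: p)
  qed
qed

lemma vector_space_distrib:
  assumes "vector_space s"
  shows "s c (x + y) = s c x + s c y" "s (c + d) x = s c x + s d x" "s c (s d x) = s (c * d) x"
    "s 1 x = x" "s c 0 = 0" "s 0 x = 0" "s c (- x) = - s c x" "s (- c) x = - s c x"
    "s c (x - y) = s c x - s c y" "s (c - d) x = s c x - s d x"
proof -
  interpret vector_space s by fact
  show "s c (x + y) = s c x + s c y" "s (c + d) x = s c x + s d x" "s c (s d x) = s (c * d) x"
    "s 1 x = x" "s c 0 = 0" "s 0 x = 0" "s c (- x) = - s c x" "s (- c) x = - s c x"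
    "s c (x - y) = s c x - s c y" "s (c - d) x = s c x - s d x"
    by (auto simp: scale_right_distrib scale_left_distrib scale_right_diff_distrib scale_left_diff_distrib)
qed

lemmas fscale_distrib = vector_space_distrib[OF vector_space_fscale]

lemma subspace_tensor_space:
  assumes "vector_space s1" "vector_space s2" "module.subspace s1 V" "module.subspace s2 W"
  shows "module.subspace fscale (tensor_space s1 s2 V W)"
proof -
  interpret vector_space fscale by (rule vector_space_fscale)
  interpret v1: vector_space s1 by fact
  have "tens s1 s2 (s1 c a) b = fscale c (tens s1 s2 a b)" for c a b
    using bilinear_on_tens[OF assms(1,2)] unfolding bilinear_on_def linear_on_def by blast
  then have "fscale c (\<Sum>(a, b)\<leftarrow>xs. tens s1 s2 a b) = (\<Sum>(a, b)\<leftarrow>map (\<lambda>(a, b). (s1 c a, b)) xs. tens s1 s2 a b)" for c xs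
    by (induction xs) (auto simp: fscale_distrib)
  moreover have "set (map (\<lambda>(a, b). (s1 c a, b)) xs) \<subseteq> V \<times> W" if "set xs \<subseteq> V \<times> W" for c xs
    using that v1.subspace_scale[OF assms(3)] by auto
  ultimately have "fscale c t \<in> tensor_space s1 s2 V W" if "t \<in> tensor_space s1 s2 V W" for c t
    using that unfolding tensor_space_def by blast
  moreover have "t + t' \<in> tensor_space s1 s2 V W"
    if "t \<in> tensor_space s1 s2 V W" "t' \<in> tensor_space s1 s2 V W" for t t'
  proof -
    from that obtain xs ys where xs: "set xs \<subseteq> V \<times> W" "t = (\<Sum>(a, b)\<leftarrow>xs. tens s1 s2 a b)"
      and ys: "set ys \<subseteq> V \<times> W" "t' = (\<Sum>(a, b)\<leftarrow>ys. tens s1 s2 a b)" unfolding tensor_space_def by blast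
    then show ?thesis unfolding tensor_space_def by (auto intro!: exI[of _ "xs @ ys"])
  qed
  moreover have "0 \<in> tensor_space s1 s2 V W" unfolding tensor_space_def by (auto intro!: exI[of _ "[]"])
  ultimately show ?thesis by (simp add: subspace_def)
qed

lemma tens_in_tensor_space: "a \<in> V \<Longrightarrow> b \<in> W \<Longrightarrow> tens s1 s2 a b \<in> tensor_space s1 s2 V W"
  unfolding tensor_space_def by (auto intro!: exI[of _ "[(a, b)]"])

text \<open>The description under \<open>THE\<close> evaluates the map only at pairs from V x W, so
  both sides are defined by equivalent predicates. The tensor t is arbitrary: the equation also
  holds where the description has no unique solution.\<close>

lemma tensor_lift_cong:
  assumes "\<And>a b. a \<in> V \<Longrightarrow> b \<in> W \<Longrightarrow> B a b = B' a b"
  shows "tensor_lift s1 s2 V W B t = tensor_lift s1 s2 V W B' t"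
proof -
  have "(\<Sum>(a, b)\<leftarrow>xs. B a b) = (\<Sum>(a, b)\<leftarrow>xs. B' a b)" if "set xs \<subseteq> V \<times> W" for xs
    by (rule arg_cong[where f=sum_list], rule map_cong) (use that assms in auto)
  then have "(\<exists>xs. set xs \<subseteq> V \<times> W \<and> t = (\<Sum>(a, b)\<leftarrow>xs. tens s1 s2 a b) \<and> u = (\<Sum>(a, b)\<leftarrow>xs. B a b))
    \<longleftrightarrow> (\<exists>xs. set xs \<subseteq> V \<times> W \<and> t = (\<Sum>(a, b)\<leftarrow>xs. tens s1 s2 a b) \<and> u = (\<Sum>(a, b)\<leftarrow>xs. B' a b))" for u
    by (metis (no_types, lifting))
  then show ?thesis unfolding tensor_lift_def by simp
qed

lemma tensor_lift_tens:
  assumes "vector_space s1" "vector_space s2" "vector_space s3"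
    and "module.subspace s1 V" "module.subspace s2 W"
    and "bilinear_on s1 s2 s3 V W B" "a \<in> V" "b \<in> W"
  shows "tensor_lift s1 s2 V W B (tens s1 s2 a b) = B a b"
  using tensor_lift_sum[OF assms(1-6), of "[(a, b)]"] assms(7,8) by simp

text \<open>Sums of tensors are represented by concatenated lists, and a scalar is absorbed into the
  first factors; the lift may be evaluated on any representing list.\<close>

lemma linear_on_tensor_lift:
  assumes "vector_space s1" "vector_space s2" "vector_space s3"
    and "module.subspace s1 V" "module.subspace s2 W"
    and B: "bilinear_on s1 s2 s3 V W B"
  shows "linear_on fscale s3 (tensor_space s1 s2 V W) (tensor_lift s1 s2 V W B)"
  unfolding linear_on_def
proof (intro conjI ballI allI)
  fix t t' assume "t \<in> tensor_space s1 s2 V W" "t' \<in> tensor_space s1 s2 V W"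
  then obtain xs ys where xs: "set xs \<subseteq> V \<times> W" "t = (\<Sum>(a, b)\<leftarrow>xs. tens s1 s2 a b)"
    and ys: "set ys \<subseteq> V \<times> W" "t' = (\<Sum>(a, b)\<leftarrow>ys. tens s1 s2 a b)" unfolding tensor_space_def by blast
  have "t + t' = (\<Sum>(a, b)\<leftarrow>xs @ ys. tens s1 s2 a b)" using xs ys by simp
  then have "tensor_lift s1 s2 V W B (t + t') = (\<Sum>(a, b)\<leftarrow>xs @ ys. B a b)"
    using tensor_lift_sum[OF assms(1-6), of "xs @ ys"] xs ys by (metis le_sup_iff set_append)
  then show "tensor_lift s1 s2 V W B (t + t') = tensor_lift s1 s2 V W B t + tensor_lift s1 s2 V W B t'"
    using tensor_lift_sum[OF assms(1-6) xs(1)] tensor_lift_sum[OF assms(1-6) ys(1)] xs ys by simp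
next
  fix c t assume "t \<in> tensor_space s1 s2 V W"
  then obtain xs where xs: "set xs \<subseteq> V \<times> W" "t = (\<Sum>(a, b)\<leftarrow>xs. tens s1 s2 a b)" unfolding tensor_space_def by blast
  interpret v1: vector_space s1 by fact
  interpret v3: vector_space s3 by fact
  let ?ys = "map (\<lambda>(a, b). (s1 c a, b)) xs"
  have ys: "set ?ys \<subseteq> V \<times> W"
    using xs v1.subspace_scale[OF assms(4)] by auto
  have "tens s1 s2 (s1 c a) b = fscale c (tens s1 s2 a b)" for c a b
    using bilinear_on_tens[OF assms(1,2)] unfolding bilinear_on_def linear_on_def by blast
  then have "fscale c t = (\<Sum>(a, b)\<leftarrow>?ys. tens s1 s2 a b)"
    unfolding xs(2) by (induction xs) (auto simp: fscale_distrib)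
  moreover have "s3 c (\<Sum>(a, b)\<leftarrow>xs. B a b) = (\<Sum>(a, b)\<leftarrow>?ys. B a b)"
    using xs(1) B by (induction xs) (auto simp: v3.scale_right_distrib bilinear_on_def linear_on_def)
  ultimately show "tensor_lift s1 s2 V W B (fscale c t) = s3 c (tensor_lift s1 s2 V W B t)"
    using tensor_lift_sum[OF assms(1-6) xs(1)] tensor_lift_sum[OF assms(1-6) ys] xs(2) by simp
qed

section \<open>Multilinear maps and Sweedler sums\<close>

definition lin ::
  "('k::field, 'a::ab_group_add, 'm) hopf_scheme \<Rightarrow> ('k \<Rightarrow> 'c::ab_group_add \<Rightarrow> 'c) \<Rightarrow> ('a \<Rightarrow> 'c) \<Rightarrow> bool"
  where "lin A s f \<longleftrightarrow> vector_space s \<and> linear_on (smult A) s (carrier A) f"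

text \<open>Like \<open>lin\<close> and \<open>tri\<close>, this predicate contains the vector space
  axioms of the target, so that a single fact supplies the side conditions of the lifting
  lemmas.\<close>

definition bil ::
  "('k::field, 'a::ab_group_add, 'm) hopf_scheme \<Rightarrow> ('k \<Rightarrow> 'c::ab_group_add \<Rightarrow> 'c) \<Rightarrow> ('a \<Rightarrow> 'a \<Rightarrow> 'c) \<Rightarrow> bool"
  where "bil A s F \<longleftrightarrow> vector_space s \<and> bilinear_on (smult A) (smult A) s (carrier A) (carrier A) F"

text \<open>The split into bilinearity in the last two arguments and linearity in the first is the
  form used when the last two arguments are contracted with a coproduct.\<close>

definition tri ::
  "('k::field, 'a::ab_group_add, 'm) hopf_scheme \<Rightarrow> ('k \<Rightarrow> 'c::ab_group_add \<Rightarrow> 'c) \<Rightarrow> ('a \<Rightarrow> 'a \<Rightarrow> 'a \<Rightarrow> 'c) \<Rightarrow> bool"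
  where "tri A s G \<longleftrightarrow> vector_space s \<and> (\<forall>u\<in>carrier A. bil A s (G u)) \<and>
    (\<forall>v\<in>carrier A. \<forall>w\<in>carrier A. lin A s (\<lambda>u. G u v w))"

lemma linI:
  assumes "vector_space s" "\<And>x y. x \<in> carrier A \<Longrightarrow> y \<in> carrier A \<Longrightarrow> f (x + y) = f x + f y"
    "\<And>c x. x \<in> carrier A \<Longrightarrow> f (smult A c x) = s c (f x)"
  shows "lin A s f"
  using assms by (auto simp: lin_def linear_on_def)

lemma linD:
  assumes "lin A s f"
  shows "vector_space s" "x \<in> carrier A \<Longrightarrow> y \<in> carrier A \<Longrightarrow> f (x + y) = f x + f y"
    "x \<in> carrier A \<Longrightarrow> f (smult A c x) = s c (f x)"
  using assms by (auto simp: lin_def linear_on_def)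

lemma bilI:
  assumes "vector_space s"
    "\<And>x y z. x \<in> carrier A \<Longrightarrow> y \<in> carrier A \<Longrightarrow> z \<in> carrier A \<Longrightarrow> F (x + y) z = F x z + F y z"
    "\<And>x y z. x \<in> carrier A \<Longrightarrow> y \<in> carrier A \<Longrightarrow> z \<in> carrier A \<Longrightarrow> F x (y + z) = F x y + F x z"
    "\<And>c x y. x \<in> carrier A \<Longrightarrow> y \<in> carrier A \<Longrightarrow> F (smult A c x) y = s c (F x y)"
    "\<And>c x y. x \<in> carrier A \<Longrightarrow> y \<in> carrier A \<Longrightarrow> F x (smult A c y) = s c (F x y)"
  shows "bil A s F"
  using assms by (auto simp: bil_def bilinear_on_def linear_on_def)

lemma bilD:
  assumes "bil A s F"
  shows "vector_space s"
    "x \<in> carrier A \<Longrightarrow> y \<in> carrier A \<Longrightarrow> z \<in> carrier A \<Longrightarrow> F (x + y) z = F x z + F y z"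
    "x \<in> carrier A \<Longrightarrow> y \<in> carrier A \<Longrightarrow> z \<in> carrier A \<Longrightarrow> F x (y + z) = F x y + F x z"
    "x \<in> carrier A \<Longrightarrow> y \<in> carrier A \<Longrightarrow> F (smult A c x) y = s c (F x y)"
    "x \<in> carrier A \<Longrightarrow> y \<in> carrier A \<Longrightarrow> F x (smult A c y) = s c (F x y)"
  using assms by (auto simp: bil_def bilinear_on_def linear_on_def)

lemma triI:
  assumes "vector_space s"
    "\<And>u x y z. u \<in> carrier A \<Longrightarrow> x \<in> carrier A \<Longrightarrow> y \<in> carrier A \<Longrightarrow> z \<in> carrier A \<Longrightarrow> F u (x + y) z = F u x z + F u y z"
    "\<And>u x y z. u \<in> carrier A \<Longrightarrow> x \<in> carrier A \<Longrightarrow> y \<in> carrier A \<Longrightarrow> z \<in> carrier A \<Longrightarrow> F u x (y + z) = F u x y + F u x z"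
    "\<And>u x y z. u \<in> carrier A \<Longrightarrow> x \<in> carrier A \<Longrightarrow> y \<in> carrier A \<Longrightarrow> z \<in> carrier A \<Longrightarrow> F (u + x) y z = F u y z + F x y z"
    "\<And>c u x y. u \<in> carrier A \<Longrightarrow> x \<in> carrier A \<Longrightarrow> y \<in> carrier A \<Longrightarrow> F u (smult A c x) y = s c (F u x y)"
    "\<And>c u x y. u \<in> carrier A \<Longrightarrow> x \<in> carrier A \<Longrightarrow> y \<in> carrier A \<Longrightarrow> F u x (smult A c y) = s c (F u x y)"
    "\<And>c u x y. u \<in> carrier A \<Longrightarrow> x \<in> carrier A \<Longrightarrow> y \<in> carrier A \<Longrightarrow> F (smult A c u) x y = s c (F u x y)"
  shows "tri A s F"
  using assms unfolding tri_def by (auto intro!: bilI linI)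

text \<open>Coalgebra axioms are not needed to compute with Sweedler sums; a bosonization, not yet known
  to be a Hopf algebra, is an instance.\<close>

locale comult_space =
  fixes A :: "('k::field, 'a::ab_group_add, 'm) hopf_scheme" (structure)
  assumes vs: "vector_space (smult A)"
    and sub: "module.subspace (smult A) (carrier A)"
    and comult_cl: "\<And>x. x \<in> carrier A \<Longrightarrow>
          comult A x \<in> tensor_space (smult A) (smult A) (carrier A) (carrier A)"
    and comult_lin: "linear_on (smult A) fscale (carrier A) (comult A)"
begin

sublocale V: vector_space "smult A" by (rule vs)

lemmas smult_distrib = vector_space_distrib[OF vs]

lemma carrier_closed [simp]:
  "0 \<in> carrier A" "x \<in> carrier A \<Longrightarrow> y \<in> carrier A \<Longrightarrow> x + y \<in> carrier A"
  "x \<in> carrier A \<Longrightarrow> c \<odot> x \<in> carrier A" "x \<in> carrier A \<Longrightarrow> y \<in> carrier A \<Longrightarrow> x - y \<in> carrier A"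
  "x \<in> carrier A \<Longrightarrow> - x \<in> carrier A"
  using V.subspace_0[OF sub] V.subspace_add[OF sub] V.subspace_scale[OF sub] V.subspace_diff[OF sub]
    V.subspace_neg[OF sub] by auto

lemma tens_distrib:
  "(x + y) \<otimes>\<^bsub>A\<^esub> z = (x \<otimes>\<^bsub>A\<^esub> z) + (y \<otimes>\<^bsub>A\<^esub> z)" "x \<otimes>\<^bsub>A\<^esub> (y + z) = (x \<otimes>\<^bsub>A\<^esub> y) + (x \<otimes>\<^bsub>A\<^esub> z)"
  "(c \<odot> x) \<otimes>\<^bsub>A\<^esub> y = fscale c (x \<otimes>\<^bsub>A\<^esub> y)" "x \<otimes>\<^bsub>A\<^esub> (c \<odot> y) = fscale c (x \<otimes>\<^bsub>A\<^esub> y)"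
  "(x - y) \<otimes>\<^bsub>A\<^esub> z = (x \<otimes>\<^bsub>A\<^esub> z) - (y \<otimes>\<^bsub>A\<^esub> z)" "x \<otimes>\<^bsub>A\<^esub> (y - z) = (x \<otimes>\<^bsub>A\<^esub> y) - (x \<otimes>\<^bsub>A\<^esub> z)"
proof -
  note * = bilinear_on_tens[OF vs vs, unfolded bilinear_on_def linear_on_def]
  have add: "tens (smult A) (smult A) (x + y) z = tens (smult A) (smult A) x z + tens (smult A) (smult A) y z"
    "tens (smult A) (smult A) x (y + z) = tens (smult A) (smult A) x y + tens (smult A) (smult A) x z" for x y z
    using * by blast+
  show "(x + y) \<otimes>\<^bsub>A\<^esub> z = (x \<otimes>\<^bsub>A\<^esub> z) + (y \<otimes>\<^bsub>A\<^esub> z)" "x \<otimes>\<^bsub>A\<^esub> (y + z) = (x \<otimes>\<^bsub>A\<^esub> y) + (x \<otimes>\<^bsub>A\<^esub> z)"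
    by (rule add)+
  show "(c \<odot> x) \<otimes>\<^bsub>A\<^esub> y = fscale c (x \<otimes>\<^bsub>A\<^esub> y)" "x \<otimes>\<^bsub>A\<^esub> (c \<odot> y) = fscale c (x \<otimes>\<^bsub>A\<^esub> y)"
    using * by blast+
  show "(x - y) \<otimes>\<^bsub>A\<^esub> z = (x \<otimes>\<^bsub>A\<^esub> z) - (y \<otimes>\<^bsub>A\<^esub> z)" "x \<otimes>\<^bsub>A\<^esub> (y - z) = (x \<otimes>\<^bsub>A\<^esub> y) - (x \<otimes>\<^bsub>A\<^esub> z)"
    using add(1)[of "x - y" y z] add(2)[of x "y - z" z] by simp_all
qed

lemma tens_closed: "x \<in> carrier A \<Longrightarrow> y \<in> carrier A \<Longrightarrow>
    x \<otimes>\<^bsub>A\<^esub> y \<in> tensor_space (smult A) (smult A) (carrier A) (carrier A)"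
  by (rule tens_in_tensor_space)

text \<open>A fixed expression of the coproduct as a finite sum of pure tensors; it reduces
  identities of Sweedler sums to identities of list sums.\<close>

definition rep :: "'a \<Rightarrow> ('a \<times> 'a) list" where
  "rep x = (SOME xs. set xs \<subseteq> carrier A \<times> carrier A \<and> comult A x = (\<Sum>(a, b)\<leftarrow>xs. a \<otimes>\<^bsub>A\<^esub> b))"

lemma rep:
  assumes "x \<in> carrier A"
  shows "set (rep x) \<subseteq> carrier A \<times> carrier A" "comult A x = (\<Sum>(a, b)\<leftarrow>rep x. a \<otimes>\<^bsub>A\<^esub> b)"
proof -
  have "\<exists>xs. set xs \<subseteq> carrier A \<times> carrier A \<and> comult A x = (\<Sum>(a, b)\<leftarrow>xs. a \<otimes>\<^bsub>A\<^esub> b)"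
    using comult_cl[OF assms] by (auto simp: tensor_space_def)
  from someI_ex[OF this] show "set (rep x) \<subseteq> carrier A \<times> carrier A"
    "comult A x = (\<Sum>(a, b)\<leftarrow>rep x. a \<otimes>\<^bsub>A\<^esub> b)" unfolding rep_def by auto
qed

lemma rep_mem:
  assumes "x \<in> carrier A" "(a, b) \<in> set (rep x)"
  shows "a \<in> carrier A" "b \<in> carrier A"
  using rep(1)[OF assms(1)] assms(2) by auto

lemma sweedler_rep:
  assumes "bil A s F" "x \<in> carrier A"
  shows "sweedler A F x = (\<Sum>(a, b)\<leftarrow>rep x. F a b)"
  unfolding rep(2)[OF assms(2)]
  by (rule tensor_lift_sum[OF vs vs _ sub sub _ rep(1)[OF assms(2)], of s]) (use assms(1) in \<open>auto simp: bil_def\<close>)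

lemma sweedler_cong:
  assumes "\<And>a b. a \<in> carrier A \<Longrightarrow> b \<in> carrier A \<Longrightarrow> F a b = G a b"
  shows "sweedler A F x = sweedler A G x"
  by (rule tensor_lift_cong) (rule assms)

lemma sweedler_linear:
  assumes "bil A s F"
  shows "lin A s (sweedler A F)"
proof -
  have *: "linear_on fscale s (tensor_space (smult A) (smult A) (carrier A) (carrier A))
     (tensor_lift (smult A) (smult A) (carrier A) (carrier A) F)"
    by (rule linear_on_tensor_lift[OF vs vs _ sub sub]) (use assms in \<open>auto simp: bil_def\<close>)
  show ?thesis
    by (rule linI) (use assms comult_lin comult_cl * in \<open>auto simp: bil_def linear_on_def\<close>)
qed

lemmas sweedler_add = linD(2)[OF sweedler_linear]
lemmas sweedler_smult = linD(3)[OF sweedler_linear]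

lemma sweedler_minus:
  assumes "bil A s F" "x \<in> carrier A" "y \<in> carrier A"
  shows "sweedler A F (x - y) = sweedler A F x - sweedler A F y"
  using sweedler_add[OF assms(1), of "x - y" y] assms(2,3) by simp

lemma bil_add: "bil A s F \<Longrightarrow> bil A s G \<Longrightarrow> bil A s (\<lambda>u v. F u v + G u v)"
  by (rule bilI) (auto simp: bilD algebra_simps vector_space_distrib[OF bilD(1)])

lemma sweedler_plus:
  assumes "bil A s F" "bil A s G" "x \<in> carrier A"
  shows "sweedler A (\<lambda>u v. F u v + G u v) x = sweedler A F x + sweedler A G x"
proof -
  have "(\<Sum>(a, b)\<leftarrow>xs. F a b + G a b) = (\<Sum>(a, b)\<leftarrow>xs. F a b) + (\<Sum>(a, b)\<leftarrow>xs. G a b)" for xs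
    by (induction xs) (auto simp: algebra_simps)
  then show ?thesis
    using sweedler_rep[OF bil_add[OF assms(1,2)] assms(3)] sweedler_rep[OF assms(1,3)] sweedler_rep[OF assms(2,3)]
    by metis
qed

lemma bil_smult:
  assumes "bil A s F" shows "bil A s (\<lambda>u v. s c (F u v))"
  by (rule bilI) (use assms in \<open>auto simp: bilD vector_space_distrib[OF bilD(1)[OF assms]] mult.commute\<close>)

lemma bil_hom:
  assumes F: "bil A s F" and h: "linear_on s s' D h" "vector_space s'"
    and FD: "\<And>a b. a \<in> carrier A \<Longrightarrow> b \<in> carrier A \<Longrightarrow> F a b \<in> D"
  shows "bil A s' (\<lambda>u v. h (F u v))"
  by (rule bilI) (use F h FD in \<open>auto simp: bilD linear_on_def\<close>)

text \<open>The domain D matters because maps such as \<open>tensor_lift\<close> are linear only on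
  a subspace of their type; as D is a subspace, the partial sums stay in it together with the
  summands.\<close>

lemma sweedler_hom:
  assumes F: "bil A s F" and h: "linear_on s s' D h" "vector_space s'" "module.subspace s D"
    and FD: "\<And>a b. a \<in> carrier A \<Longrightarrow> b \<in> carrier A \<Longrightarrow> F a b \<in> D"
    and x: "x \<in> carrier A"
  shows "h (sweedler A F x) = sweedler A (\<lambda>u v. h (F u v)) x"
proof -
  have "bil A s' (\<lambda>u v. h (F u v))" using bil_hom[OF F h(1,2)] FD by blast
  from sweedler_rep[OF this x] show ?thesis
    unfolding sweedler_rep[OF F x]
    by (simp only:) (rule linear_on_subspace_sum_list[OF bilD(1)[OF F] h(3,1)], use FD rep_mem[OF x] in auto)
qed

lemma sweedler_mem:
  assumes F: "bil A s F" and D: "module.subspace s D"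
    and FD: "\<And>a b. a \<in> carrier A \<Longrightarrow> b \<in> carrier A \<Longrightarrow> F a b \<in> D"
    and x: "x \<in> carrier A"
  shows "sweedler A F x \<in> D"
  unfolding sweedler_rep[OF F x] by (rule subspace_sum_list[OF bilD(1)[OF F] D]) (use FD rep_mem[OF x] in auto)

lemma sweedler_smult_fun:
  assumes "bil A s F" "x \<in> carrier A"
  shows "sweedler A (\<lambda>u v. s c (F u v)) x = s c (sweedler A F x)"
proof -
  interpret vector_space s by (rule bilD(1)[OF assms(1)])
  show ?thesis
    by (rule sweedler_hom[OF assms(1) _ bilD(1)[OF assms(1)] subspace_UNIV _ assms(2), symmetric])
      (auto simp: linear_on_def scale_right_distrib mult.commute)
qed

lemma bil_tens: "bil A fscale (\<lambda>u v. u \<otimes>\<^bsub>A\<^esub> v)"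
  by (rule bilI) (auto simp: tens_distrib vector_space_fscale)

lemma sweedler_tens: "x \<in> carrier A \<Longrightarrow> sweedler A (\<lambda>u v. u \<otimes>\<^bsub>A\<^esub> v) x = comult A x"
  using sweedler_rep[OF bil_tens] rep(2) by simp

text \<open>A lift is itself linear on the tensor space and therefore passes under a Sweedler sum of
  tensors. This evaluates bilinear maps on coproducts that are given by a Sweedler formula.\<close>

lemma tensor_lift_sweedler:
  assumes s': "vector_space s'" "module.subspace s' V" and s: "vector_space s" and F: "bilinear_on s' s' s V V F"
    and G: "bil A fscale G"
    and GV: "\<And>a b. a \<in> carrier A \<Longrightarrow> b \<in> carrier A \<Longrightarrow> G a b \<in> tensor_space s' s' V V"
    and x: "x \<in> carrier A"
  shows "tensor_lift s' s' V V F (sweedler A G x) = sweedler A (\<lambda>u v. tensor_lift s' s' V V F (G u v)) x"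
  by (rule sweedler_hom[OF G linear_on_tensor_lift[OF s'(1) s'(1) s s'(2) s'(2) F] s
        subspace_tensor_space[OF s'(1) s'(1) s'(2) s'(2)] _ x]) (rule GV)

end

lemma tri_vs: "tri A s G \<Longrightarrow> vector_space s" by (simp add: tri_def)

context comult_space begin

lemma bil_sweedler_right:
  assumes "tri A s G"
  shows "bil A s (\<lambda>u v. sweedler A (G u) v)"
proof (rule bilI)
  have b: "bil A s (G u)" if "u \<in> carrier A" for u using assms that by (simp add: tri_def)
  have l: "lin A s (\<lambda>u. G u v w)" if "v \<in> carrier A" "w \<in> carrier A" for v w using assms that by (simp add: tri_def)
  show "vector_space s" using assms tri_vs by blast
  show "sweedler A (G x) (y + z) = sweedler A (G x) y + sweedler A (G x) z"
    if "x \<in> carrier A" "y \<in> carrier A" "z \<in> carrier A" for x y z using sweedler_add[OF b] that by blast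
  show "sweedler A (G x) (c \<odot> y) = s c (sweedler A (G x) y)"
    if "x \<in> carrier A" "y \<in> carrier A" for x y c using sweedler_smult[OF b] that by blast
  show "sweedler A (G (x + y)) z = sweedler A (G x) z + sweedler A (G y) z"
    if "x \<in> carrier A" "y \<in> carrier A" "z \<in> carrier A" for x y z
  proof -
    have "sweedler A (G (x + y)) z = sweedler A (\<lambda>v w. G x v w + G y v w) z"
      by (rule sweedler_cong) (use that in \<open>auto simp: linD(2,3)[OF l]\<close>)
    then show ?thesis using sweedler_plus[OF b b] that by simp
  qed
  show "sweedler A (G (c \<odot> x)) y = s c (sweedler A (G x) y)"
    if "x \<in> carrier A" "y \<in> carrier A" for x y c
  proof -
    have "sweedler A (G (c \<odot> x)) y = sweedler A (\<lambda>v w. s c (G x v w)) y"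
      by (rule sweedler_cong) (use that in \<open>auto simp: linD(2,3)[OF l]\<close>)
    then show ?thesis using sweedler_smult_fun[OF b] that by simp
  qed
qed

text \<open>Here y is fixed while u and v are parameters. This is the bilinearity of the outer
  summand in nested sums over two different elements, as in the coproduct of a product.\<close>

lemma bil_sweedler_param:
  assumes y: "y \<in> carrier A"
    and b: "\<And>u v. u \<in> carrier A \<Longrightarrow> v \<in> carrier A \<Longrightarrow> bil A s (H u v)"
    and l: "\<And>y1 y2. y1 \<in> carrier A \<Longrightarrow> y2 \<in> carrier A \<Longrightarrow> bil A s (\<lambda>u v. H u v y1 y2)"
  shows "bil A s (\<lambda>u v. sweedler A (H u v) y)"
proof (rule bilI)
  show "vector_space s" using bilD(1)[OF b[of 0 0]] by simp
  show "sweedler A (H (u + v) w) y = sweedler A (H u w) y + sweedler A (H v w) y"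
    if "u \<in> carrier A" "v \<in> carrier A" "w \<in> carrier A" for u v w
  proof -
    have "sweedler A (H (u + v) w) y = sweedler A (\<lambda>y1 y2. H u w y1 y2 + H v w y1 y2) y"
      by (rule sweedler_cong) (use that in \<open>simp add: bilD(2)[OF l]\<close>)
    then show ?thesis using sweedler_plus[OF b b y] that by simp
  qed
  show "sweedler A (H w (u + v)) y = sweedler A (H w u) y + sweedler A (H w v) y"
    if "w \<in> carrier A" "u \<in> carrier A" "v \<in> carrier A" for u v w
  proof -
    have "sweedler A (H w (u + v)) y = sweedler A (\<lambda>y1 y2. H w u y1 y2 + H w v y1 y2) y"
      by (rule sweedler_cong) (use that in \<open>simp add: bilD(3)[OF l]\<close>)
    then show ?thesis using sweedler_plus[OF b b y] that by simp
  qed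
  show "sweedler A (H (c \<odot> u) v) y = s c (sweedler A (H u v) y)"
    if "u \<in> carrier A" "v \<in> carrier A" for c u v
  proof -
    have "sweedler A (H (c \<odot> u) v) y = sweedler A (\<lambda>y1 y2. s c (H u v y1 y2)) y"
      by (rule sweedler_cong) (use that in \<open>simp add: bilD(4)[OF l]\<close>)
    then show ?thesis using sweedler_smult_fun[OF b y] that by simp
  qed
  show "sweedler A (H u (c \<odot> v)) y = s c (sweedler A (H u v) y)"
    if "u \<in> carrier A" "v \<in> carrier A" for c u v
  proof -
    have "sweedler A (H u (c \<odot> v)) y = sweedler A (\<lambda>y1 y2. s c (H u v y1 y2)) y"
      by (rule sweedler_cong) (use that in \<open>simp add: bilD(5)[OF l]\<close>)
    then show ?thesis using sweedler_smult_fun[OF b y] that by simp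
  qed
qed

text \<open>The cyclic shift makes the third slot the parameter, so that contraction of the first
  two slots becomes an instance of contraction of the last two.\<close>

lemma tri_rotate: "tri A s G \<Longrightarrow> tri A s (\<lambda>w u v. G u v w)"
  unfolding tri_def bil_def lin_def bilinear_on_def by blast

lemma bil_sweedler_left:
  assumes "tri A s G"
  shows "bil A s (\<lambda>u v. sweedler A (\<lambda>u1 u2. G u1 u2 v) u)"
  using bil_sweedler_right[OF tri_rotate[OF assms]] by (auto simp: bil_def bilinear_on_def)

end

section \<open>Sweedler calculus from the Hopf axioms\<close>

context hopf_core begin

sublocale comult_space A
  by (rule comult_space.intro) (rule vector_space_smult subspace_carrier comult_closed comult_linear; assumption?)+

lemma mult_distrib:
  assumes "x \<in> carrier A" "y \<in> carrier A"
  shows "z \<in> carrier A \<Longrightarrow> x \<cdot> (y + z) = x \<cdot> y + x \<cdot> z" "z \<in> carrier A \<Longrightarrow> (x + z) \<cdot> y = x \<cdot> y + z \<cdot> y"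
    "(c \<odot> x) \<cdot> y = c \<odot> (x \<cdot> y)" "x \<cdot> (c \<odot> y) = c \<odot> (x \<cdot> y)"
    "z \<in> carrier A \<Longrightarrow> x \<cdot> (y - z) = x \<cdot> y - x \<cdot> z" "z \<in> carrier A \<Longrightarrow> (x - z) \<cdot> y = x \<cdot> y - z \<cdot> y"
    "x \<cdot> (- y) = - (x \<cdot> y)" "(- x) \<cdot> y = - (x \<cdot> y)"
proof -
  have r: "x \<cdot> (y + z) = x \<cdot> y + x \<cdot> z" and l: "(x + y) \<cdot> z = x \<cdot> z + y \<cdot> z"
    and sl: "(c \<odot> x) \<cdot> y = c \<odot> (x \<cdot> y)" and sr: "x \<cdot> (c \<odot> y) = c \<odot> (x \<cdot> y)"
    if "x \<in> carrier A" "y \<in> carrier A" "z \<in> carrier A" for x y z c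
    using mult_bilinear that unfolding bilinear_on_def linear_on_def by auto
  show "z \<in> carrier A \<Longrightarrow> x \<cdot> (y + z) = x \<cdot> y + x \<cdot> z" using r assms by blast
  show "z \<in> carrier A \<Longrightarrow> (x + z) \<cdot> y = x \<cdot> y + z \<cdot> y" using l assms by blast
  show "(c \<odot> x) \<cdot> y = c \<odot> (x \<cdot> y)" using sl assms by blast
  show "x \<cdot> (c \<odot> y) = c \<odot> (x \<cdot> y)" using sr assms by blast
  show "z \<in> carrier A \<Longrightarrow> x \<cdot> (y - z) = x \<cdot> y - x \<cdot> z" using r[of x "y - z" z] assms by (simp add: algebra_simps)
  show "z \<in> carrier A \<Longrightarrow> (x - z) \<cdot> y = x \<cdot> y - z \<cdot> y" using l[of "x - z" z y] assms by (simp add: algebra_simps)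
  have x0: "x \<cdot> 0 = 0" using r[of x 0 0] assms by simp
  have y0: "0 \<cdot> y = 0" using l[of 0 0 y] assms by simp
  show "x \<cdot> (- y) = - (x \<cdot> y)" using r[of x "- y" y] assms x0 by (simp add: eq_neg_iff_add_eq_0)
  show "(- x) \<cdot> y = - (x \<cdot> y)" using l[of "- x" x y] assms y0 by (simp add: eq_neg_iff_add_eq_0)
qed

lemma mult_zero [simp]: "x \<in> carrier A \<Longrightarrow> x \<cdot> 0 = 0" "x \<in> carrier A \<Longrightarrow> 0 \<cdot> x = 0"
  using mult_distrib(5)[of x x x] mult_distrib(6)[of x x x] by simp_all

lemma counit_distrib:
  "x \<in> carrier A \<Longrightarrow> y \<in> carrier A \<Longrightarrow> counit A (x + y) = counit A x + counit A y"
  "x \<in> carrier A \<Longrightarrow> counit A (c \<odot> x) = c * counit A x"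
  "x \<in> carrier A \<Longrightarrow> y \<in> carrier A \<Longrightarrow> counit A (x - y) = counit A x - counit A y"
  "counit A 0 = 0"
proof -
  have add: "counit A (x + y) = counit A x + counit A y" if "x \<in> carrier A" "y \<in> carrier A" for x y
    using counit_linear that unfolding linear_on_def by blast
  show "x \<in> carrier A \<Longrightarrow> y \<in> carrier A \<Longrightarrow> counit A (x + y) = counit A x + counit A y" by (rule add)
  show "x \<in> carrier A \<Longrightarrow> counit A (c \<odot> x) = c * counit A x" using counit_linear unfolding linear_on_def by blast
  show "counit A (x - y) = counit A x - counit A y" if "x \<in> carrier A" "y \<in> carrier A"
    using add[of "x - y" y] that by simp
  show "counit A 0 = 0" using linear_on_zero[OF counit_linear] by simp
qed

lemma antipode_distrib:
  "x \<in> carrier A \<Longrightarrow> y \<in> carrier A \<Longrightarrow> antipode A (x + y) = antipode A x + antipode A y"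
  "x \<in> carrier A \<Longrightarrow> antipode A (c \<odot> x) = c \<odot> antipode A x"
  "x \<in> carrier A \<Longrightarrow> y \<in> carrier A \<Longrightarrow> antipode A (x - y) = antipode A x - antipode A y"
  "antipode A 0 = 0"
proof -
  have add: "antipode A (x + y) = antipode A x + antipode A y" if "x \<in> carrier A" "y \<in> carrier A" for x y
    using antipode_linear that unfolding linear_on_def by blast
  show "x \<in> carrier A \<Longrightarrow> y \<in> carrier A \<Longrightarrow> antipode A (x + y) = antipode A x + antipode A y" by (rule add)
  show "x \<in> carrier A \<Longrightarrow> antipode A (c \<odot> x) = c \<odot> antipode A x" using antipode_linear unfolding linear_on_def by blast
  show "antipode A (x - y) = antipode A x - antipode A y" if "x \<in> carrier A" "y \<in> carrier A"
    using add[of "x - y" y] that by simp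
  show "antipode A 0 = 0" using linear_on_zero[OF antipode_linear] by simp
qed

lemmas closed [simp] = mult_closed unit_closed antipode_closed
lemmas unit [simp] = unit_left unit_right counit_unit

lemma sweedler_closed:
  "bil A (smult A) F \<Longrightarrow> (\<And>a b. a \<in> carrier A \<Longrightarrow> b \<in> carrier A \<Longrightarrow> F a b \<in> carrier A) \<Longrightarrow>
    x \<in> carrier A \<Longrightarrow> sweedler A F x \<in> carrier A"
  by (rule sweedler_mem[OF _ sub])

text \<open>The axiom is an equation in A (x) (A (x) A). A trilinear G induces a linear map on that
  space, and applying it to both sides extends the axiom to arbitrary summands.\<close>

lemma sweedler_coassoc:
  assumes G: "tri A s G" and x: "x \<in> carrier A"
  shows "sweedler A (\<lambda>u v. sweedler A (\<lambda>u1 u2. G u1 u2 v) u) x = sweedler A (\<lambda>u v. sweedler A (G u) v) x"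
proof -
  let ?C = "carrier A" let ?sA = "smult A"
  let ?T = "tensor_space ?sA ?sA ?C ?C"
  have s: "vector_space s" using G tri_vs by blast
  have sT: "module.subspace fscale ?T" by (rule subspace_tensor_space[OF vs vs sub sub])
  \<comment> \<open>For fixed u this is the linear map on A (x) A induced by \<open>G u\<close>; a
    second lift, in the variable u, gives the map \<open>?B\<close> on the threefold tensor
    product.\<close>
  define B where "B = (\<lambda>u t. tensor_lift ?sA ?sA ?C ?C (G u) t)"
  have b: "bil A s (G u)" if "u \<in> ?C" for u using G that by (simp add: tri_def)
  have Glin: "lin A s (\<lambda>u. G u v w)" if "v \<in> ?C" "w \<in> ?C" for v w using G that by (simp add: tri_def)
  have Bt: "B u (v \<otimes>\<^bsub>A\<^esub> w) = G u v w" if "u \<in> ?C" "v \<in> ?C" "w \<in> ?C" for u v w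
    unfolding B_def using tensor_lift_tens[OF vs vs s sub sub _ that(2,3)] b[OF that(1)] by (simp add: bil_def)
  have Blin: "linear_on fscale s ?T (B u)" if "u \<in> ?C" for u
    unfolding B_def using linear_on_tensor_lift[OF vs vs s sub sub] b[OF that] by (simp add: bil_def)
  have Bs: "B u (\<Sum>(a, b)\<leftarrow>xs. a \<otimes>\<^bsub>A\<^esub> b) = (\<Sum>(a, b)\<leftarrow>xs. G u a b)" if "u \<in> ?C" "set xs \<subseteq> ?C \<times> ?C" for u xs
    unfolding B_def using tensor_lift_sum[OF vs vs s sub sub _ that(2)] b[OF that(1)] by (simp add: bil_def)
  have BB: "bilinear_on ?sA fscale s ?C ?T B"
    unfolding bilinear_on_def
  proof (intro conjI ballI)
    show "linear_on fscale s ?T (B u)" if "u \<in> ?C" for u using Blin that .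
    fix t assume "t \<in> ?T"
    then obtain xs where xs: "set xs \<subseteq> ?C \<times> ?C" "t = (\<Sum>(a, b)\<leftarrow>xs. a \<otimes>\<^bsub>A\<^esub> b)" by (auto simp: tensor_space_def)
    interpret v3: vector_space s by fact
    have "(\<Sum>(a, b)\<leftarrow>xs. G (u + u') a b) = (\<Sum>(a, b)\<leftarrow>xs. G u a b) + (\<Sum>(a, b)\<leftarrow>xs. G u' a b)" if "u \<in> ?C" "u' \<in> ?C" for u u'
      using xs(1) by (induction xs) (use that in \<open>auto simp: linD(2)[OF Glin] algebra_simps\<close>)
    moreover have "(\<Sum>(a, b)\<leftarrow>xs. G (c \<odot> u) a b) = s c (\<Sum>(a, b)\<leftarrow>xs. G u a b)" if "u \<in> ?C" for u c
      using xs(1) by (induction xs) (use that in \<open>auto simp: linD(3)[OF Glin] v3.scale_right_distrib\<close>)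
    ultimately show "linear_on ?sA s ?C (\<lambda>u. B u t)"
      by (auto simp: linear_on_def xs(2) Bs[OF _ xs(1)])
  qed
  let ?B = "tensor_lift ?sA fscale ?C ?T B"
  have BT: "?B (tens ?sA fscale u t) = B u t" if "u \<in> ?C" "t \<in> ?T" for u t
    by (rule tensor_lift_tens[OF vs vector_space_fscale s sub sT BB that])
  let ?T3 = "tensor_space ?sA fscale ?C ?T"
  have hlin: "linear_on fscale s ?T3 ?B" by (rule linear_on_tensor_lift[OF vs vector_space_fscale s sub sT BB])
  have T3: "module.subspace fscale ?T3" by (rule subspace_tensor_space[OF vs vector_space_fscale sub sT])
  have tens3: "tens ?sA fscale (u + u') t = tens ?sA fscale u t + tens ?sA fscale u' t"
     "tens ?sA fscale u (t + t') = tens ?sA fscale u t + tens ?sA fscale u t'"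
     "tens ?sA fscale (c \<odot> u) t = fscale c (tens ?sA fscale u t)"
     "tens ?sA fscale u (fscale c t) = fscale c (tens ?sA fscale u t)"
    for u u' c and t t' :: "('k, 'a, 'a) tensor"
    using bilinear_on_tens[OF vs vector_space_fscale[where 'i="'a \<Rightarrow> 'a \<Rightarrow> 'k"]] unfolding bilinear_on_def linear_on_def by auto
  have tri3: "tri A fscale (\<lambda>u1 u2 v. tens ?sA fscale u1 (u2 \<otimes>\<^bsub>A\<^esub> v))"
    by (rule triI) (auto simp: tens3 tens_distrib vector_space_fscale)
  have tm: "tens ?sA fscale u t \<in> ?T3" if "u \<in> ?C" "t \<in> ?T" for u t by (rule tens_in_tensor_space[OF that])
  have bilr: "bil A fscale (\<lambda>u v. tens ?sA fscale u (comult A v))"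
    using comult_lin by (intro bilI) (auto simp: tens3 vector_space_fscale linear_on_def)
  have b1: "bil A fscale (\<lambda>u1 u2. tens ?sA fscale u1 (u2 \<otimes>\<^bsub>A\<^esub> v))" if "v \<in> ?C" for v
    by (rule bilI) (auto simp: tens3 tens_distrib vector_space_fscale)
  have "?B (sweedler A (\<lambda>u v. sweedler A (\<lambda>u1 u2. tens ?sA fscale u1 (u2 \<otimes>\<^bsub>A\<^esub> v)) u) x)
      = sweedler A (\<lambda>u v. ?B (sweedler A (\<lambda>u1 u2. tens ?sA fscale u1 (u2 \<otimes>\<^bsub>A\<^esub> v)) u)) x"
    by (rule sweedler_hom[OF bil_sweedler_left[OF tri3] hlin s T3 _ x])
      (auto intro!: sweedler_mem[OF b1 T3] tm tens_closed)
  also have "\<dots> = sweedler A (\<lambda>u v. sweedler A (\<lambda>u1 u2. G u1 u2 v) u) x"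
  proof (rule sweedler_cong)
    fix u v assume uv: "u \<in> ?C" "v \<in> ?C"
    have "?B (sweedler A (\<lambda>u1 u2. tens ?sA fscale u1 (u2 \<otimes>\<^bsub>A\<^esub> v)) u) =
       sweedler A (\<lambda>u1 u2. ?B (tens ?sA fscale u1 (u2 \<otimes>\<^bsub>A\<^esub> v))) u"
      by (rule sweedler_hom[OF b1[OF uv(2)] hlin s T3 _ uv(1)]) (auto intro!: tm tens_closed uv)
    also have "\<dots> = sweedler A (\<lambda>u1 u2. G u1 u2 v) u"
      by (rule sweedler_cong) (auto simp: BT Bt uv tens_closed)
    finally show "?B (sweedler A (\<lambda>u1 u2. tens ?sA fscale u1 (u2 \<otimes>\<^bsub>A\<^esub> v)) u) = sweedler A (\<lambda>u1 u2. G u1 u2 v) u" .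
  qed
  finally have l: "?B (sweedler A (\<lambda>u v. sweedler A (\<lambda>u1 u2. tens ?sA fscale u1 (u2 \<otimes>\<^bsub>A\<^esub> v)) u) x) = \<dots>" .
  have "?B (sweedler A (\<lambda>u v. tens ?sA fscale u (comult A v)) x) = sweedler A (\<lambda>u v. ?B (tens ?sA fscale u (comult A v))) x"
    by (rule sweedler_hom[OF bilr hlin s T3 _ x]) (auto intro!: tm comult_cl)
  also have "\<dots> = sweedler A (\<lambda>u v. sweedler A (G u) v) x"
    by (rule sweedler_cong) (use BT comult_cl in \<open>simp add: B_def\<close>)
  finally show ?thesis using l coassoc[OF x] by simp
qed

lemma lin_bil_left: "lin A s f \<Longrightarrow> bil A s (\<lambda>u v. s (counit A u) (f v))"
  by (rule bilI) (auto simp: linD counit_distrib vector_space_distrib[OF linD(1)] mult.commute)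

lemma lin_bil_right: "lin A s f \<Longrightarrow> bil A s (\<lambda>u v. s (counit A v) (f u))"
  by (rule bilI) (auto simp: linD counit_distrib vector_space_distrib[OF linD(1)] mult.commute)

lemma lin_id: "lin A (smult A) (\<lambda>x. x)" by (rule linI) (auto simp: vs)

lemma sweedler_counit_left:
  assumes "lin A s f" "x \<in> carrier A"
  shows "sweedler A (\<lambda>u v. s (counit A u) (f v)) x = f x"
proof -
  have "f x = f (sweedler A (\<lambda>u v. counit A u \<odot> v) x)" using counit_left assms by simp
  also have "\<dots> = sweedler A (\<lambda>u v. f (counit A u \<odot> v)) x"
    by (rule sweedler_hom[OF lin_bil_left[OF lin_id] _ linD(1)[OF assms(1)] sub _ assms(2)])
      (use assms in \<open>auto simp: lin_def\<close>)
  also have "\<dots> = sweedler A (\<lambda>u v. s (counit A u) (f v)) x"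
    by (rule sweedler_cong) (use assms in \<open>simp add: linD\<close>)
  finally show ?thesis ..
qed

lemma sweedler_counit_right:
  assumes "lin A s f" "x \<in> carrier A"
  shows "sweedler A (\<lambda>u v. s (counit A v) (f u)) x = f x"
proof -
  have "f x = f (sweedler A (\<lambda>u v. counit A v \<odot> u) x)" using counit_right assms by simp
  also have "\<dots> = sweedler A (\<lambda>u v. f (counit A v \<odot> u)) x"
    by (rule sweedler_hom[OF lin_bil_right[OF lin_id] _ linD(1)[OF assms(1)] sub _ assms(2)])
      (use assms in \<open>auto simp: lin_def\<close>)
  also have "\<dots> = sweedler A (\<lambda>u v. s (counit A v) (f u)) x"
    by (rule sweedler_cong) (use assms in \<open>simp add: linD\<close>)
  finally show ?thesis ..
qed

lemma sweedler_one:
  assumes "bil A s F" shows "sweedler A F \<one> = F \<one> \<one>"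
  unfolding comult_unit by (rule tensor_lift_tens[OF vs vs _ sub sub]) (use assms in \<open>auto simp: bil_def\<close>)

text \<open>In the convolution algebra, \<open>T = T * (id * S) = (T * id) * S = S\<close>.\<close>

lemma antipode_unique:
  assumes T: "lin A (smult A) T" and Tc: "\<And>x. x \<in> carrier A \<Longrightarrow> T x \<in> carrier A"
    and inv: "\<And>x. x \<in> carrier A \<Longrightarrow> sweedler A (\<lambda>u v. T u \<cdot> v) x = counit A x \<odot> \<one>"
    and x: "x \<in> carrier A"
  shows "T x = antipode A x"
proof -
  note d = linD(2,3)[OF T] Tc mult_distrib smult_distrib antipode_distrib vs mult_assoc
  have t: "tri A (smult A) (\<lambda>u v w. T u \<cdot> (v \<cdot> antipode A w))"
    by (rule triI) (auto simp: d)
  have b1: "bil A (smult A) (\<lambda>v w. v \<cdot> antipode A w)" by (rule bilI) (auto simp: d)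
  have b2: "bil A (smult A) (\<lambda>v w. T v \<cdot> w)" by (rule bilI) (auto simp: d)
  have "T x = sweedler A (\<lambda>u v. counit A v \<odot> T u) x"
    using sweedler_counit_right[OF T x] by simp
  also have "\<dots> = sweedler A (\<lambda>u v. sweedler A (\<lambda>v w. T u \<cdot> (v \<cdot> antipode A w)) v) x"
  proof (rule sweedler_cong)
    fix u v assume uv: "u \<in> carrier A" "v \<in> carrier A"
    have "T u \<cdot> sweedler A (\<lambda>v w. v \<cdot> antipode A w) v = sweedler A (\<lambda>v w. T u \<cdot> (v \<cdot> antipode A w)) v"
      by (rule sweedler_hom[OF b1 _ vs sub]) (use uv in \<open>auto simp: linear_on_def d\<close>)
    then show "counit A v \<odot> T u = sweedler A (\<lambda>v w. T u \<cdot> (v \<cdot> antipode A w)) v"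
      using uv by (simp add: antipode_right d)
  qed
  also have "\<dots> = sweedler A (\<lambda>u w. sweedler A (\<lambda>u v. T u \<cdot> (v \<cdot> antipode A w)) u) x"
    using sweedler_coassoc[OF t x] by simp
  also have "\<dots> = sweedler A (\<lambda>u w. counit A u \<odot> antipode A w) x"
  proof (rule sweedler_cong)
    fix u w assume uw: "u \<in> carrier A" "w \<in> carrier A"
    have "sweedler A (\<lambda>u v. T u \<cdot> v) u \<cdot> antipode A w = sweedler A (\<lambda>u v. (T u \<cdot> v) \<cdot> antipode A w) u"
      by (rule sweedler_hom[OF b2 _ vs sub]) (use uw in \<open>auto simp: linear_on_def d\<close>)
    also have "\<dots> = sweedler A (\<lambda>u v. T u \<cdot> (v \<cdot> antipode A w)) u"
      by (rule sweedler_cong) (use uw in \<open>auto simp: d\<close>)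
    finally show "sweedler A (\<lambda>u v. T u \<cdot> (v \<cdot> antipode A w)) u = counit A u \<odot> antipode A w"
      using uw by (simp add: inv d)
  qed
  also have "\<dots> = antipode A x"
    using sweedler_counit_left[of "smult A" "antipode A" x] x by (simp add: lin_def antipode_linear vs)
  finally show ?thesis .
qed

end

context hopf_algebra begin

text \<open>The right-hand side of the axiom \<open>comult_mult\<close> is a double Sweedler sum of
  tensors; the lift of F is linear and is moved under both sums.\<close>

lemma sweedler_mult:
  assumes F: "bil A s F" and x: "x \<in> carrier A" and y: "y \<in> carrier A"
  shows "sweedler A F (x \<cdot> y) = sweedler A (\<lambda>x1 x2. sweedler A (\<lambda>y1 y2. F (x1 \<cdot> y1) (x2 \<cdot> y2)) y) x"
proof -
  let ?C = "carrier A" let ?sA = "smult A"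
  let ?T = "tensor_space ?sA ?sA ?C ?C"
  have s: "vector_space s" using bilD(1)[OF F] .
  have sT: "module.subspace fscale ?T" by (rule subspace_tensor_space[OF vs vs sub sub])
  note d = mult_distrib tens_distrib vector_space_fscale
  have b: "bil A fscale (\<lambda>y1 y2. (x1 \<cdot> y1) \<otimes>\<^bsub>A\<^esub> (x2 \<cdot> y2))" if "x1 \<in> ?C" "x2 \<in> ?C" for x1 x2
    using that by (intro bilI) (auto simp: d)
  have bb': "bil A fscale (\<lambda>x1 x2. sweedler A (\<lambda>y1 y2. (x1 \<cdot> y1) \<otimes>\<^bsub>A\<^esub> (x2 \<cdot> y2)) y)"
    by (rule bil_sweedler_param[OF y b]) (auto intro!: bilI simp: d)
  have Fb: "bilinear_on ?sA ?sA s ?C ?C F" using F by (simp add: bil_def)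
  have "sweedler A F (x \<cdot> y) = tensor_lift ?sA ?sA ?C ?C F (sweedler A (\<lambda>x1 x2. sweedler A (\<lambda>y1 y2. (x1 \<cdot> y1) \<otimes>\<^bsub>A\<^esub> (x2 \<cdot> y2)) y) x)"
    by (simp only: comult_mult[OF x y])
  also have "\<dots> = sweedler A (\<lambda>x1 x2. tensor_lift ?sA ?sA ?C ?C F (sweedler A (\<lambda>y1 y2. (x1 \<cdot> y1) \<otimes>\<^bsub>A\<^esub> (x2 \<cdot> y2)) y)) x"
    by (rule tensor_lift_sweedler[OF vs sub s Fb bb' _ x]) (auto intro!: sweedler_mem[OF b sT] tens_closed y)
  also have "\<dots> = sweedler A (\<lambda>x1 x2. sweedler A (\<lambda>y1 y2. F (x1 \<cdot> y1) (x2 \<cdot> y2)) y) x"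
  proof (rule sweedler_cong)
    fix x1 x2 assume xx: "x1 \<in> ?C" "x2 \<in> ?C"
    have "tensor_lift ?sA ?sA ?C ?C F (sweedler A (\<lambda>y1 y2. (x1 \<cdot> y1) \<otimes>\<^bsub>A\<^esub> (x2 \<cdot> y2)) y) =
      sweedler A (\<lambda>y1 y2. tensor_lift ?sA ?sA ?C ?C F ((x1 \<cdot> y1) \<otimes>\<^bsub>A\<^esub> (x2 \<cdot> y2))) y"
      by (rule tensor_lift_sweedler[OF vs sub s Fb b[OF xx] _ y]) (simp add: tens_closed xx)
    also have "\<dots> = sweedler A (\<lambda>y1 y2. F (x1 \<cdot> y1) (x2 \<cdot> y2)) y"
      by (rule sweedler_cong) (simp add: tensor_lift_tens[OF vs vs s sub sub Fb] xx)
    finally show "tensor_lift ?sA ?sA ?C ?C F (sweedler A (\<lambda>y1 y2. (x1 \<cdot> y1) \<otimes>\<^bsub>A\<^esub> (x2 \<cdot> y2)) y) =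
      sweedler A (\<lambda>y1 y2. F (x1 \<cdot> y1) (x2 \<cdot> y2)) y" .
  qed
  finally show ?thesis .
qed

end

context hopf_algebra begin

lemma group_likeD:
  assumes "g \<in> group_like A"
  shows "g \<in> carrier A" "comult A g = g \<otimes>\<^bsub>A\<^esub> g" "counit A g = 1"
  using assms by (auto simp: group_like_def)

lemma sweedler_group_like:
  assumes "bil A s F" "g \<in> group_like A"
  shows "sweedler A F g = F g g"
  unfolding group_likeD(2)[OF assms(2)]
  by (rule tensor_lift_tens[OF vs vs _ sub sub]) (use assms group_likeD in \<open>auto simp: bil_def\<close>)

text \<open>The coproduct of g has the single term g (x) g, so in the formula for a product the sum
  belonging to g collapses.\<close>

lemma sweedler_mult_group_like:
  assumes F: "bil A s F" and g: "g \<in> group_like A" and x: "x \<in> carrier A"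
  shows "sweedler A F (x \<cdot> g) = sweedler A (\<lambda>u v. F (u \<cdot> g) (v \<cdot> g)) x"
    "sweedler A F (g \<cdot> x) = sweedler A (\<lambda>u v. F (g \<cdot> u) (g \<cdot> v)) x"
proof -
  note gC = group_likeD(1)[OF g]
  have 1: "bil A s (\<lambda>y1 y2. F (u \<cdot> y1) (v \<cdot> y2))" if "u \<in> carrier A" "v \<in> carrier A" for u v
    by (rule bilI) (use that in \<open>auto simp: bilD[OF F] mult_distrib\<close>)
  show "sweedler A F (x \<cdot> g) = sweedler A (\<lambda>u v. F (u \<cdot> g) (v \<cdot> g)) x"
    unfolding sweedler_mult[OF F x gC] by (rule sweedler_cong) (simp add: sweedler_group_like[OF 1 g])
  have 3: "bil A s (\<lambda>x1 x2. sweedler A (\<lambda>y1 y2. F (x1 \<cdot> y1) (x2 \<cdot> y2)) x)"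
    by (rule bil_sweedler_param[OF x 1]) (auto intro!: bilI simp: bilD[OF F] mult_distrib)
  show "sweedler A F (g \<cdot> x) = sweedler A (\<lambda>u v. F (g \<cdot> u) (g \<cdot> v)) x"
    unfolding sweedler_mult[OF F gC x] by (rule sweedler_group_like[OF 3 g])
qed

end

section \<open>Super-data and the coinvariant subalgebra\<close>

locale super_datum = hopf_algebra A for A :: "('k::field, 'a::ab_group_add) hopf" (structure) +
  fixes g :: 'a and \<alpha> :: "'a \<Rightarrow> 'k"
  assumes two: "(2::'k) \<noteq> 0" and datum: "(g, \<alpha>) \<in> super_data A"
begin

lemma g: "g \<in> group_like A" and gg: "g \<cdot> g = \<one>" and \<alpha>: "\<alpha> \<in> characters A" and \<alpha>g: "\<alpha> g = - 1"
  and conv: "convolution A \<alpha> \<alpha> = restrict (counit A) (carrier A)" and not_center: "g \<notin> center A"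
  using datum by (auto simp: super_data_def admissible_data_def)

lemma gC [simp]: "g \<in> carrier A" and counit_g [simp]: "counit A g = 1"
  using group_likeD[OF g] by auto

lemma \<alpha>_distrib:
  "x \<in> carrier A \<Longrightarrow> y \<in> carrier A \<Longrightarrow> \<alpha> (x + y) = \<alpha> x + \<alpha> y"
  "x \<in> carrier A \<Longrightarrow> \<alpha> (c \<odot> x) = c * \<alpha> x"
  "x \<in> carrier A \<Longrightarrow> y \<in> carrier A \<Longrightarrow> \<alpha> (x \<cdot> y) = \<alpha> x * \<alpha> y"
  "\<alpha> \<one> = 1"
  using \<alpha> by (auto simp: characters_def linear_on_def)

lemma \<alpha>\<alpha>: 
  assumes "x \<in> carrier A" shows "sweedler A (\<lambda>u v. \<alpha> u * \<alpha> v) x = counit A x"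
  using fun_cong[OF conv, of x] assms by (simp add: convolution_def)

definition L where "L = act_left A \<alpha>"
definition R where "R = (\<lambda>x. act_right A x \<alpha>)"
definition \<gamma> where "\<gamma> x = g \<cdot> x \<cdot> g"

lemma RL: "x \<in> carrier A \<Longrightarrow> R (L x) = \<gamma> x"
  using datum by (simp add: super_data_def L_def R_def \<gamma>_def)

lemma L_eq: "L x = sweedler A (\<lambda>u v. \<alpha> v \<odot> u) x" by (simp add: L_def act_left_def)
lemma R_eq: "R x = sweedler A (\<lambda>u v. \<alpha> u \<odot> v) x" by (simp add: R_def act_right_def)

lemma bilL: "bil A (smult A) (\<lambda>u v. \<alpha> v \<odot> u)"
  by (rule bilI) (auto simp: \<alpha>_distrib smult_distrib vs mult.commute)
lemma bilR: "bil A (smult A) (\<lambda>u v. \<alpha> u \<odot> v)"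
  by (rule bilI) (auto simp: \<alpha>_distrib smult_distrib vs mult.commute)

lemma LR_closed [simp]: "x \<in> carrier A \<Longrightarrow> L x \<in> carrier A" "x \<in> carrier A \<Longrightarrow> R x \<in> carrier A"
  "x \<in> carrier A \<Longrightarrow> \<gamma> x \<in> carrier A"
  unfolding L_eq R_eq \<gamma>_def by (auto intro!: sweedler_closed bilL bilR)

lemma lin_L: "lin A (smult A) L" unfolding L_eq[abs_def] by (rule sweedler_linear[OF bilL])
lemma lin_R: "lin A (smult A) R" unfolding R_eq[abs_def] by (rule sweedler_linear[OF bilR])

lemma lin_diff:
  assumes "lin A s f" "x \<in> carrier A" "y \<in> carrier A"
  shows "f (x - y) = f x - f y" "f (- x) = - f x"
proof -
  have *: "f (x - y) = f x - f y" if "x \<in> carrier A" "y \<in> carrier A" for x y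
    using linD(2)[OF assms(1), of "x - y" y] that by simp
  then show "f (x - y) = f x - f y" using assms by blast
  show "f (- x) = - f x"
    using *[of 0 x] linD(2)[OF assms(1), of 0 0] assms(2) by simp
qed

lemmas LR_distrib = linD(2,3)[OF lin_L] linD(2,3)[OF lin_R] lin_diff[OF lin_L] lin_diff[OF lin_R]

lemmas distrib = LR_distrib \<alpha>_distrib(1,2) mult_distrib smult_distrib counit_distrib antipode_distrib
  tens_distrib vs vector_space_fscale vector_space_mult

text \<open>L and R contract one leg with \<alpha>, and a linear f passes under the defining sum. In
  this form any sum with a factor \<alpha> on one leg is recognised as a value at L x or R
  x.\<close>

lemma sweedler_\<alpha>:
  assumes "lin A s f" "x \<in> carrier A"
  shows "sweedler A (\<lambda>u v. s (\<alpha> v) (f u)) x = f (L x)" "sweedler A (\<lambda>u v. s (\<alpha> u) (f v)) x = f (R x)"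
proof -
  have "f (L x) = sweedler A (\<lambda>u v. f (\<alpha> v \<odot> u)) x"
    unfolding L_eq by (rule sweedler_hom[OF bilL _ linD(1)[OF assms(1)] sub _ assms(2)]) (use assms in \<open>auto simp: lin_def\<close>)
  also have "\<dots> = sweedler A (\<lambda>u v. s (\<alpha> v) (f u)) x" by (rule sweedler_cong) (simp add: linD[OF assms(1)])
  finally show "sweedler A (\<lambda>u v. s (\<alpha> v) (f u)) x = f (L x)" ..
  have "f (R x) = sweedler A (\<lambda>u v. f (\<alpha> u \<odot> v)) x"
    unfolding R_eq by (rule sweedler_hom[OF bilR _ linD(1)[OF assms(1)] sub _ assms(2)]) (use assms in \<open>auto simp: lin_def\<close>)
  also have "\<dots> = sweedler A (\<lambda>u v. s (\<alpha> u) (f v)) x" by (rule sweedler_cong) (simp add: linD[OF assms(1)])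
  finally show "sweedler A (\<lambda>u v. s (\<alpha> u) (f v)) x = f (R x)" ..
qed

text \<open>All three are coassociativity of the threefold coproduct with \<alpha> evaluated on the
  last, the first and the middle leg, respectively. The third is the exchange rule: L on the left
  leg may be traded for R on the right leg.\<close>

lemma
  assumes F: "bil A s F" and x: "x \<in> carrier A"
  shows sweedler_L: "sweedler A F (L x) = sweedler A (\<lambda>u v. F u (L v)) x"
    and sweedler_R: "sweedler A F (R x) = sweedler A (\<lambda>u v. F (R u) v) x"
    and sweedler_LR: "sweedler A (\<lambda>u v. F (L u) v) x = sweedler A (\<lambda>u v. F u (R v)) x"
proof -
  have s: "vector_space s" by (rule bilD(1)[OF F])
  note d = bilD[OF F] distrib vector_space_distrib[OF s]
  have t: "tri A s (\<lambda>u v w. s (\<alpha> w) (F u v))" "tri A s (\<lambda>u v w. s (\<alpha> u) (F v w))" "tri A s (\<lambda>u v w. s (\<alpha> v) (F u w))"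
    by (rule triI; simp add: d mult.commute)+
  have l: "lin A s (F u)" "lin A s (\<lambda>v. F v u)" if "u \<in> carrier A" for u
    by (rule linI; simp add: d that)+
  have "sweedler A F (L x) = sweedler A (\<lambda>u v. sweedler A (\<lambda>u1 u2. s (\<alpha> v) (F u1 u2)) u) x"
    unfolding sweedler_\<alpha>(1)[OF sweedler_linear[OF F] x, symmetric]
    by (rule sweedler_cong) (simp add: sweedler_smult_fun[OF F])
  also have "\<dots> = sweedler A (\<lambda>u v. sweedler A (\<lambda>v1 v2. s (\<alpha> v2) (F u v1)) v) x"
    by (rule sweedler_coassoc[OF t(1) x])
  also have "\<dots> = sweedler A (\<lambda>u v. F u (L v)) x"
    by (rule sweedler_cong) (simp add: sweedler_\<alpha>(1)[OF l(1)])
  finally show "sweedler A F (L x) = sweedler A (\<lambda>u v. F u (L v)) x" .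
  have "sweedler A F (R x) = sweedler A (\<lambda>u v. sweedler A (\<lambda>v1 v2. s (\<alpha> u) (F v1 v2)) v) x"
    unfolding sweedler_\<alpha>(2)[OF sweedler_linear[OF F] x, symmetric]
    by (rule sweedler_cong) (simp add: sweedler_smult_fun[OF F])
  also have "\<dots> = sweedler A (\<lambda>u v. sweedler A (\<lambda>u1 u2. s (\<alpha> u1) (F u2 v)) u) x"
    by (rule sweedler_coassoc[OF t(2) x, symmetric])
  also have "\<dots> = sweedler A (\<lambda>u v. F (R u) v) x"
    by (rule sweedler_cong) (simp add: sweedler_\<alpha>(2)[OF l(2)])
  finally show "sweedler A F (R x) = sweedler A (\<lambda>u v. F (R u) v) x" .
  have "sweedler A (\<lambda>u v. F (L u) v) x = sweedler A (\<lambda>u v. sweedler A (\<lambda>u1 u2. s (\<alpha> u2) (F u1 v)) u) x"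
    by (rule sweedler_cong) (simp add: sweedler_\<alpha>(1)[OF l(2)])
  also have "\<dots> = sweedler A (\<lambda>u v. sweedler A (\<lambda>v1 v2. s (\<alpha> v1) (F u v2)) v) x"
    by (rule sweedler_coassoc[OF t(3) x])
  also have "\<dots> = sweedler A (\<lambda>u v. F u (R v)) x"
    by (rule sweedler_cong) (simp add: sweedler_\<alpha>(2)[OF l(1)])
  finally show "sweedler A (\<lambda>u v. F (L u) v) x = sweedler A (\<lambda>u v. F u (R v)) x" .
qed

lemma lin_\<alpha>: "lin A (*) \<alpha>" by (rule linI) (auto simp: distrib)
lemma lin_counit: "lin A (*) (counit A)" by (rule linI) (auto simp: distrib)

text \<open>Contracting one leg with \<alpha> and the other with \<alpha> gives the convolution
  square of \<alpha>, which is the counit; contracting the other leg with the counit returns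
  \<alpha>.\<close>

lemma
  assumes x: "x \<in> carrier A"
  shows \<alpha>_L: "\<alpha> (L x) = counit A x" and \<alpha>_R: "\<alpha> (R x) = counit A x"
    and counit_L: "counit A (L x) = \<alpha> x" and counit_R: "counit A (R x) = \<alpha> x"
  using \<alpha>\<alpha>[OF x] sweedler_\<alpha>[OF lin_\<alpha> x] sweedler_\<alpha>[OF lin_counit x]
    sweedler_counit_left[OF lin_\<alpha> x] sweedler_counit_right[OF lin_\<alpha> x]
  by (simp_all add: mult.commute)

lemma L_L [simp]: assumes x: "x \<in> carrier A" shows "L (L x) = x"
proof -
  have "L (L x) = sweedler A (\<lambda>u v. \<alpha> (L v) \<odot> u) x"
    unfolding L_eq[of "L x"] by (rule sweedler_L[OF bilL x])
  also have "\<dots> = sweedler A (\<lambda>u v. counit A v \<odot> u) x" by (rule sweedler_cong) (simp add: \<alpha>_L)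
  finally show ?thesis using counit_right x by simp
qed

text \<open>The coproduct and \<alpha> are both multiplicative, so the double sum over x and y
  factors into the sums that define \<open>L x\<close> and \<open>L y\<close>.\<close>

lemma L_mult:
  assumes x: "x \<in> carrier A" and y: "y \<in> carrier A"
  shows "L (x \<cdot> y) = L x \<cdot> L y"
proof -
  have "L (x \<cdot> y) = sweedler A (\<lambda>x1 x2. sweedler A (\<lambda>y1 y2. \<alpha> (x2 \<cdot> y2) \<odot> (x1 \<cdot> y1)) y) x"
    unfolding L_eq by (rule sweedler_mult[OF bilL x y])
  also have "\<dots> = sweedler A (\<lambda>x1 x2. (\<alpha> x2 \<odot> x1) \<cdot> L y) x"
  proof (rule sweedler_cong)
    fix x1 x2 assume xx: "x1 \<in> carrier A" "x2 \<in> carrier A"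
    have "(\<alpha> x2 \<odot> x1) \<cdot> L y = sweedler A (\<lambda>y1 y2. (\<alpha> x2 \<odot> x1) \<cdot> (\<alpha> y2 \<odot> y1)) y"
      unfolding L_eq by (rule sweedler_hom[OF bilL _ vs sub _ y]) (use xx in \<open>auto simp: linear_on_def distrib mult.commute\<close>)
    also have "\<dots> = sweedler A (\<lambda>y1 y2. \<alpha> (x2 \<cdot> y2) \<odot> (x1 \<cdot> y1)) y"
      by (rule sweedler_cong) (use xx in \<open>simp add: distrib \<alpha>_distrib mult.commute\<close>)
    finally show "sweedler A (\<lambda>y1 y2. \<alpha> (x2 \<cdot> y2) \<odot> (x1 \<cdot> y1)) y = (\<alpha> x2 \<odot> x1) \<cdot> L y" ..
  qed
  also have "\<dots> = L x \<cdot> L y"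
    unfolding L_eq[of x] by (rule sweedler_hom[OF bilL _ vs sub _ x, symmetric]) (use y in \<open>auto simp: linear_on_def distrib\<close>)
  finally show ?thesis .
qed

lemma L_one [simp]: "L \<one> = \<one>" and L_g [simp]: "L g = - g"
  unfolding L_eq using sweedler_one[OF bilL] sweedler_group_like[OF bilL g]
  by (simp_all add: \<alpha>_distrib \<alpha>g smult_distrib)

lemma g_cancel [simp]: assumes "x \<in> carrier A" shows "g \<cdot> (g \<cdot> x) = x" "x \<cdot> g \<cdot> g = x"
  using mult_assoc[of g g x] mult_assoc[of x g g] assms by (auto simp: gg)

lemma \<gamma>_\<gamma> [simp]: "x \<in> carrier A \<Longrightarrow> \<gamma> (\<gamma> x) = x"
  unfolding \<gamma>_def by (simp add: mult_assoc gg)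

lemma g_mult: "x \<in> carrier A \<Longrightarrow> g \<cdot> x = \<gamma> x \<cdot> g" "x \<in> carrier A \<Longrightarrow> \<gamma> x \<cdot> g = g \<cdot> x"
  "x \<in> carrier A \<Longrightarrow> g \<cdot> \<gamma> x = x \<cdot> g"
  unfolding \<gamma>_def by (auto simp: mult_assoc gg)

lemma \<gamma>_distrib:
  "x \<in> carrier A \<Longrightarrow> y \<in> carrier A \<Longrightarrow> \<gamma> (x + y) = \<gamma> x + \<gamma> y"
  "x \<in> carrier A \<Longrightarrow> \<gamma> (c \<odot> x) = c \<odot> \<gamma> x"
  "x \<in> carrier A \<Longrightarrow> y \<in> carrier A \<Longrightarrow> \<gamma> (x - y) = \<gamma> x - \<gamma> y"
  "x \<in> carrier A \<Longrightarrow> \<gamma> (- x) = - \<gamma> x"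
  unfolding \<gamma>_def by (auto simp: mult_distrib)

lemma \<gamma>_zero [simp]: "\<gamma> 0 = 0" by (simp add: \<gamma>_def)

lemma \<gamma>_mult: "x \<in> carrier A \<Longrightarrow> y \<in> carrier A \<Longrightarrow> \<gamma> (x \<cdot> y) = \<gamma> x \<cdot> \<gamma> y"
  unfolding \<gamma>_def by (simp add: mult_assoc)

lemma \<gamma>_one [simp]: "\<gamma> \<one> = \<one>" and \<gamma>_g [simp]: "\<gamma> g = g" by (auto simp: \<gamma>_def gg)

lemma counit_\<gamma>: "x \<in> carrier A \<Longrightarrow> counit A (\<gamma> x) = counit A x"
  by (simp add: \<gamma>_def counit_mult)

lemma L_\<gamma>: "x \<in> carrier A \<Longrightarrow> L (\<gamma> x) = \<gamma> (L x)"
  unfolding \<gamma>_def by (simp add: L_mult mult_distrib)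

text \<open>L is an involution, so the super-datum condition R L = \<gamma> can be solved for
  R.\<close>

lemma R_eq_\<gamma>L: "x \<in> carrier A \<Longrightarrow> R x = \<gamma> (L x)" using RL[of "L x"] by simp

lemma sweedler_\<gamma>:
  assumes F: "bil A s F" and x: "x \<in> carrier A"
  shows "sweedler A F (\<gamma> x) = sweedler A (\<lambda>u v. F (\<gamma> u) (\<gamma> v)) x"
proof -
  have b: "bil A s (\<lambda>u v. F (u \<cdot> g) (v \<cdot> g))" by (rule bilI) (auto simp: bilD[OF F] mult_distrib)
  show ?thesis unfolding \<gamma>_def
    using sweedler_mult_group_like(1)[OF F g] sweedler_mult_group_like(2)[OF b g x] x by simp
qed

lemma half_add: "(1/2) \<odot> x + (1/2) \<odot> x = x"
proof -
  have "(1/2) \<odot> x + (1/2) \<odot> x = (1/2 + 1/2) \<odot> x" by (simp only: smult_distrib)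
  also have "(1/2 + 1/2 :: 'k) = 1" using two by (simp add: field_simps)
  finally show ?thesis by (simp add: smult_distrib)
qed

lemma neg_eq_imp_zero: assumes "x = - x" shows "x = (0::'a)"
proof -
  have "(1/2) \<odot> x + (1/2) \<odot> x = 0" using assms by (metis add.right_inverse smult_distrib(7))
  then show ?thesis by (simp add: half_add)
qed

section \<open>Eigenspace projections of L and the fixed subalgebra B\<close>

definition E where "E x = (1/2) \<odot> (x + L x)"
definition N where "N x = (1/2) \<odot> (x - L x)"
definition Q where "Q x = E x + N x \<cdot> g"
definition B where "B = {b \<in> carrier A. L b = b}"

lemma ENQ_closed [simp]: "x \<in> carrier A \<Longrightarrow> E x \<in> carrier A" "x \<in> carrier A \<Longrightarrow> N x \<in> carrier A"
  "x \<in> carrier A \<Longrightarrow> Q x \<in> carrier A"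
  by (auto simp: E_def N_def Q_def)

lemma ENQ_distrib:
  assumes "x \<in> carrier A"
  shows "y \<in> carrier A \<Longrightarrow> E (x + y) = E x + E y" "E (c \<odot> x) = c \<odot> E x" 
    "y \<in> carrier A \<Longrightarrow> E (x - y) = E x - E y" 
    "y \<in> carrier A \<Longrightarrow> N (x + y) = N x + N y" "N (c \<odot> x) = c \<odot> N x" 
    "y \<in> carrier A \<Longrightarrow> N (x - y) = N x - N y"
    "y \<in> carrier A \<Longrightarrow> Q (x + y) = Q x + Q y" "Q (c \<odot> x) = c \<odot> Q x" 
    "y \<in> carrier A \<Longrightarrow> Q (x - y) = Q x - Q y"
  using assms by (auto simp: Q_def E_def N_def distrib algebra_simps)

lemma E_N: "x \<in> carrier A \<Longrightarrow> E x + N x = x" by (simp add: E_def N_def smult_distrib half_add)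
lemma L_E [simp]: "x \<in> carrier A \<Longrightarrow> L (E x) = E x" by (simp add: E_def distrib add.commute)
lemma L_N [simp]: "x \<in> carrier A \<Longrightarrow> L (N x) = - N x" by (simp add: N_def distrib)

lemma BC: "b \<in> B \<Longrightarrow> b \<in> carrier A" and LB: "b \<in> B \<Longrightarrow> L b = b" by (auto simp: B_def)

lemma E_B [simp]: "b \<in> B \<Longrightarrow> E b = b" by (auto simp: B_def E_def smult_distrib half_add)
lemma N_B [simp]: "b \<in> B \<Longrightarrow> N b = 0" by (auto simp: B_def N_def smult_distrib)
lemma Q_B [simp]: "b \<in> B \<Longrightarrow> Q b = b" by (simp add: Q_def BC mult_distrib)
lemma E_in_B [simp]: "x \<in> carrier A \<Longrightarrow> E x \<in> B" by (auto simp: B_def)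
lemma Q_in_B [simp]: "x \<in> carrier A \<Longrightarrow> Q x \<in> B" by (auto simp: B_def Q_def LR_distrib L_mult mult_distrib)

lemma E_N_mult_g: assumes x: "x \<in> carrier A" shows "E (x \<cdot> g) = N x \<cdot> g" "N (x \<cdot> g) = E x \<cdot> g"
  using x by (auto simp: E_def N_def L_mult mult_distrib smult_distrib)

lemma Q_mult_g: "x \<in> carrier A \<Longrightarrow> Q (x \<cdot> g) = Q x"
  by (simp add: Q_def E_N_mult_g add.commute)

lemma decomp: "x \<in> carrier A \<Longrightarrow> E x + (N x \<cdot> g) \<cdot> g = x" by (simp add: E_N)

lemma Og_in_B [simp]: "x \<in> carrier A \<Longrightarrow> N x \<cdot> g \<in> B" by (auto simp: B_def L_mult mult_distrib)

lemma subspace_B: "module.subspace (smult A) B"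
  using L_one LR_distrib(1,2) by (intro V.subspaceI) (auto simp: B_def V.subspace_0 linear_on_zero[of "smult A" "smult A" "carrier A"] lin_L[unfolded lin_def])

lemma B_closed [simp]:
  "0 \<in> B" "x \<in> B \<Longrightarrow> y \<in> B \<Longrightarrow> x + y \<in> B" "x \<in> B \<Longrightarrow> c \<odot> x \<in> B" "x \<in> B \<Longrightarrow> y \<in> B \<Longrightarrow> x - y \<in> B"
  using V.subspace_0[OF subspace_B] V.subspace_add[OF subspace_B] V.subspace_scale[OF subspace_B] V.subspace_diff[OF subspace_B] by auto

lemma B_mult [simp]: "x \<in> B \<Longrightarrow> y \<in> B \<Longrightarrow> x \<cdot> y \<in> B" by (auto simp: B_def L_mult)
lemma B_one [simp]: "\<one> \<in> B" by (auto simp: B_def)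
lemma B_\<gamma> [simp]: "x \<in> B \<Longrightarrow> \<gamma> x \<in> B" by (auto simp: B_def L_\<gamma>)
lemma R_B: "x \<in> B \<Longrightarrow> R x = \<gamma> x" by (auto simp: B_def R_eq_\<gamma>L)

lemma counit_E: "x \<in> carrier A \<Longrightarrow> counit A (E x) = (counit A x + \<alpha> x) / 2"
  and counit_N: "x \<in> carrier A \<Longrightarrow> counit A (N x) = (counit A x - \<alpha> x) / 2"
  by (auto simp: E_def N_def counit_distrib counit_L)
lemma counit_Q: "x \<in> carrier A \<Longrightarrow> counit A (Q x) = counit A x"
  using two by (simp add: Q_def counit_distrib counit_mult counit_E counit_N add_divide_distrib[symmetric])

lemma \<alpha>_B: "b \<in> B \<Longrightarrow> \<alpha> b = counit A b"
  using counit_L[of b] by (auto simp: B_def)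

text \<open>L acts on the right leg of a coproduct, hence so do E and N, which are linear
  combinations of the identity and L.\<close>

lemma sweedler_E:
  assumes F: "bil A s F" and x: "x \<in> carrier A"
  shows "sweedler A F (E x) = sweedler A (\<lambda>u v. F u (E v)) x"
    "sweedler A F (N x) = sweedler A (\<lambda>u v. F u (N v)) x"
proof -
  have s: "vector_space s" by (rule bilD(1)[OF F])
  have b: "bil A s (\<lambda>u v. F u (L v))" by (rule bilI) (auto simp: bilD[OF F] distrib)
  have b': "bil A s (\<lambda>u v. s (-1) (F u (L v)))" by (rule bil_smult[OF b])
  have "sweedler A F (E x) = s (1/2) (sweedler A F x + sweedler A (\<lambda>u v. F u (L v)) x)"
    using x by (simp add: E_def sweedler_smult[OF F] sweedler_add[OF F] sweedler_L[OF F])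
  also have "\<dots> = sweedler A (\<lambda>u v. s (1/2) (F u v + F u (L v))) x"
    using sweedler_smult_fun[OF bil_add[OF F b] x] sweedler_plus[OF F b x] by simp
  also have "\<dots> = sweedler A (\<lambda>u v. F u (E v)) x"
    by (rule sweedler_cong) (simp add: E_def bilD[OF F])
  finally show "sweedler A F (E x) = sweedler A (\<lambda>u v. F u (E v)) x" .
  have "sweedler A F (N x) = s (1/2) (sweedler A F x - sweedler A (\<lambda>u v. F u (L v)) x)"
    using x by (simp add: N_def sweedler_smult[OF F] sweedler_minus[OF F] sweedler_L[OF F])
  \<comment> \<open>The difference is rewritten with the scalar -1, since the rules for combining
    Sweedler sums concern sums and multiples.\<close>
  also have "\<dots> = s (1/2) (sweedler A F x + sweedler A (\<lambda>u v. s (-1) (F u (L v))) x)"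
    using sweedler_smult_fun[OF b x, of "-1"] by (simp add: vector_space_distrib[OF s])
  also have "\<dots> = sweedler A (\<lambda>u v. s (1/2) (F u v + s (-1) (F u (L v)))) x"
    using sweedler_smult_fun[OF bil_add[OF F b'] x] sweedler_plus[OF F b' x] by simp
  also have "\<dots> = sweedler A (\<lambda>u v. F u (N v)) x"
  proof (rule sweedler_cong)
    fix u v assume uv: "u \<in> carrier A" "v \<in> carrier A"
    have "F u (v - L v) = F u (v + (-1) \<odot> L v)" by (simp add: smult_distrib)
    also have "\<dots> = F u v + s (-1) (F u (L v))" using uv by (simp only: bilD(3,5)[OF F] carrier_closed LR_closed)
    finally show "s (1/2) (F u v + s (-1) (F u (L v))) = F u (N v)"
      using uv by (simp add: N_def bilD[OF F])
  qed
  finally show "sweedler A F (N x) = sweedler A (\<lambda>u v. F u (N v)) x" .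
qed

end

section \<open>The projection onto the group algebra and the structure maps of the
  coinvariants\<close>

lemma kZ2_proj_apply:
  "kZ2_proj A \<alpha> v 0 = (counit A v + \<alpha> v) / 2" "kZ2_proj A \<alpha> v 1 = (counit A v - \<alpha> v) / 2"
  by (auto simp: kZ2_proj_def fscale_def kZ2_basis_def diff_divide_distrib add_divide_distrib)

context super_datum begin

definition K where "K v = kZ2_incl A g (kZ2_proj A \<alpha> v)"

lemma K_eq: "K v = ((counit A v + \<alpha> v) / 2) \<odot> \<one> + ((counit A v - \<alpha> v) / 2) \<odot> g"
  by (simp add: K_def kZ2_incl_def kZ2_proj_apply)

lemma K_closed [simp]: "K v \<in> carrier A" by (simp add: K_eq)

lemma K_distrib:
  "x \<in> carrier A \<Longrightarrow> y \<in> carrier A \<Longrightarrow> K (x + y) = K x + K y"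
  "x \<in> carrier A \<Longrightarrow> K (c \<odot> x) = c \<odot> K x"
  by (auto simp: K_eq distrib add_divide_distrib diff_divide_distrib algebra_simps)

lemma mult_K: "x \<in> carrier A \<Longrightarrow>
    x \<cdot> K v = (1/2) \<odot> (counit A v \<odot> x + \<alpha> v \<odot> x) + (1/2) \<odot> (counit A v \<odot> (x \<cdot> g) - \<alpha> v \<odot> (x \<cdot> g))"
  "x \<in> carrier A \<Longrightarrow>
    K v \<cdot> x = (1/2) \<odot> (counit A v \<odot> x + \<alpha> v \<odot> x) + (1/2) \<odot> (counit A v \<odot> (g \<cdot> x) - \<alpha> v \<odot> (g \<cdot> x))"
  by (auto simp: K_eq distrib add_divide_distrib diff_divide_distrib)

text \<open>The formulas in \<open>mult_K\<close> consist of counit terms and \<alpha> terms. Under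
  a Sweedler sum a counit term returns the value at x itself, and an \<alpha> term the value at L x
  or R x, depending on the leg that carries \<alpha>.\<close>

lemma sweedler_K:
  assumes f: "lin A s f" and h: "lin A s h" and x: "x \<in> carrier A"
  shows "sweedler A (\<lambda>u v. s (1/2) (s (counit A v) (f u) + s (\<alpha> v) (f u)) + s (1/2) (s (counit A v) (h u) - s (\<alpha> v) (h u))) x
     = s (1/2) (f x + f (L x)) + s (1/2) (h x - h (L x))" (is ?A)
    and "sweedler A (\<lambda>u v. s (1/2) (s (counit A u) (f v) + s (\<alpha> u) (f v)) + s (1/2) (s (counit A u) (h v) - s (\<alpha> u) (h v))) x
     = s (1/2) (f x + f (R x)) + s (1/2) (h x - h (R x))" (is ?B)
proof -
  have s: "vector_space s" by (rule linD(1)[OF f])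
  have b: "bil A s (\<lambda>u v. s (counit A v) (k u))" "bil A s (\<lambda>u v. s (\<alpha> v) (k u))"
    "bil A s (\<lambda>u v. s (counit A u) (k v))" "bil A s (\<lambda>u v. s (\<alpha> u) (k v))" if "lin A s k" for k
    by (rule bilI; simp add: linD[OF that] distrib vector_space_distrib[OF s] mult.commute)+
  have m: "X - Y = X + s (-1) Y" for X Y by (simp add: vector_space_distrib[OF s])
  note b1 = bil_add[OF b(1,2)[OF f]] bil_add[OF b(1)[OF h] bil_smult[OF b(2)[OF h], of "-1"]]
    bil_add[OF b(3,4)[OF f]] bil_add[OF b(3)[OF h] bil_smult[OF b(4)[OF h], of "-1"]]
  note b2 = b1[THEN bil_smult, of "1/2"]
  show ?A ?B
    unfolding m
    by (simp_all only: sweedler_plus[OF b2(1,2) x] sweedler_plus[OF b2(3,4) x] b1[THEN sweedler_smult_fun, OF x]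
      sweedler_plus[OF b(1,2)[OF f] x] sweedler_plus[OF b(3,4)[OF f] x]
      sweedler_plus[OF b(1)[OF h] bil_smult[OF b(2)[OF h]] x] sweedler_plus[OF b(3)[OF h] bil_smult[OF b(4)[OF h]] x]
      b(2,4)[OF h, THEN sweedler_smult_fun, OF x] sweedler_\<alpha>[OF f x] sweedler_\<alpha>[OF h x]
      sweedler_counit_left[OF f x] sweedler_counit_right[OF f x]
      sweedler_counit_left[OF h x] sweedler_counit_right[OF h x])
qed

text \<open>This identifies Q with the standard projection onto the coinvariants of a Hopf algebra
  with projection, which multiplies the first leg by the antipode of the projected second leg. The
  antipode does not show, because the elements of Z_2 are their own inverses.\<close>

lemma sweedler_mult_K: assumes "x \<in> carrier A" shows "sweedler A (\<lambda>u v. u \<cdot> K v) x = Q x"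
proof -
  have "sweedler A (\<lambda>u v. u \<cdot> K v) x = sweedler A (\<lambda>u v. (1/2) \<odot> (counit A v \<odot> u + \<alpha> v \<odot> u) + (1/2) \<odot> (counit A v \<odot> (u \<cdot> g) - \<alpha> v \<odot> (u \<cdot> g))) x"
    by (rule sweedler_cong) (simp add: mult_K)
  also have "\<dots> = (1/2) \<odot> (x + L x) + (1/2) \<odot> (x \<cdot> g - L x \<cdot> g)"
    by (rule sweedler_K(1)[OF lin_id _ assms]) (auto intro!: linI simp: distrib)
  also have "\<dots> = Q x" using assms by (simp add: Q_def E_def N_def distrib)
  finally show ?thesis .
qed

text \<open>The antipode formula of the coinvariants after the sum has been evaluated:
  \<open>sweedler_K_antipode\<close> shows that T is the convolution product of K with the antipode.
  It makes sense on all of A, which allows it to be compared at x, x g and Q x.\<close>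

definition T where "T x = antipode A ((1/2) \<odot> (x + R x)) + g \<cdot> antipode A ((1/2) \<odot> (x - R x))"

lemma sweedler_K_antipode: assumes "x \<in> carrier A" shows "sweedler A (\<lambda>u v. K u \<cdot> antipode A v) x = T x"
proof -
  have "sweedler A (\<lambda>u v. K u \<cdot> antipode A v) x = sweedler A (\<lambda>u v. (1/2) \<odot> (counit A u \<odot> antipode A v + \<alpha> u \<odot> antipode A v) +
     (1/2) \<odot> (counit A u \<odot> (g \<cdot> antipode A v) - \<alpha> u \<odot> (g \<cdot> antipode A v))) x"
    by (rule sweedler_cong) (simp add: mult_K)
  also have "\<dots> = (1/2) \<odot> (antipode A x + antipode A (R x)) + (1/2) \<odot> (g \<cdot> antipode A x - g \<cdot> antipode A (R x))"
    by (rule sweedler_K(2)[OF _ _ assms]) (auto intro!: linI simp: distrib)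
  also have "\<dots> = T x" using assms by (simp add: T_def distrib)
  finally show ?thesis .
qed

lemma tens_kZ2_distrib:
  fixes f f' :: "bit \<Rightarrow> 'k"
  shows "tens (smult A) fscale (x + y) f = tens (smult A) fscale x f + tens (smult A) fscale y f"
  "tens (smult A) fscale x (f + f') = tens (smult A) fscale x f + tens (smult A) fscale x f'"
  "tens (smult A) fscale x (f - f') = tens (smult A) fscale x f - tens (smult A) fscale x f'"
  "tens (smult A) fscale (c \<odot> x) f = fscale c (tens (smult A) fscale x f)"
  "tens (smult A) fscale x (fscale c f) = fscale c (tens (smult A) fscale x f)"
proof -
  have *: "tens (smult A) fscale (x + y) f = tens (smult A) fscale x f + tens (smult A) fscale y f"
  "tens (smult A) fscale x (f + f') = tens (smult A) fscale x f + tens (smult A) fscale x f'"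
  "tens (smult A) fscale (c \<odot> x) f = fscale c (tens (smult A) fscale x f)"
  "tens (smult A) fscale x (fscale c f) = fscale c (tens (smult A) fscale x f)" for x y c and f f' :: "bit \<Rightarrow> 'k"
    using bilinear_on_tens[OF vs vector_space_fscale[where 'i=bit]] unfolding bilinear_on_def linear_on_def by auto
  then show "tens (smult A) fscale (x + y) f = tens (smult A) fscale x f + tens (smult A) fscale y f"
  "tens (smult A) fscale x (f + f') = tens (smult A) fscale x f + tens (smult A) fscale x f'"
  "tens (smult A) fscale (c \<odot> x) f = fscale c (tens (smult A) fscale x f)"
  "tens (smult A) fscale x (fscale c f) = fscale c (tens (smult A) fscale x f)" by blast+
  show "tens (smult A) fscale x (f - f') = tens (smult A) fscale x f - tens (smult A) fscale x f'"
    using *(2)[of x "f - f'" f'] by (simp add: algebra_simps)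
qed

text \<open>The left side of the coinvariance condition evaluates to half of b (x) (e + \<sigma>)
  plus half of L b (x) (e - \<sigma>). For L b = b this is b (x) e; the converse extracts L b with
  the sign character of Z_2.\<close>

lemma coinv_carrier_eq: "coinv_carrier A (g, \<alpha>) = B"
proof -
  let ?t = "tens (smult A) fscale :: 'a \<Rightarrow> (bit \<Rightarrow> 'k) \<Rightarrow> _"
  let ?p = "kZ2_basis 0 + kZ2_basis 1 :: bit \<Rightarrow> 'k" let ?m = "kZ2_basis 0 - kZ2_basis 1 :: bit \<Rightarrow> 'k"
  let ?F = "\<lambda>u v. ?t u (kZ2_proj A \<alpha> v)"
  let ?W = "UNIV :: (bit \<Rightarrow> 'k) set"
  have sW: "module.subspace fscale ?W"
  proof - interpret vector_space "fscale :: 'k \<Rightarrow> (bit \<Rightarrow> 'k) \<Rightarrow> _" by (rule vector_space_fscale) show ?thesis by (rule subspace_UNIV) qed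
  have proj: "kZ2_proj A \<alpha> (x + y) = kZ2_proj A \<alpha> x + kZ2_proj A \<alpha> y"
    "kZ2_proj A \<alpha> (c \<odot> x) = fscale c (kZ2_proj A \<alpha> x)" if "x \<in> carrier A" "y \<in> carrier A" for x y c
  proof -
    show "kZ2_proj A \<alpha> (x + y) = kZ2_proj A \<alpha> x + kZ2_proj A \<alpha> y"
    proof
      fix i show "kZ2_proj A \<alpha> (x + y) i = (kZ2_proj A \<alpha> x + kZ2_proj A \<alpha> y) i"
        using that by (cases i) (simp_all add: kZ2_proj_apply distrib add_divide_distrib diff_divide_distrib)
    qed
    show "kZ2_proj A \<alpha> (c \<odot> x) = fscale c (kZ2_proj A \<alpha> x)"
    proof
      fix i show "kZ2_proj A \<alpha> (c \<odot> x) i = fscale c (kZ2_proj A \<alpha> x) i"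
        using that by (cases i) (simp_all add: kZ2_proj_apply distrib fscale_def distrib_left right_diff_distrib)
    qed
  qed
  have bF: "bil A fscale ?F"
    by (rule bilI) (auto simp: proj tens_kZ2_distrib vector_space_fscale)
  have half: "fscale (1/2) (?p + ?m) = kZ2_basis 0"
    using two by (auto simp: fscale_def kZ2_basis_def fun_eq_iff field_simps)
  have SW: "sweedler A ?F b = fscale (1/2) (?t b ?p) + fscale (1/2) (?t (L b) ?m)" if b: "b \<in> carrier A" for b
  proof -
    have t: "lin A fscale (\<lambda>u. ?t u f)" for f by (rule linI) (auto simp: tens_kZ2_distrib vector_space_fscale)
    have b1: "bil A fscale (\<lambda>u v. fscale (counit A v) (?t u ?p))" by (rule lin_bil_right[OF t])
    have b2: "bil A fscale (\<lambda>u v. fscale (\<alpha> v) (?t u ?m))"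
      by (rule bilI) (auto simp: linD[OF t] distrib fscale_distrib mult.commute)
    have "sweedler A ?F b = sweedler A (\<lambda>u v. fscale (1/2) (fscale (counit A v) (?t u ?p)) + fscale (1/2) (fscale (\<alpha> v) (?t u ?m))) b"
      by (rule sweedler_cong) (simp only: kZ2_proj_def tens_kZ2_distrib(2)[of _ "fscale _ _" "fscale _ _"] tens_kZ2_distrib(5), simp add: fscale_distrib(3))
    also have "\<dots> = fscale (1/2) (?t b ?p) + fscale (1/2) (?t (L b) ?m)"
      by (simp only: sweedler_plus[OF bil_smult[OF b1] bil_smult[OF b2] b] sweedler_smult_fun[OF b1 b] sweedler_smult_fun[OF b2 b]
        sweedler_counit_right[OF t b] sweedler_\<alpha>(1)[OF t b])
    finally show ?thesis .
  qed
  have "sweedler A ?F b = ?t b (kZ2_basis 0) \<longleftrightarrow> L b = b" if b: "b \<in> carrier A" for b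
  proof
    assume "L b = b"
    then have "sweedler A ?F b = fscale (1/2) (?t b (?p + ?m))"
      by (simp only: SW[OF b] tens_kZ2_distrib(2)[of b ?p ?m] fscale_distrib(1))
    then show "sweedler A ?F b = ?t b (kZ2_basis 0)" by (simp only: tens_kZ2_distrib(5)[symmetric] half)
  next
    assume eq: "sweedler A ?F b = ?t b (kZ2_basis 0)"
    \<comment> \<open>The functional with value 1 at e and -1 at \<sigma> turns
      \<open>kZ2_proj\<close> into \<alpha>, so the left side of the condition becomes L b and the
      right side b.\<close>
    let ?B = "\<lambda>u (f :: bit \<Rightarrow> 'k). (f 0 - f 1) \<odot> u"
    have bB: "bilinear_on (smult A) fscale (smult A) (carrier A) ?W ?B"
      unfolding bilinear_on_def linear_on_def by (auto simp: smult_distrib fscale_def algebra_simps)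
    let ?h = "tensor_lift (smult A) fscale (carrier A) ?W ?B"
    have ht: "?h (?t u f) = ?B u f" if "u \<in> carrier A" for u f
      by (rule tensor_lift_tens[OF vs vector_space_fscale vs sub sW bB that]) simp
    have "?h (sweedler A ?F b) = sweedler A (\<lambda>u v. ?h (?F u v)) b"
      by (rule sweedler_hom[OF bF linear_on_tensor_lift[OF vs vector_space_fscale vs sub sW bB] vs
         subspace_tensor_space[OF vs vector_space_fscale sub sW] _ b]) (auto intro!: tens_in_tensor_space)
    also have "\<dots> = sweedler A (\<lambda>u v. \<alpha> v \<odot> u) b"
    proof (rule sweedler_cong)
      fix u v assume "u \<in> carrier A"
      moreover have "(counit A v + \<alpha> v) / 2 - (counit A v - \<alpha> v) / 2 = \<alpha> v"
        using two by (simp add: diff_divide_distrib[symmetric] mult_2[symmetric])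
      ultimately show "?h (?F u v) = \<alpha> v \<odot> u" by (simp add: ht kZ2_proj_apply)
    qed
    finally show "L b = b" using b ht[of b "kZ2_basis 0"] by (simp only: eq L_eq[symmetric]) (simp add: kZ2_basis_def smult_distrib)
  qed
  then show ?thesis by (auto simp: coinv_carrier_def B_def)
qed

abbreviation D where "D \<equiv> coinv A (g, \<alpha>)"

lemma D_simps [simp]: "carrier D = B" "smult D = smult A" "mult D = mult A" "unit_elt D = \<one>" "counit D = counit A"
  by (simp_all add: coinv_def coinv_carrier_eq)

lemma grade_D: "grade D i = {b \<in> B. \<gamma> b = parity_sign i \<odot> b}"
  by (simp add: coinv_def coinv_carrier_eq \<gamma>_def)

text \<open>The definition multiplies the first leg of a threefold coproduct by K of the second.
  Coassociativity groups these two legs together, and their sum is Q.\<close>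

lemma comult_D: assumes b: "b \<in> carrier A" shows "comult D b = sweedler A (\<lambda>u v. Q u \<otimes>\<^bsub>A\<^esub> v) b"
proof -
  have t: "tri A fscale (\<lambda>u v w. (u \<cdot> K v) \<otimes>\<^bsub>A\<^esub> w)"
    by (rule triI) (auto simp: distrib K_distrib)
  have bK: "bil A (smult A) (\<lambda>u v. u \<cdot> K v)" by (rule bilI) (auto simp: distrib K_distrib)
  have "comult D b = sweedler A (\<lambda>u v. sweedler A (\<lambda>u1 u2. (u1 \<cdot> K u2) \<otimes>\<^bsub>A\<^esub> v) u) b"
    unfolding sweedler_coassoc[OF t b] by (simp add: coinv_def K_def)
  also have "\<dots> = sweedler A (\<lambda>u v. Q u \<otimes>\<^bsub>A\<^esub> v) b"
  proof (rule sweedler_cong)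
    fix u v assume uv: "u \<in> carrier A" "v \<in> carrier A"
    have "(sweedler A (\<lambda>u v. u \<cdot> K v) u) \<otimes>\<^bsub>A\<^esub> v = sweedler A (\<lambda>u1 u2. (u1 \<cdot> K u2) \<otimes>\<^bsub>A\<^esub> v) u"
      by (rule sweedler_hom[OF bK _ vector_space_fscale V.subspace_UNIV _ uv(1), where h="\<lambda>x. x \<otimes>\<^bsub>A\<^esub> v"]) (auto simp: linear_on_def distrib)
    then show "sweedler A (\<lambda>u1 u2. (u1 \<cdot> K u2) \<otimes>\<^bsub>A\<^esub> v) u = Q u \<otimes>\<^bsub>A\<^esub> v" using sweedler_mult_K uv by simp
  qed
  finally show ?thesis .
qed

lemma antipode_D: "x \<in> carrier A \<Longrightarrow> antipode D x = T x"
  using sweedler_K_antipode by (simp add: coinv_def K_def)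

text \<open>B is a left coideal: b = E b, and E acts on the right leg. As Q is the identity on the
  image of E, it can be inserted or removed there as well.\<close>

lemma sweedler_on_B:
  assumes F: "bil A s F" and b: "b \<in> B"
  shows "sweedler A (\<lambda>u v. F u (E v)) b = sweedler A F b"
    "sweedler A (\<lambda>u v. F u (Q v)) b = sweedler A F b"
proof -
  have 1: "sweedler A (\<lambda>u v. F u (E v)) b = sweedler A F b" if F: "bil A s F" for F
    using sweedler_E(1)[OF F BC[OF b]] b by simp
  then show "sweedler A (\<lambda>u v. F u (E v)) b = sweedler A F b" using F .
  have bQ: "bil A s (\<lambda>u v. F u (Q v))" by (rule bilI) (auto simp: bilD[OF F] ENQ_distrib)
  have "sweedler A (\<lambda>u v. F u (Q (E v))) b = sweedler A (\<lambda>u v. F u (E v)) b"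
    by (rule sweedler_cong) simp
  then show "sweedler A (\<lambda>u v. F u (Q v)) b = sweedler A F b" using 1[OF F] 1[OF bQ] by simp
qed

section \<open>Sweedler sums in the coalgebra B\<close>

definition bilB where "bilB s F \<longleftrightarrow> vector_space s \<and> bilinear_on (smult A) (smult A) s B B F"

lemma bilBD:
  assumes "bilB s F"
  shows "vector_space s"
    "x \<in> B \<Longrightarrow> y \<in> B \<Longrightarrow> z \<in> B \<Longrightarrow> F (x + y) z = F x z + F y z"
    "x \<in> B \<Longrightarrow> y \<in> B \<Longrightarrow> z \<in> B \<Longrightarrow> F x (y + z) = F x y + F x z"
    "x \<in> B \<Longrightarrow> y \<in> B \<Longrightarrow> F (c \<odot> x) y = s c (F x y)"
    "x \<in> B \<Longrightarrow> y \<in> B \<Longrightarrow> F x (c \<odot> y) = s c (F x y)"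
  using assms by (auto simp: bilB_def bilinear_on_def linear_on_def)

lemma bilBI:
  assumes "vector_space s"
    "\<And>x y z. x \<in> B \<Longrightarrow> y \<in> B \<Longrightarrow> z \<in> B \<Longrightarrow> F (x + y) z = F x z + F y z"
    "\<And>x y z. x \<in> B \<Longrightarrow> y \<in> B \<Longrightarrow> z \<in> B \<Longrightarrow> F x (y + z) = F x y + F x z"
    "\<And>c x y. x \<in> B \<Longrightarrow> y \<in> B \<Longrightarrow> F (c \<odot> x) y = s c (F x y)"
    "\<And>c x y. x \<in> B \<Longrightarrow> y \<in> B \<Longrightarrow> F x (c \<odot> y) = s c (F x y)"
  shows "bilB s F"
  using assms by (auto simp: bilB_def bilinear_on_def linear_on_def)

lemma bil_bilB: "bil A s F \<Longrightarrow> bilB s F" by (rule bilBI) (auto simp: bilD BC)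

text \<open>A map that is bilinear only on B, such as one built from the coproduct of B, becomes
  bilinear on A after composition with Q in both arguments.\<close>

lemma bilB_QQ: "bilB s F \<Longrightarrow> bil A s (\<lambda>u v. F (Q u) (Q v))"
  by (rule bilI) (auto simp: bilBD ENQ_distrib)

text \<open>By \<open>comult_D\<close> the left leg carries Q, and Q may be added on the right leg
  because the element lies in B. Sums in D are thereby translated into sums in A.\<close>

lemma sweedler_D:
  assumes F: "bilB s F" and b: "b \<in> B"
  shows "sweedler D F b = sweedler A (\<lambda>u v. F (Q u) (Q v)) b"
proof -
  have bt: "bil A fscale (\<lambda>u v. Q u \<otimes>\<^bsub>A\<^esub> v)" by (rule bilI) (auto simp: distrib ENQ_distrib)
  have bt': "bil A fscale (\<lambda>u v. Q u \<otimes>\<^bsub>A\<^esub> Q v)" by (rule bilI) (auto simp: distrib ENQ_distrib)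
  have s: "vector_space s" "bilinear_on (smult A) (smult A) s B B F" using F by (auto simp: bilB_def)
  have "sweedler D F b = tensor_lift (smult A) (smult A) B B F (sweedler A (\<lambda>u v. Q u \<otimes>\<^bsub>A\<^esub> Q v) b)"
    using sweedler_on_B(2)[OF bt b] by (simp add: comult_D BC[OF b])
  also have "\<dots> = sweedler A (\<lambda>u v. tensor_lift (smult A) (smult A) B B F (Q u \<otimes>\<^bsub>A\<^esub> Q v)) b"
    by (rule tensor_lift_sweedler[OF vs subspace_B s bt' _ BC[OF b]]) (simp add: tens_in_tensor_space)
  also have "\<dots> = sweedler A (\<lambda>u v. F (Q u) (Q v)) b"
    by (rule sweedler_cong) (simp add: tensor_lift_tens[OF vs vs s(1) subspace_B subspace_B s(2)])
  finally show ?thesis .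
qed

lemma comult_D_B: assumes "b \<in> B" shows "comult D b = sweedler A (\<lambda>u v. Q u \<otimes>\<^bsub>A\<^esub> Q v) b"
proof -
  have bt: "bil A fscale (\<lambda>u v. Q u \<otimes>\<^bsub>A\<^esub> v)" by (rule bilI) (auto simp: distrib ENQ_distrib)
  from sweedler_on_B(2)[OF this assms] show ?thesis using comult_D BC[OF assms] by simp
qed

text \<open>\<open>Q\<close> identifies \<open>B\<close> with the quotient coalgebra \<open>A/A(g - 1)\<close>.\<close>

lemma sweedler_QQ:
  assumes F: "bilB s F" and x: "x \<in> carrier A"
  shows "sweedler D F (Q x) = sweedler A (\<lambda>u v. F (Q u) (Q v)) x"
proof -
  note b = bilB_QQ[OF F]
  have "sweedler A (\<lambda>u v. F (Q u) (Q v)) (N x \<cdot> g) = sweedler A (\<lambda>u v. F (Q u) (Q v)) (N x)"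
    unfolding sweedler_mult_group_like(1)[OF b g ENQ_closed(2)[OF x]]
    by (rule sweedler_cong) (simp add: Q_mult_g)
  then have "sweedler A (\<lambda>u v. F (Q u) (Q v)) (Q x) = sweedler A (\<lambda>u v. F (Q u) (Q v)) (E x + N x)"
    unfolding Q_def[of x] using x by (simp add: sweedler_add[OF b])
  then show ?thesis using sweedler_D[OF F] x by (simp add: E_N)
qed

section \<open>The antipodes of A and of B\<close>

text \<open>The maps sending x to g S(x g) and to S(g x) g are left convolution inverses of the
  identity and hence equal to S; cancelling g gives the two formulas.\<close>

lemma antipode_mult_g:
  assumes x: "x \<in> carrier A"
  shows "antipode A (x \<cdot> g) = g \<cdot> antipode A x" "antipode A (g \<cdot> x) = antipode A x \<cdot> g"
proof -
  have b: "bil A (smult A) (\<lambda>u v. antipode A u \<cdot> v)" by (rule bilI) (auto simp: distrib)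
  have "g \<cdot> antipode A (x \<cdot> g) = antipode A x"
  proof (rule antipode_unique[OF _ _ _ x, of "\<lambda>x. g \<cdot> antipode A (x \<cdot> g)"])
    show "lin A (smult A) (\<lambda>x. g \<cdot> antipode A (x \<cdot> g))" by (rule linI) (auto simp: distrib)
    fix x assume x: "x \<in> carrier A"
    have "sweedler A (\<lambda>u v. g \<cdot> antipode A (u \<cdot> g) \<cdot> v) x = sweedler A (\<lambda>u v. \<gamma> (antipode A (u \<cdot> g) \<cdot> (v \<cdot> g))) x"
      by (rule sweedler_cong) (simp add: \<gamma>_def mult_assoc gg)
    also have "\<dots> = sweedler A (\<lambda>u v. \<gamma> (antipode A u \<cdot> v)) (x \<cdot> g)"
      by (rule sweedler_mult_group_like(1)[symmetric, OF _ g x]) (rule bilI; simp add: distrib \<gamma>_distrib)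
    also have "\<dots> = \<gamma> (sweedler A (\<lambda>u v. antipode A u \<cdot> v) (x \<cdot> g))"
      by (rule sweedler_hom[OF b _ vs sub, symmetric]) (use x in \<open>auto simp: linear_on_def \<gamma>_distrib\<close>)
    also have "\<dots> = counit A x \<odot> \<one>" using x by (simp add: antipode_left counit_mult \<gamma>_distrib)
    finally show "sweedler A (\<lambda>u v. g \<cdot> antipode A (u \<cdot> g) \<cdot> v) x = counit A x \<odot> \<one>" .
  qed simp
  then show "antipode A (x \<cdot> g) = g \<cdot> antipode A x" using g_cancel(1)[of "antipode A (x \<cdot> g)"] x by simp
  have "antipode A (g \<cdot> x) \<cdot> g = antipode A x"
  proof (rule antipode_unique[OF _ _ _ x, of "\<lambda>x. antipode A (g \<cdot> x) \<cdot> g"])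
    show "lin A (smult A) (\<lambda>x. antipode A (g \<cdot> x) \<cdot> g)" by (rule linI) (auto simp: distrib)
    fix x assume x: "x \<in> carrier A"
    have "sweedler A (\<lambda>u v. antipode A (g \<cdot> u) \<cdot> g \<cdot> v) x = sweedler A (\<lambda>u v. antipode A (g \<cdot> u) \<cdot> (g \<cdot> v)) x"
      by (rule sweedler_cong) (simp add: mult_assoc)
    also have "\<dots> = sweedler A (\<lambda>u v. antipode A u \<cdot> v) (g \<cdot> x)"
      by (rule sweedler_mult_group_like(2)[symmetric, OF b g x])
    also have "\<dots> = counit A x \<odot> \<one>" using x by (simp add: antipode_left counit_mult)
    finally show "sweedler A (\<lambda>u v. antipode A (g \<cdot> u) \<cdot> g \<cdot> v) x = counit A x \<odot> \<one>" .
  qed simp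
  then show "antipode A (g \<cdot> x) = antipode A x \<cdot> g" using g_cancel(2)[of "antipode A (g \<cdot> x)"] x by simp
qed

lemma antipode_\<gamma>: "x \<in> carrier A \<Longrightarrow> antipode A (\<gamma> x) = \<gamma> (antipode A x)"
  unfolding \<gamma>_def by (simp add: antipode_mult_g mult_assoc)

text \<open>L S R is a left convolution inverse of the identity. As L is multiplicative, it can be
  taken out of the product if the right leg receives L; moving L and R from the legs to the argument
  leaves the counit of R (L x), which is the counit of x.\<close>

lemma antipode_R:
  assumes x: "x \<in> carrier A" shows "L (antipode A (R x)) = antipode A x"
proof (rule antipode_unique[OF _ _ _ x, of "\<lambda>x. L (antipode A (R x))"])
  show "lin A (smult A) (\<lambda>x. L (antipode A (R x)))" by (rule linI) (auto simp: distrib)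
  fix x assume x: "x \<in> carrier A"
  have b: "bil A (smult A) (\<lambda>u v. antipode A u \<cdot> v)" by (rule bilI) (auto simp: distrib)
  have b': "bil A (smult A) (\<lambda>u v. L (antipode A (R u) \<cdot> v))" by (rule bilI) (auto simp: distrib)
  have "sweedler A (\<lambda>u v. L (antipode A (R u)) \<cdot> v) x = sweedler A (\<lambda>u v. L (antipode A (R u) \<cdot> L v)) x"
    by (rule sweedler_cong) (simp add: L_mult)
  also have "\<dots> = sweedler A (\<lambda>u v. L (antipode A (R u) \<cdot> v)) (L x)"
    by (rule sweedler_L[symmetric, OF b' x])
  also have "\<dots> = sweedler A (\<lambda>u v. L (antipode A u \<cdot> v)) (R (L x))"
    by (rule sweedler_R[symmetric, OF _ LR_closed(1)[OF x]]) (rule bilI; simp add: distrib)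
  also have "\<dots> = L (sweedler A (\<lambda>u v. antipode A u \<cdot> v) (R (L x)))"
    by (rule sweedler_hom[OF b _ vs sub, symmetric]) (use x in \<open>auto simp: linear_on_def LR_distrib\<close>)
  also have "\<dots> = counit A x \<odot> \<one>" using x by (simp add: antipode_left counit_R \<alpha>_L LR_distrib)
  finally show "sweedler A (\<lambda>u v. L (antipode A (R u)) \<cdot> v) x = counit A x \<odot> \<one>" .
qed simp

lemma L_antipode: "x \<in> carrier A \<Longrightarrow> L (antipode A x) = antipode A (R x)"
  using antipode_R[of x] L_L[of "antipode A (R x)"] by simp

lemma R_R: "x \<in> carrier A \<Longrightarrow> R (R x) = x"
  by (simp add: R_eq_\<gamma>L L_\<gamma>)

lemma T_closed [simp]: "x \<in> carrier A \<Longrightarrow> T x \<in> carrier A" by (simp add: T_def)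

lemma T_distrib:
  "x \<in> carrier A \<Longrightarrow> y \<in> carrier A \<Longrightarrow> T (x + y) = T x + T y"
  "x \<in> carrier A \<Longrightarrow> T (c \<odot> x) = c \<odot> T x"
  by (auto simp: T_def distrib algebra_simps)

text \<open>From L S = S R and R R = id, L fixes the first summand of \<open>T x\<close>. In the
  second, g and the difference x - R x each contribute a sign, and the signs cancel.\<close>

lemma T_in_B [simp]: "x \<in> carrier A \<Longrightarrow> T x \<in> B"
  by (auto simp: B_def T_def L_mult distrib L_antipode R_R algebra_simps)

lemma R_mult_g: assumes "x \<in> carrier A" shows "R (x \<cdot> g) = - (R x \<cdot> g)"
  using assms by (simp add: R_eq_\<gamma>L L_mult mult_distrib \<gamma>_distrib \<gamma>_mult)

text \<open>R anticommutes with right multiplication by g, so the two averages in T change places.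
  The antipode moves g to the left, where it restores each summand. Hence T factors through Q, which
  is \<open>T_Q\<close>.\<close>

lemma T_mult_g: assumes x: "x \<in> carrier A" shows "T (x \<cdot> g) = T x"
proof -
  have "T (x \<cdot> g) = antipode A ((1/2) \<odot> (x - R x) \<cdot> g) + g \<cdot> antipode A ((1/2) \<odot> (x + R x) \<cdot> g)"
    using x by (simp add: T_def R_mult_g mult_distrib)
  then show ?thesis using x by (simp add: antipode_mult_g T_def add.commute)
qed

lemma T_Q: assumes x: "x \<in> carrier A" shows "T (Q x) = T x"
  using x T_mult_g[of "N x"] T_distrib(1)[of "E x" "N x"] by (simp add: Q_def T_distrib E_N)

text \<open>For b in B the sums of S(u) v and S(R u) v agree: the second is the first taken at R b,
  and the counit of R b is \<alpha> b, hence the counit of b. In T the terms with the plus sign then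
  average to the counit, and those with the minus sign cancel.\<close>

lemma antipode_left_D:
  assumes b: "b \<in> B" shows "sweedler D (\<lambda>u v. T u \<cdot> v) b = counit A b \<odot> \<one>"
proof -
  have s: "bil A (smult A) (\<lambda>u v. antipode A u \<cdot> v)" by (rule bilI) (auto simp: distrib)
  have sR: "bil A (smult A) (\<lambda>u v. antipode A (R u) \<cdot> v)" by (rule bilI) (auto simp: distrib)
  have t: "bil A (smult A) (\<lambda>u v. T u \<cdot> v)" by (rule bilI) (auto simp: distrib T_distrib)
  have bC: "b \<in> carrier A" using b by (rule BC)
  have e: "sweedler A (\<lambda>u v. antipode A (R u) \<cdot> v) b = counit A b \<odot> \<one>"
    using sweedler_R[OF s bC] antipode_left[of "R b"] bC b by (simp add: counit_R \<alpha>_B)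
  define P where "P = (\<lambda>u v. antipode A u \<cdot> v + antipode A (R u) \<cdot> v)"
  define M where "M = (\<lambda>u v. antipode A u \<cdot> v + (-1) \<odot> (antipode A (R u) \<cdot> v))"
  have bP: "bil A (smult A) P" unfolding P_def by (rule bil_add[OF s sR])
  have bM: "bil A (smult A) M" unfolding M_def by (rule bil_add[OF s bil_smult[OF sR]])
  have bP': "bil A (smult A) (\<lambda>u v. (1/2) \<odot> P u v)" "bil A (smult A) (\<lambda>u v. (1/2) \<odot> (g \<cdot> M u v))"
    by (rule bilI; simp add: distrib bilD[OF bP] bilD[OF bM] P_def M_def mult.commute)+
  have bM': "bil A (smult A) (\<lambda>u v. g \<cdot> M u v)"
    by (rule bilI; simp add: distrib bilD[OF bM] M_def)
  have P: "sweedler A P b = counit A b \<odot> \<one> + counit A b \<odot> \<one>" unfolding P_def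
    using sweedler_plus[OF s sR bC] e antipode_left[OF bC] by simp
  have "sweedler A M b = sweedler A (\<lambda>u v. antipode A u \<cdot> v) b + sweedler A (\<lambda>u v. (-1) \<odot> (antipode A (R u) \<cdot> v)) b"
    unfolding M_def by (rule sweedler_plus[OF s bil_smult[OF sR] bC])
  also have "\<dots> = counit A b \<odot> \<one> + (-1) \<odot> (counit A b \<odot> \<one>)"
    by (simp only: sweedler_smult_fun[OF sR bC] e antipode_left[OF bC])
  finally have M: "sweedler A M b = 0" by (simp add: smult_distrib)
  have gM: "sweedler A (\<lambda>u v. g \<cdot> M u v) b = g \<cdot> sweedler A M b"
    by (rule sweedler_hom[OF bM _ vs sub, symmetric]) (use bC in \<open>auto simp: linear_on_def distrib M_def\<close>)
  have "sweedler D (\<lambda>u v. T u \<cdot> v) b = sweedler A (\<lambda>u v. T (Q u) \<cdot> Q v) b"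
    by (rule sweedler_D[OF bil_bilB[OF t] b])
  also have "\<dots> = sweedler A (\<lambda>u v. T u \<cdot> Q v) b" by (rule sweedler_cong) (simp add: T_Q)
  also have "\<dots> = sweedler A (\<lambda>u v. T u \<cdot> v) b" by (rule sweedler_on_B(2)[OF t b])
  also have "\<dots> = sweedler A (\<lambda>u v. (1/2) \<odot> P u v + (1/2) \<odot> (g \<cdot> M u v)) b"
    by (rule sweedler_cong) (simp add: T_def P_def M_def distrib mult_assoc)
  also have "\<dots> = counit A b \<odot> \<one>"
    by (simp only: sweedler_plus[OF bP' bC] sweedler_smult_fun[OF bP bC] sweedler_smult_fun[OF bM' bC] gM P M
      mult_zero gC smult_distrib(1,5) half_add add_0_right)
  finally show ?thesis .
qed

text \<open>The exchange rule \<open>sweedler_LR\<close> applied to projections. On B, where R is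
  \<gamma>, the averages on the right are homogeneous parts, so this converts eigenspaces of L on
  one leg into parities on the other.\<close>

lemma sweedler_E_N_left:
  assumes F: "bil A s F" and x: "x \<in> carrier A"
  shows "sweedler A (\<lambda>u v. F (E u) v) x = sweedler A (\<lambda>u v. F u ((1/2) \<odot> (v + R v))) x"
    "sweedler A (\<lambda>u v. F (N u) v) x = sweedler A (\<lambda>u v. F u ((1/2) \<odot> (v - R v))) x"
proof -
  have s: "vector_space s" by (rule bilD(1)[OF F])
  have bL: "bil A s (\<lambda>u v. F (L u) v)" by (rule bilI) (auto simp: bilD[OF F] distrib)
  have bR: "bil A s (\<lambda>u v. F u (R v))" by (rule bilI) (auto simp: bilD[OF F] distrib)
  note l = bil_smult[OF bL, of "-1"] note r = bil_smult[OF bR, of "-1"]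
  have neg: "F u (- v) = s (-1) (F u v)" "F (- u) v = s (-1) (F u v)" if "u \<in> carrier A" "v \<in> carrier A" for u v
    using that bilD(4,5)[OF F, of u v "-1"] by (auto simp: smult_distrib)
  have F': "F u (v - w) = F u v + s (-1) (F u w)" "F (u - w) v = F u v + s (-1) (F w v)"
    if "u \<in> carrier A" "v \<in> carrier A" "w \<in> carrier A" for u v w
    using that bilD(3)[OF F, of u v "- w"] bilD(2)[OF F, of u "- w" v] neg by auto
  have "sweedler A (\<lambda>u v. F (E u) v) x = sweedler A (\<lambda>u v. s (1/2) (F u v + F (L u) v)) x"
    by (rule sweedler_cong) (simp add: E_def bilD[OF F])
  also have "\<dots> = sweedler A (\<lambda>u v. s (1/2) (F u v + F u (R v))) x"
    unfolding sweedler_smult_fun[OF bil_add[OF F bL] x] sweedler_smult_fun[OF bil_add[OF F bR] x]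
      sweedler_plus[OF F bL x] sweedler_plus[OF F bR x] sweedler_LR[OF F x] ..
  also have "\<dots> = sweedler A (\<lambda>u v. F u ((1/2) \<odot> (v + R v))) x"
    by (rule sweedler_cong) (simp add: bilD[OF F])
  finally show "sweedler A (\<lambda>u v. F (E u) v) x = sweedler A (\<lambda>u v. F u ((1/2) \<odot> (v + R v))) x" .
  have "sweedler A (\<lambda>u v. F (N u) v) x = sweedler A (\<lambda>u v. s (1/2) (F u v + s (-1) (F (L u) v))) x"
    by (rule sweedler_cong) (simp add: N_def bilD(4,5)[OF F] F')
  also have "\<dots> = sweedler A (\<lambda>u v. s (1/2) (F u v + s (-1) (F u (R v)))) x"
    unfolding sweedler_smult_fun[OF bil_add[OF F l] x] sweedler_smult_fun[OF bil_add[OF F r] x]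
      sweedler_plus[OF F l x] sweedler_plus[OF F r x] sweedler_smult_fun[OF bL x] sweedler_smult_fun[OF bR x] sweedler_LR[OF F x] ..
  also have "\<dots> = sweedler A (\<lambda>u v. F u ((1/2) \<odot> (v - R v))) x"
    by (rule sweedler_cong) (simp add: bilD(4,5)[OF F] F')
  finally show "sweedler A (\<lambda>u v. F (N u) v) x = sweedler A (\<lambda>u v. F u ((1/2) \<odot> (v - R v))) x" .
qed

lemma Q_E_N: "x \<in> carrier A \<Longrightarrow> Q (E x) = E x" "x \<in> carrier A \<Longrightarrow> Q (N x) = N x \<cdot> g"
  using Q_mult_g[of "N x"] Q_B[of "N x \<cdot> g"] by simp_all

text \<open>\<open>T v\<close> contains the averages with R; the exchange rule, read backwards,
  turns them into E and N on the left leg. There Q (E u) + Q (N u) g is u again, and the antipode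
  axiom of A remains.\<close>

lemma antipode_right_D:
  assumes b: "b \<in> B" shows "sweedler D (\<lambda>u v. u \<cdot> T v) b = counit A b \<odot> \<one>"
proof -
  have bC: "b \<in> carrier A" using b by (rule BC)
  have t: "bil A (smult A) (\<lambda>u v. u \<cdot> T v)" by (rule bilI) (auto simp: distrib T_distrib)
  have qS: "bil A (smult A) (\<lambda>u v. Q u \<cdot> antipode A v)" by (rule bilI) (auto simp: distrib ENQ_distrib)
  have qgS: "bil A (smult A) (\<lambda>u v. Q u \<cdot> (g \<cdot> antipode A v))" by (rule bilI) (auto simp: distrib ENQ_distrib)
  have e1: "bil A (smult A) (\<lambda>u v. Q u \<cdot> antipode A ((1/2) \<odot> (v + R v)))" by (rule bilI) (auto simp: distrib ENQ_distrib algebra_simps)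
  have e2: "bil A (smult A) (\<lambda>u v. Q u \<cdot> (g \<cdot> antipode A ((1/2) \<odot> (v - R v))))" by (rule bilI) (auto simp: distrib ENQ_distrib algebra_simps)
  have f1: "bil A (smult A) (\<lambda>u v. Q (E u) \<cdot> antipode A v)" by (rule bilI) (auto simp: distrib ENQ_distrib)
  have f2: "bil A (smult A) (\<lambda>u v. Q (N u) \<cdot> (g \<cdot> antipode A v))" by (rule bilI) (auto simp: distrib ENQ_distrib)
  have "sweedler D (\<lambda>u v. u \<cdot> T v) b = sweedler A (\<lambda>u v. Q u \<cdot> T (Q v)) b"
    by (rule sweedler_D[OF bil_bilB[OF t] b])
  also have "\<dots> = sweedler A (\<lambda>u v. Q u \<cdot> antipode A ((1/2) \<odot> (v + R v)) + Q u \<cdot> (g \<cdot> antipode A ((1/2) \<odot> (v - R v)))) b"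
    by (rule sweedler_cong, simp only: T_Q, simp add: T_def mult_distrib)
  also have "\<dots> = sweedler A (\<lambda>u v. Q (E u) \<cdot> antipode A v) b + sweedler A (\<lambda>u v. Q (N u) \<cdot> (g \<cdot> antipode A v)) b"
    unfolding sweedler_plus[OF e1 e2 bC] sweedler_E_N_left[OF qS bC] sweedler_E_N_left[OF qgS bC] ..
  also have "\<dots> = sweedler A (\<lambda>u v. Q (E u) \<cdot> antipode A v + Q (N u) \<cdot> (g \<cdot> antipode A v)) b"
    by (rule sweedler_plus[symmetric, OF f1 f2 bC])
  also have "\<dots> = sweedler A (\<lambda>u v. u \<cdot> antipode A v) b"
  proof (rule sweedler_cong)
    fix u v assume uv: "u \<in> carrier A" "v \<in> carrier A"
    have "N u \<cdot> g \<cdot> (g \<cdot> antipode A v) = N u \<cdot> antipode A v" using uv by (simp add: mult_assoc)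
    then show "Q (E u) \<cdot> antipode A v + Q (N u) \<cdot> (g \<cdot> antipode A v) = u \<cdot> antipode A v"
      using uv mult_distrib(2)[of "E u" "antipode A v" "N u"] by (simp add: Q_E_N E_N)
  qed
  finally show ?thesis using antipode_right[OF bC] by simp
qed

section \<open>The Hopf axioms of B that do not involve the symmetry\<close>

lemma coinv_comult_space: "comult_space D"
proof (rule comult_space.intro; simp)
  have bt: "bil A fscale (\<lambda>u v. Q u \<otimes>\<^bsub>A\<^esub> Q v)" by (rule bilI) (auto simp: distrib ENQ_distrib)
  show "vector_space (smult A)" by (rule vs)
  show "module.subspace (smult A) B" by (rule subspace_B)
  show "comult D x \<in> tensor_space (smult A) (smult A) B B" if "x \<in> B" for x
    unfolding comult_D_B[OF that]
    by (rule sweedler_mem[OF bt subspace_tensor_space[OF vs vs subspace_B subspace_B] _ BC[OF that]]) (simp add: tens_in_tensor_space)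
  show "linear_on (smult A) fscale B (comult D)"
    using sweedler_linear[OF bt] by (simp add: linear_on_def lin_def comult_D_B BC)
qed

lemma coinv_hopf_core: "hopf_core D"
proof -
  interpret D: comult_space D by (rule coinv_comult_space)
  have bt: "bil A fscale (\<lambda>u v. Q u \<otimes>\<^bsub>A\<^esub> Q v)" by (rule bilI) (auto simp: distrib ENQ_distrib)
  \<comment> \<open>Q preserves the counit, so the sum in A contracts to Q x, and this is x.\<close>
  have c1: "sweedler D (\<lambda>u v. counit A u \<odot> v) x = x" if "x \<in> B" for x
  proof -
    have "sweedler D (\<lambda>u v. counit A u \<odot> v) x = sweedler A (\<lambda>u v. counit A (Q u) \<odot> Q v) x"
      by (rule sweedler_D[OF bil_bilB[OF lin_bil_left[OF lin_id]] that])
    also have "\<dots> = sweedler A (\<lambda>u v. counit A u \<odot> Q v) x" by (rule sweedler_cong) (simp add: counit_Q)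
    also have "\<dots> = Q x" by (rule sweedler_counit_left) (auto intro!: linI simp: that BC ENQ_distrib vs)
    finally show ?thesis using that by simp
  qed
  have c2: "sweedler D (\<lambda>u v. counit A v \<odot> u) x = x" if "x \<in> B" for x
  proof -
    have "sweedler D (\<lambda>u v. counit A v \<odot> u) x = sweedler A (\<lambda>u v. counit A (Q v) \<odot> Q u) x"
      by (rule sweedler_D[OF bil_bilB[OF lin_bil_right[OF lin_id]] that])
    also have "\<dots> = sweedler A (\<lambda>u v. counit A v \<odot> Q u) x" by (rule sweedler_cong) (simp add: counit_Q)
    also have "\<dots> = Q x" by (rule sweedler_counit_right) (auto intro!: linI simp: that BC ENQ_distrib vs)
    finally show ?thesis using that by simp
  qed
  have c3: "sweedler D (\<lambda>u v. antipode D u \<cdot> v) x = counit A x \<odot> \<one>" if "x \<in> B" for x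
  proof -
    have "sweedler D (\<lambda>u v. antipode D u \<cdot> v) x = sweedler D (\<lambda>u v. T u \<cdot> v) x"
      by (rule tensor_lift_cong) (simp add: antipode_D BC)
    then show ?thesis using antipode_left_D[OF that] by simp
  qed
  have c4: "sweedler D (\<lambda>u v. u \<cdot> antipode D v) x = counit A x \<odot> \<one>" if "x \<in> B" for x
  proof -
    have "sweedler D (\<lambda>u v. u \<cdot> antipode D v) x = sweedler D (\<lambda>u v. u \<cdot> T v) x"
      by (rule tensor_lift_cong) (simp add: antipode_D BC)
    then show ?thesis using antipode_right_D[OF that] by simp
  qed
  \<comment> \<open>Both sides become the threefold coproduct of A with Q on every leg. The inner
    coproducts of D are taken at Q u and Q v with u, v in A, which is the situation of
    \<open>sweedler_QQ\<close>.\<close>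
  have c5: "sweedler D (\<lambda>u v. sweedler D (\<lambda>u1 u2. tens (smult A) fscale u1 (u2 \<otimes>\<^bsub>A\<^esub> v)) u) x
     = sweedler D (\<lambda>u v. tens (smult A) fscale u (comult D v)) x" if x: "x \<in> B" for x
  proof -
    let ?t = "tens (smult A) fscale :: 'a \<Rightarrow> ('k, 'a, 'a) tensor \<Rightarrow> _"
    have t3: "?t (u + u') t = ?t u t + ?t u' t" "?t u (t + t') = ?t u t + ?t u t'"
      "?t (c \<odot> u) t = fscale c (?t u t)" "?t u (fscale c t) = fscale c (?t u t)" for u u' t t' c
      using bilinear_on_tens[OF vs vector_space_fscale[where 'i="'a \<Rightarrow> 'a \<Rightarrow> 'k"]] unfolding bilinear_on_def linear_on_def by auto
    note d = t3 tens_distrib vector_space_fscale ENQ_distrib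
    have b1: "bilB fscale (\<lambda>u1 u2. ?t u1 (u2 \<otimes>\<^bsub>A\<^esub> v))" for v by (rule bilBI) (auto simp: d)
    have t1: "tri A fscale (\<lambda>u v w. ?t (Q u) (Q v \<otimes>\<^bsub>A\<^esub> Q w))" by (rule triI) (auto simp: d)
    have t1': "tri D fscale (\<lambda>u v w. ?t u (v \<otimes>\<^bsub>A\<^esub> w))" by (rule triI) (auto simp: d)
    have b2: "bilB fscale (\<lambda>u v. ?t u (comult D v))"
      by (rule bilBI) (use D.comult_lin in \<open>auto simp: d linear_on_def\<close>)
    have "sweedler D (\<lambda>u v. sweedler D (\<lambda>u1 u2. ?t u1 (u2 \<otimes>\<^bsub>A\<^esub> v)) u) x
      = sweedler A (\<lambda>u v. sweedler D (\<lambda>u1 u2. ?t u1 (u2 \<otimes>\<^bsub>A\<^esub> Q v)) (Q u)) x"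
      by (rule sweedler_D[OF _ x]) (use D.bil_sweedler_left[OF t1'] in \<open>simp add: bilB_def bil_def\<close>)
    also have "\<dots> = sweedler A (\<lambda>u v. sweedler A (\<lambda>u1 u2. ?t (Q u1) (Q u2 \<otimes>\<^bsub>A\<^esub> Q v)) u) x"
      by (rule sweedler_cong) (rule sweedler_QQ[OF b1])
    also have "\<dots> = sweedler A (\<lambda>u v. sweedler A (\<lambda>v1 v2. ?t (Q u) (Q v1 \<otimes>\<^bsub>A\<^esub> Q v2)) v) x"
      by (rule sweedler_coassoc[OF t1 BC[OF x]])
    also have "\<dots> = sweedler A (\<lambda>u v. ?t (Q u) (comult D (Q v))) x"
    proof (rule sweedler_cong)
      fix u v assume uv: "u \<in> carrier A" "v \<in> carrier A"
      have "comult D (Q v) = sweedler D (\<lambda>u v. u \<otimes>\<^bsub>A\<^esub> v) (Q v)" using D.sweedler_tens[of "Q v"] uv by simp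
      also have "\<dots> = sweedler A (\<lambda>u v. Q u \<otimes>\<^bsub>A\<^esub> Q v) v" by (rule sweedler_QQ[OF bil_bilB[OF bil_tens] uv(2)])
      finally have "?t (Q u) (comult D (Q v)) = ?t (Q u) (sweedler A (\<lambda>u v. Q u \<otimes>\<^bsub>A\<^esub> Q v) v)" by simp
      also have "\<dots> = sweedler A (\<lambda>v1 v2. ?t (Q u) (Q v1 \<otimes>\<^bsub>A\<^esub> Q v2)) v"
        by (rule sweedler_hom[OF bt _ vector_space_fscale subspace_tensor_space[OF vs vs sub sub] _ uv(2)])
          (auto simp: linear_on_def d intro!: tens_closed)
      finally show "sweedler A (\<lambda>v1 v2. ?t (Q u) (Q v1 \<otimes>\<^bsub>A\<^esub> Q v2)) v = ?t (Q u) (comult D (Q v))" ..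
    qed
    also have "\<dots> = sweedler D (\<lambda>u v. ?t u (comult D v)) x"
      by (rule sweedler_D[OF b2 x, symmetric])
    finally show ?thesis .
  qed
  show ?thesis
  proof (rule hopf_core.intro; simp)
    show "vector_space (smult A)" by (rule vs)
    show "module.subspace (smult A) B" by (rule subspace_B)
    show "bilinear_on (smult A) (smult A) (smult A) B B (mult A)"
      by (auto simp: bilinear_on_def linear_on_def mult_distrib BC)
    show "\<And>x y z. x \<in> B \<Longrightarrow> y \<in> B \<Longrightarrow> z \<in> B \<Longrightarrow> x \<cdot> y \<cdot> z = x \<cdot> (y \<cdot> z)" by (simp add: mult_assoc BC)
    show "\<And>x. x \<in> B \<Longrightarrow> \<one> \<cdot> x = x" "\<And>x. x \<in> B \<Longrightarrow> x \<cdot> \<one> = x" by (simp_all add: BC)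
    show "\<And>x. x \<in> B \<Longrightarrow> comult D x \<in> tensor_space (smult A) (smult A) B B" using D.comult_cl by simp
    show "linear_on (smult A) fscale B (comult D)" using D.comult_lin by simp
    show "linear_on (smult A) (*) B (counit A)" by (simp add: linear_on_def counit_distrib BC)
    show "\<And>x y. x \<in> B \<Longrightarrow> y \<in> B \<Longrightarrow> counit A (x \<cdot> y) = counit A x * counit A y" by (simp add: counit_mult BC)
    have bt: "bil A fscale (\<lambda>u v. Q u \<otimes>\<^bsub>A\<^esub> Q v)" by (rule bilI) (auto simp: distrib ENQ_distrib)
    show "comult D \<one> = \<one> \<otimes>\<^bsub>A\<^esub> \<one>" by (simp add: comult_D_B sweedler_one[OF bt])
    show "\<And>x. x \<in> B \<Longrightarrow> antipode D x \<in> B" by (simp add: antipode_D BC)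
    show "linear_on (smult A) (smult A) B (antipode D)"
      by (simp add: linear_on_def antipode_D BC T_distrib)
  qed (use c1 c2 c3 c4 c5 in simp_all)
qed

end

section \<open>The grading by conjugation with g and the sign rule\<close>

lemma parity_sign_simps [simp]: "parity_sign 0 = 1" "parity_sign 1 = - 1"
  by (simp_all add: parity_sign_def)

lemma bit_induct: "P 0 \<Longrightarrow> P 1 \<Longrightarrow> P (i :: bit)" by (cases i) simp_all

text \<open>Two candidates differ by an element of both degrees, hence by 0. The assumptions are
  listed explicitly so that the result applies to the coinvariants while they are still being shown
  to form a Hopf superalgebra.\<close>

lemma homog_part_eq:
  assumes "vector_space (smult H)" "\<And>i. module.subspace (smult H) (grade H i)"
    and "grade H 0 \<inter> grade H 1 = {0}" and y: "y \<in> grade H i" and z: "z \<in> grade H (i + 1)"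
  shows "homog_part H i (y + z) = y"
  unfolding homog_part_def
proof (rule the_equality)
  show "y \<in> grade H i \<and> y + z - y \<in> grade H (i + 1)" using y z by simp
next
  interpret V: vector_space "smult H" by fact
  fix y' assume y': "y' \<in> grade H i \<and> y + z - y' \<in> grade H (i + 1)"
  have "y' - y \<in> grade H i" using y y' V.subspace_diff[OF assms(2)] by blast
  moreover have "z - (y + z - y') \<in> grade H (i + 1)" using z y' V.subspace_diff[OF assms(2)] by blast
  then have "y' - y \<in> grade H (i + 1)" by (simp add: algebra_simps)
  moreover have "grade H i \<inter> grade H (i + 1) = {0}"
    using assms(3) by (cases i) (auto simp: Int_commute)
  ultimately have "y' - y \<in> {0}" by blast
  then show "y' = y" by simp
qed

context super_datum begin

text \<open>The projection onto degree i, written with \<gamma> so that it exists on all of A; on B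
  it is \<open>homog_part\<close>, by \<open>homog_part_D\<close>.\<close>

definition P where "P i x = (1/2) \<odot> (x + parity_sign i \<odot> \<gamma> x)"

lemma P_closed [simp]: "x \<in> carrier A \<Longrightarrow> P i x \<in> carrier A" "x \<in> B \<Longrightarrow> P i x \<in> B"
  by (auto simp: P_def BC)

lemma P_distrib: "x \<in> carrier A \<Longrightarrow> y \<in> carrier A \<Longrightarrow> P i (x + y) = P i x + P i y"
  "x \<in> carrier A \<Longrightarrow> P i (c \<odot> x) = c \<odot> P i x"
  by (auto simp: P_def \<gamma>_distrib smult_distrib algebra_simps)

lemma P_sum: "P 0 x + P 1 x = x" by (simp add: P_def smult_distrib half_add)

lemma \<gamma>_P: "x \<in> carrier A \<Longrightarrow> \<gamma> (P i x) = parity_sign i \<odot> P i x"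
  by (cases i) (auto simp: P_def \<gamma>_distrib smult_distrib algebra_simps)

lemma P_diff: "x \<in> carrier A \<Longrightarrow> \<gamma> x = P 0 x - P 1 x"
  using P_sum[of x] \<gamma>_P[of x 0] \<gamma>_P[of x 1] \<gamma>_distrib(1)[of "P 0 x" "P 1 x"] by (simp add: smult_distrib)

lemma P_grade [simp]: "x \<in> B \<Longrightarrow> P i x \<in> grade D i" by (simp add: grade_D \<gamma>_P BC)

lemma subspace_grade_D: "module.subspace (smult A) (grade D i)"
  by (rule V.subspaceI) (auto simp: grade_D BC \<gamma>_distrib smult_distrib mult.commute)

lemma grade_inter_D: "grade D 0 \<inter> grade D 1 = {0}"
proof -
  have "x = 0" if "x \<in> B" "\<gamma> x = x" "\<gamma> x = - x" for x using that neg_eq_imp_zero[of x] by simp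
  then show ?thesis by (auto simp: grade_D smult_distrib)
qed

lemma homog_part_D: assumes "x \<in> B" shows "homog_part D i x = P i x"
proof -
  have "x = P i x + P (i + 1) x" using P_sum[of x] by (cases i) (auto simp: add.commute)
  moreover have "homog_part D i (P i x + P (i + 1) x) = P i x"
    by (rule homog_part_eq) (use assms subspace_grade_D grade_inter_D vs in simp_all)
  ultimately show ?thesis by simp
qed

lemma Q_\<gamma>: "x \<in> carrier A \<Longrightarrow> Q (\<gamma> x) = \<gamma> (Q x)"
  by (simp add: Q_def E_def N_def L_\<gamma> \<gamma>_distrib \<gamma>_mult)

text \<open>Conjugation by g is compatible with coproducts and commutes with Q, so \<gamma> (x)
  \<gamma> multiplies the coproduct of x by the sign of its degree k. Averaging over this symmetry
  removes the components whose total degree is not k.\<close>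

lemma comult_grade_D:
  assumes x: "x \<in> grade D k"
  shows "comult D x = (\<Sum>i\<in>UNIV. sweedler A (\<lambda>u v. P i (Q u) \<otimes>\<^bsub>A\<^esub> P (k - i) (Q v)) x)"
proof -
  have xB: "x \<in> B" and \<gamma>x: "\<gamma> x = parity_sign k \<odot> x" using x by (auto simp: grade_D)
  have xC: "x \<in> carrier A" using xB by (rule BC)
  note d = distrib ENQ_distrib P_distrib \<gamma>_distrib
  let ?W = "\<lambda>u v. Q u \<otimes>\<^bsub>A\<^esub> Q v" let ?W' = "\<lambda>u v. \<gamma> (Q u) \<otimes>\<^bsub>A\<^esub> \<gamma> (Q v)"
  have bW: "bil A fscale ?W" and bW': "bil A fscale ?W'" by (rule bilI; simp add: d)+
  have b: "bil A fscale (\<lambda>u v. P i (Q u) \<otimes>\<^bsub>A\<^esub> P j (Q v))" for i j by (rule bilI) (simp_all add: d)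
  have ss: "parity_sign k * parity_sign k = (1 :: 'k)" by (cases k) simp_all
  have "fscale (parity_sign k) (sweedler A ?W' x) = fscale (parity_sign k) (sweedler A ?W (\<gamma> x))"
    using sweedler_\<gamma>[OF bW xC] sweedler_cong[of "\<lambda>u v. ?W (\<gamma> u) (\<gamma> v)" ?W' x] by (simp add: Q_\<gamma>)
  also have "\<dots> = sweedler A ?W x"
    unfolding \<gamma>x sweedler_smult[OF bW xC] by (simp add: fscale_distrib ss)
  finally have "sweedler A ?W x = fscale (1/2) (sweedler A ?W x + fscale (parity_sign k) (sweedler A ?W' x))"
    using two by (simp add: fscale_def fun_eq_iff mult_2[symmetric])
  also have "\<dots> = sweedler A (\<lambda>u v. fscale (1/2) (?W u v + fscale (parity_sign k) (?W' u v))) x"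
    by (simp only: sweedler_smult_fun[OF bil_add[OF bW bil_smult[OF bW']] xC] sweedler_plus[OF bW bil_smult[OF bW'] xC] sweedler_smult_fun[OF bW' xC])
  also have "\<dots> = sweedler A (\<lambda>u v. P 0 (Q u) \<otimes>\<^bsub>A\<^esub> P k (Q v) + (P 1 (Q u) \<otimes>\<^bsub>A\<^esub> P (k - 1) (Q v))) x"
  proof (rule sweedler_cong)
    fix u v assume uv: "u \<in> carrier A" "v \<in> carrier A"
    have half: "fscale (1/2) (X + X) = X" for X :: "('k, 'a, 'a) tensor"
      using two by (simp add: fscale_def fun_eq_iff mult_2[symmetric])
    have *: "Q u = P 0 (Q u) + P 1 (Q u)" "Q v = P 0 (Q v) + P 1 (Q v)" by (simp_all add: P_sum)
    \<comment> \<open>The four bihomogeneous components; \<gamma> (x) \<gamma> acts on each of them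
      by a sign.\<close>
    have W: "?W u v = tens (smult A) (smult A) (P 0 (Q u)) (P 0 (Q v)) + tens (smult A) (smult A) (P 0 (Q u)) (P 1 (Q v)) 
       + tens (smult A) (smult A) (P 1 (Q u)) (P 0 (Q v)) + tens (smult A) (smult A) (P 1 (Q u)) (P 1 (Q v))"
      by (subst *(1), subst *(2)) (simp only: tens_distrib add_ac)
    have W': "?W' u v = tens (smult A) (smult A) (P 0 (Q u)) (P 0 (Q v)) - tens (smult A) (smult A) (P 0 (Q u)) (P 1 (Q v)) 
       - tens (smult A) (smult A) (P 1 (Q u)) (P 0 (Q v)) + tens (smult A) (smult A) (P 1 (Q u)) (P 1 (Q v))"
      using uv by (simp only: P_diff[OF ENQ_closed(3)] tens_distrib) (simp add: algebra_simps)
    have W0: "?W u v + ?W' u v = (tens (smult A) (smult A) (P 0 (Q u)) (P 0 (Q v)) + tens (smult A) (smult A) (P 1 (Q u)) (P 1 (Q v)))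
        + (tens (smult A) (smult A) (P 0 (Q u)) (P 0 (Q v)) + tens (smult A) (smult A) (P 1 (Q u)) (P 1 (Q v)))"
      unfolding W W' by (simp add: algebra_simps)
    have W1: "?W u v - ?W' u v = (tens (smult A) (smult A) (P 0 (Q u)) (P 1 (Q v)) + tens (smult A) (smult A) (P 1 (Q u)) (P 0 (Q v)))
        + (tens (smult A) (smult A) (P 0 (Q u)) (P 1 (Q v)) + tens (smult A) (smult A) (P 1 (Q u)) (P 0 (Q v)))"
      unfolding W W' by (simp add: algebra_simps)
    show "fscale (1/2) (?W u v + fscale (parity_sign k) (?W' u v)) = P 0 (Q u) \<otimes>\<^bsub>A\<^esub> P k (Q v) + (P 1 (Q u) \<otimes>\<^bsub>A\<^esub> P (k - 1) (Q v))"
    proof (cases "k = 0")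
      case True
      then show ?thesis using W0 half by (simp add: fscale_distrib)
    next
      case False
      then have "k = 1" by (cases k) simp_all
      then show ?thesis using W1 half by (simp add: fscale_distrib)
    qed
  qed
  also have "\<dots> = sweedler A (\<lambda>u v. P 0 (Q u) \<otimes>\<^bsub>A\<^esub> P (k - 0) (Q v)) x + sweedler A (\<lambda>u v. P 1 (Q u) \<otimes>\<^bsub>A\<^esub> P (k - 1) (Q v)) x"
    using sweedler_plus[OF b b xC] by simp
  finally show ?thesis using comult_D_B[OF xB] by (simp add: UNIV_bit)
qed

text \<open>L is a multiplicative involution, so its eigenspaces form a Z_2-grading of the algebra
  A.\<close>

lemma E_mult:
  assumes x: "x \<in> carrier A" and y: "y \<in> carrier A"
  shows "E (x \<cdot> y) = E x \<cdot> E y + N x \<cdot> N y" "N (x \<cdot> y) = E x \<cdot> N y + N x \<cdot> E y"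
proof -
  have e: "E z = z" "N z = 0" if "z \<in> carrier A" "L z = z" for z using that by (auto simp: B_def)
  have n: "E z = 0" "N z = z" if "z \<in> carrier A" "L z = - z" for z using that by (auto simp: E_def N_def smult_distrib half_add)
  have "x \<cdot> y = (E x + N x) \<cdot> (E y + N y)" using x y by (simp add: E_N)
  also have "\<dots> = (E x \<cdot> E y + N x \<cdot> N y) + (E x \<cdot> N y + N x \<cdot> E y)"
    using x y by (simp add: mult_distrib algebra_simps)
  finally have *: "x \<cdot> y = (E x \<cdot> E y + N x \<cdot> N y) + (E x \<cdot> N y + N x \<cdot> E y)" .
  have c: "E x \<cdot> E y + N x \<cdot> N y \<in> carrier A" "E x \<cdot> N y + N x \<cdot> E y \<in> carrier A" using x y by simp_all
  have l: "L (E x \<cdot> E y + N x \<cdot> N y) = E x \<cdot> E y + N x \<cdot> N y" "L (E x \<cdot> N y + N x \<cdot> E y) = - (E x \<cdot> N y + N x \<cdot> E y)"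
    using x y by (auto simp: LR_distrib L_mult mult_distrib)
  show "E (x \<cdot> y) = E x \<cdot> E y + N x \<cdot> N y" "N (x \<cdot> y) = E x \<cdot> N y + N x \<cdot> E y"
    unfolding * ENQ_distrib(1,4)[OF c] using e[OF c(1) l(1)] n[OF c(2) l(2)] by simp_all
qed

text \<open>The source of the sign rule: Q (N x) is N x g, and its factor g can pass an element of A
  only at the price of \<gamma>.\<close>

lemma Q_mult:
  assumes x: "x \<in> carrier A" and y: "y \<in> carrier A"
  shows "Q (E x) \<cdot> Q y + Q (N x) \<cdot> \<gamma> (Q y) = Q (x \<cdot> y)"
proof -
  have "Q (N x) \<cdot> \<gamma> (Q y) = N x \<cdot> (g \<cdot> \<gamma> (Q y))" using x y by (simp add: Q_E_N mult_assoc)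
  also have "\<dots> = N x \<cdot> (Q y \<cdot> g)" using y by (simp add: g_mult)
  also have "Q y \<cdot> g = E y \<cdot> g + N y" using y by (simp add: Q_def mult_distrib)
  finally show ?thesis using x y by (simp add: Q_E_N E_mult Q_def mult_distrib mult_assoc algebra_simps)
qed

text \<open>The signed sum pairs the even part of x2 with y1 and the odd part with \<gamma> y1.
  Written with R, these parts are moved by the exchange rule to the left leg x1, where they become E
  and N, and \<open>Q_mult\<close> merges the two cases into Q (x1 y1).\<close>

lemma comult_mult_D:
  assumes x: "x \<in> B" and y: "y \<in> B"
  shows "comult D (x \<cdot> y) = sweedler D (\<lambda>x1 x2. sweedler D (\<lambda>y1 y2.
              \<Sum>i\<in>UNIV. \<Sum>j\<in>UNIV. fscale (parity_sign (i * j))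
                ((x1 \<cdot> homog_part D j y1) \<otimes>\<^bsub>A\<^esub> (homog_part D i x2 \<cdot> y2))) y) x"
proof -
  interpret D: comult_space D by (rule coinv_comult_space)
  have xC: "x \<in> carrier A" and yC: "y \<in> carrier A" using x y by (auto simp: BC)
  note d = distrib ENQ_distrib P_distrib \<gamma>_distrib BC
  define F where "F x1 x2 y1 y2 = ((x1 \<cdot> y1) \<otimes>\<^bsub>A\<^esub> (((1/2) \<odot> (x2 + R x2)) \<cdot> y2)) + ((x1 \<cdot> \<gamma> y1) \<otimes>\<^bsub>A\<^esub> (((1/2) \<odot> (x2 - R x2)) \<cdot> y2))"
    for x1 x2 y1 y2
  have Feq: "(\<Sum>i\<in>UNIV. \<Sum>j\<in>UNIV. fscale (parity_sign (i * j)) ((x1 \<cdot> homog_part D j y1) \<otimes>\<^bsub>A\<^esub> (homog_part D i x2 \<cdot> y2))) = F x1 x2 y1 y2"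
    if "x1 \<in> B" "x2 \<in> B" "y1 \<in> B" "y2 \<in> B" for x1 x2 y1 y2
  proof -
    have c: "x1 \<in> carrier A" "x2 \<in> carrier A" "y1 \<in> carrier A" "y2 \<in> carrier A" using that BC by auto
    have p: "P 0 x2 = (1/2) \<odot> (x2 + R x2)" "P 1 x2 = (1/2) \<odot> (x2 - R x2)" using that by (simp_all add: P_def R_B smult_distrib)
    have "x1 \<cdot> y1 = x1 \<cdot> P 0 y1 + x1 \<cdot> P 1 y1" using mult_distrib(1)[of x1 "P 0 y1" "P 1 y1"] c by (simp add: P_sum)
    moreover have "x1 \<cdot> \<gamma> y1 = x1 \<cdot> P 0 y1 - x1 \<cdot> P 1 y1" using c by (simp add: P_diff mult_distrib)
    ultimately have "F x1 x2 y1 y2 = ((x1 \<cdot> P 0 y1 + x1 \<cdot> P 1 y1) \<otimes>\<^bsub>A\<^esub> (P 0 x2 \<cdot> y2)) + ((x1 \<cdot> P 0 y1 - x1 \<cdot> P 1 y1) \<otimes>\<^bsub>A\<^esub> (P 1 x2 \<cdot> y2))"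
      by (simp add: F_def p)
    then show ?thesis using that
      by (simp add: UNIV_bit homog_part_D tens_distrib fscale_distrib algebra_simps)
  qed
  have bF: "bil A fscale (F x1 x2)" if "x1 \<in> carrier A" "x2 \<in> carrier A" for x1 x2
    using that by (intro bilI) (auto simp: F_def d algebra_simps fscale_distrib)
  have bF': "bil A fscale (\<lambda>x1 x2. F x1 x2 y1 y2)" if "y1 \<in> carrier A" "y2 \<in> carrier A" for y1 y2
    using that by (intro bilI) (auto simp: F_def d algebra_simps fscale_distrib mult.commute)
  have bD: "bil D fscale f \<longleftrightarrow> bilB fscale f" for f :: "'a \<Rightarrow> 'a \<Rightarrow> ('k, 'a, 'a) tensor" by (simp add: bil_def bilB_def)
  have bFB: "bilB fscale (F x1 x2)" if "x1 \<in> B" "x2 \<in> B" for x1 x2 using bil_bilB[OF bF] that BC by blast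
  have bFB': "bilB fscale (\<lambda>x1 x2. sweedler D (F x1 x2) y)"
    using D.bil_sweedler_param[of y fscale F] y bFB bil_bilB[OF bF'] BC by (simp add: bD)
  \<comment> \<open>The sums over y are carried out inside \<open>H1\<close> and \<open>H2\<close>,
    which belong to the even and to the odd part of x2; only x remains for the exchange
    rule.\<close>
  define H1 where "H1 = (\<lambda>x1 x2. sweedler A (\<lambda>y1 y2. (Q x1 \<cdot> Q y1) \<otimes>\<^bsub>A\<^esub> (x2 \<cdot> y2)) y)"
  define H2 where "H2 = (\<lambda>x1 x2. sweedler A (\<lambda>y1 y2. (Q x1 \<cdot> \<gamma> (Q y1)) \<otimes>\<^bsub>A\<^esub> (x2 \<cdot> y2)) y)"
  have b1: "bil A fscale (\<lambda>y1 y2. (u \<cdot> Q y1) \<otimes>\<^bsub>A\<^esub> (v \<cdot> y2))" 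
    and b2: "bil A fscale (\<lambda>y1 y2. (u \<cdot> \<gamma> (Q y1)) \<otimes>\<^bsub>A\<^esub> (v \<cdot> y2))" if "u \<in> carrier A" "v \<in> carrier A" for u v
    by (rule bilI; simp add: d that)+
  have bH1: "bil A fscale H1" unfolding H1_def
    by (rule bil_sweedler_param[OF yC b1]) (auto intro!: bilI simp: d)
  have bH2: "bil A fscale H2" unfolding H2_def
    by (rule bil_sweedler_param[OF yC b2]) (auto intro!: bilI simp: d)
  have bH1': "bil A fscale (\<lambda>u v. H1 (E u) v)" "bil A fscale (\<lambda>u v. H1 u ((1/2) \<odot> (v + R v)))"
    and bH2': "bil A fscale (\<lambda>u v. H2 (N u) v)" "bil A fscale (\<lambda>u v. H2 u ((1/2) \<odot> (v - R v)))"
  proof -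
    have H2m: "H2 u (v - w) = H2 u v - H2 u w" if "u \<in> carrier A" "v \<in> carrier A" "w \<in> carrier A" for u v w
      using bilD(3)[OF bH2, of u "v - w" w] that by (simp add: algebra_simps)
    show "bil A fscale (\<lambda>u v. H1 (E u) v)" "bil A fscale (\<lambda>u v. H1 u ((1/2) \<odot> (v + R v)))"
      "bil A fscale (\<lambda>u v. H2 (N u) v)" "bil A fscale (\<lambda>u v. H2 u ((1/2) \<odot> (v - R v)))"
      by (rule bilI; simp add: bilD[OF bH1] bilD[OF bH2] H2m LR_distrib ENQ_distrib vector_space_fscale fscale_distrib algebra_simps)+
  qed
  have "sweedler D (\<lambda>x1 x2. sweedler D (\<lambda>y1 y2. \<Sum>i\<in>UNIV. \<Sum>j\<in>UNIV. fscale (parity_sign (i * j))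
                ((x1 \<cdot> homog_part D j y1) \<otimes>\<^bsub>A\<^esub> (homog_part D i x2 \<cdot> y2))) y) x
      = sweedler D (\<lambda>x1 x2. sweedler D (F x1 x2) y) x"
    by (intro tensor_lift_cong) (rule Feq; simp)
  also have "\<dots> = sweedler A (\<lambda>x1 x2. sweedler D (F (Q x1) (Q x2)) y) x"
    by (rule sweedler_D[OF bFB' x])
  also have "\<dots> = sweedler A (\<lambda>x1 x2. H1 x1 ((1/2) \<odot> (Q x2 + R (Q x2))) + H2 x1 ((1/2) \<odot> (Q x2 - R (Q x2)))) x"
  proof (rule sweedler_cong)
    fix x1 x2 assume xx: "x1 \<in> carrier A" "x2 \<in> carrier A"
    have b: "bil A fscale (\<lambda>y1 y2. F (Q x1) (Q x2) (Q y1) y2)"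
      using bF[of "Q x1" "Q x2"] xx by (intro bilI) (auto simp: bilD ENQ_distrib)
    have "sweedler D (F (Q x1) (Q x2)) y = sweedler A (\<lambda>y1 y2. F (Q x1) (Q x2) (Q y1) (Q y2)) y"
      by (rule sweedler_D[OF bFB y]) (use xx in simp_all)
    also have "\<dots> = sweedler A (\<lambda>y1 y2. F (Q x1) (Q x2) (Q y1) y2) y" by (rule sweedler_on_B(2)[OF b y])
    also have "\<dots> = H1 x1 ((1/2) \<odot> (Q x2 + R (Q x2))) + H2 x1 ((1/2) \<odot> (Q x2 - R (Q x2)))"
      unfolding F_def H1_def H2_def by (rule sweedler_plus[OF b1 b2 yC]) (use xx in simp_all)
    finally show "sweedler D (F (Q x1) (Q x2)) y = H1 x1 ((1/2) \<odot> (Q x2 + R (Q x2))) + H2 x1 ((1/2) \<odot> (Q x2 - R (Q x2)))" .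
  qed
  also have "\<dots> = sweedler A (\<lambda>x1 x2. H1 x1 ((1/2) \<odot> (x2 + R x2)) + H2 x1 ((1/2) \<odot> (x2 - R x2))) x"
    by (rule sweedler_on_B(2)[OF bil_add[OF bH1'(2) bH2'(2)] x])
  also have "\<dots> = sweedler A (\<lambda>x1 x2. H1 (E x1) x2 + H2 (N x1) x2) x"
    unfolding sweedler_plus[OF bH1'(2) bH2'(2) xC] sweedler_plus[OF bH1'(1) bH2'(1) xC]
      sweedler_E_N_left(1)[OF bH1 xC] sweedler_E_N_left(2)[OF bH2 xC] ..
  also have "\<dots> = sweedler A (\<lambda>x1 x2. sweedler A (\<lambda>y1 y2. Q (x1 \<cdot> y1) \<otimes>\<^bsub>A\<^esub> (x2 \<cdot> y2)) y) x"
  proof (rule sweedler_cong)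
    fix x1 x2 assume xx: "x1 \<in> carrier A" "x2 \<in> carrier A"
    have "H1 (E x1) x2 + H2 (N x1) x2 = sweedler A (\<lambda>y1 y2. ((Q (E x1) \<cdot> Q y1) \<otimes>\<^bsub>A\<^esub> (x2 \<cdot> y2)) + ((Q (N x1) \<cdot> \<gamma> (Q y1)) \<otimes>\<^bsub>A\<^esub> (x2 \<cdot> y2))) y"
      unfolding H1_def H2_def by (rule sweedler_plus[OF b1 b2 yC, symmetric]) (use xx in simp_all)
    also have "\<dots> = sweedler A (\<lambda>y1 y2. Q (x1 \<cdot> y1) \<otimes>\<^bsub>A\<^esub> (x2 \<cdot> y2)) y"
      by (rule sweedler_cong) (simp only: tens_distrib(1)[symmetric] Q_mult[OF xx(1)])
    finally show "H1 (E x1) x2 + H2 (N x1) x2 = sweedler A (\<lambda>y1 y2. Q (x1 \<cdot> y1) \<otimes>\<^bsub>A\<^esub> (x2 \<cdot> y2)) y" .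
  qed
  also have "\<dots> = sweedler A (\<lambda>u v. Q u \<otimes>\<^bsub>A\<^esub> v) (x \<cdot> y)"
    by (rule sweedler_mult[OF _ xC yC, symmetric]) (auto intro!: bilI simp: d)
  also have "\<dots> = comult D (x \<cdot> y)" using comult_D xC yC by simp
  finally show ?thesis ..
qed

lemma T_\<gamma>: "x \<in> carrier A \<Longrightarrow> \<gamma> (T x) = T (\<gamma> x)"
  by (simp add: T_def \<gamma>_distrib \<gamma>_mult antipode_\<gamma>[symmetric] R_eq_\<gamma>L L_\<gamma>)

lemma coinv_hopf_superalgebra: "hopf_superalgebra D"
proof (intro hopf_superalgebra.intro hopf_superalgebra_axioms.intro coinv_hopf_core)
  show "module.subspace (smult D) (grade D i)" for i using subspace_grade_D by simp
  show "carrier D = {x + y |x y. x \<in> grade D 0 \<and> y \<in> grade D 1}"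
  proof -
    have "x = P 0 x + P 1 x" for x by (simp add: P_sum)
    then have "x \<in> {x + y |x y. x \<in> grade D 0 \<and> y \<in> grade D 1}" if "x \<in> B" for x
      using P_grade[OF that] by blast
    moreover have "x + y \<in> B" if "x \<in> grade D 0" "y \<in> grade D 1" for x y using that by (simp add: grade_D)
    ultimately show ?thesis by auto
  qed
  show "grade D 0 \<inter> grade D 1 = {0}" by (rule grade_inter_D)
  show "mult D x y \<in> grade D (i + j)" if "x \<in> grade D i" "y \<in> grade D j" for i j x y
  proof -
    have "parity_sign (i + j) = (parity_sign i * parity_sign j :: 'k)" by (cases i; cases j) simp_all
    then show ?thesis using that by (auto simp: grade_D \<gamma>_mult BC mult_distrib smult_distrib mult.commute)
  qed
  show "unit_elt D \<in> grade D 0" by (simp add: grade_D smult_distrib)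
  show "\<exists>t. (\<forall>i. t i \<in> tensor_space (smult D) (smult D) (grade D i) (grade D (k - i))) \<and> comult D x = (\<Sum>i\<in>UNIV. t i)"
    if x: "x \<in> grade D k" for k x
  proof (intro exI conjI allI)
    show "comult D x = (\<Sum>i\<in>UNIV. sweedler A (\<lambda>u v. P i (Q u) \<otimes>\<^bsub>A\<^esub> P (k - i) (Q v)) x)" by (rule comult_grade_D[OF x])
    fix i
    have b: "bil A fscale (\<lambda>u v. P i (Q u) \<otimes>\<^bsub>A\<^esub> P (k - i) (Q v))" by (rule bilI) (simp_all add: distrib ENQ_distrib P_distrib)
    show "sweedler A (\<lambda>u v. P i (Q u) \<otimes>\<^bsub>A\<^esub> P (k - i) (Q v)) x \<in> tensor_space (smult D) (smult D) (grade D i) (grade D (k - i))"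
      unfolding D_simps
    proof (rule sweedler_mem[OF b subspace_tensor_space[OF vs vs subspace_grade_D subspace_grade_D]])
      show "x \<in> carrier A" using x by (simp add: grade_D BC)
      show "P i (Q u) \<otimes>\<^bsub>A\<^esub> P (k - i) (Q v) \<in> tensor_space (smult A) (smult A) (grade D i) (grade D (k - i))"
        if "u \<in> carrier A" "v \<in> carrier A" for u v
        by (rule tens_in_tensor_space) (simp_all add: that)
    qed
  qed
  show "counit D x = 0" if "x \<in> grade D 1" for x
  proof -
    have x: "x \<in> carrier A" "\<gamma> x = (- 1) \<odot> x" using that by (auto simp: grade_D BC)
    have "counit A x = counit A ((- 1) \<odot> x)" using counit_\<gamma>[OF x(1)] by (simp only: x(2))
    also have "\<dots> = - 1 * counit A x" by (rule counit_distrib(2)[OF x(1)])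
    finally have "counit A x = - counit A x" by simp
    then have "2 * counit A x = 0" by (simp only: mult_2 eq_neg_iff_add_eq_0)
    then show ?thesis using two by simp
  qed
  show "antipode D x \<in> grade D i" if "x \<in> grade D i" for i x
    using that by (auto simp: grade_D antipode_D BC T_\<gamma> T_distrib)
  show "comult D (mult D x y) = sweedler D (\<lambda>x1 x2. sweedler D (\<lambda>y1 y2.
              \<Sum>i\<in>UNIV. \<Sum>j\<in>UNIV. fscale (parity_sign (i * j))
                (mult D x1 (homog_part D j y1) \<otimes>\<^bsub>D\<^esub> mult D (homog_part D i x2) y2)) y) x"
    if "x \<in> carrier D" "y \<in> carrier D" for x y
    using comult_mult_D[of x y] that by simp
qed

end

section \<open>Isomorphisms and bosonization\<close>

lemma hopf_isomorphismD:
  assumes "hopf_isomorphism A A' \<phi>"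
  shows "bij_betw \<phi> (carrier A) (carrier A')" "linear_on (smult A) (smult A') (carrier A) \<phi>"
    "x \<in> carrier A \<Longrightarrow> \<phi> x \<in> carrier A'"
    "x \<in> carrier A \<Longrightarrow> y \<in> carrier A \<Longrightarrow> \<phi> (x + y) = \<phi> x + \<phi> y"
    "x \<in> carrier A \<Longrightarrow> \<phi> (smult A c x) = smult A' c (\<phi> x)"
    "x \<in> carrier A \<Longrightarrow> y \<in> carrier A \<Longrightarrow> \<phi> (x \<cdot>\<^bsub>A\<^esub> y) = \<phi> x \<cdot>\<^bsub>A'\<^esub> \<phi> y" "\<phi> \<one>\<^bsub>A\<^esub> = \<one>\<^bsub>A'\<^esub>"
    "x \<in> carrier A \<Longrightarrow> comult A' (\<phi> x) = sweedler A (\<lambda>u v. \<phi> u \<otimes>\<^bsub>A'\<^esub> \<phi> v) x"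
    "x \<in> carrier A \<Longrightarrow> counit A' (\<phi> x) = counit A x"
    "x \<in> carrier A \<Longrightarrow> antipode A' (\<phi> x) = \<phi> (antipode A x)"
  using assms bij_betwE[of \<phi> "carrier A" "carrier A'"] unfolding hopf_isomorphism_def linear_on_def by auto

text \<open>Both coproducts are required only to be linear maps into the tensor square, so the
  source or the target may be a bosonization.\<close>

lemma hopf_isomorphism_sweedler:
  fixes A :: "('k::field, 'a::ab_group_add, 'm) hopf_scheme" and A' :: "('k, 'b::ab_group_add, 'n) hopf_scheme"
  assumes \<phi>: "hopf_isomorphism A A' \<phi>" and A: "comult_space A" and A': "comult_space A'"
    and F: "bil A' s F" and x: "x \<in> carrier A"
  shows "sweedler A' F (\<phi> x) = sweedler A (\<lambda>u v. F (\<phi> u) (\<phi> v)) x"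
proof -
  interpret A: comult_space A by fact
  interpret A': comult_space A' by fact
  note h = hopf_isomorphismD[OF \<phi>]
  have Fb: "bilinear_on (smult A') (smult A') s (carrier A') (carrier A') F" and s: "vector_space s" using F by (auto simp: bil_def)
  have b: "bil A fscale (\<lambda>u v. \<phi> u \<otimes>\<^bsub>A'\<^esub> \<phi> v)"
    by (rule bilI) (auto simp: h A'.tens_distrib vector_space_fscale)
  show ?thesis unfolding h(8)[OF x]
    by (subst A.tensor_lift_sweedler[OF A'.vs A'.sub s Fb b A'.tens_closed[OF h(3) h(3)] x])
      (auto intro!: A.sweedler_cong tensor_lift_tens[OF A'.vs A'.vs s A'.sub A'.sub Fb] h(3))
qed

lemma hopf_isomorphism_refl:
  assumes "comult_space A" shows "hopf_isomorphism A A (\<lambda>x. x)"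
proof -
  interpret comult_space A by fact
  show ?thesis using sweedler_tens by (auto simp: hopf_isomorphism_def linear_on_def bij_betw_def)
qed

lemma hopf_isomorphism_trans:
  fixes A :: "('k::field, 'a::ab_group_add, 'm) hopf_scheme" and A' :: "('k, 'b::ab_group_add, 'n) hopf_scheme"
    and A'' :: "('k, 'c::ab_group_add, 'o) hopf_scheme"
  assumes \<phi>: "hopf_isomorphism A A' \<phi>" and \<psi>: "hopf_isomorphism A' A'' \<psi>"
    and A: "hopf_core A" and A': "comult_space A'" and A'': "comult_space A''"
  shows "hopf_isomorphism A A'' (\<lambda>x. \<psi> (\<phi> x))"
proof -
  interpret A: hopf_core A by fact
  interpret A'': comult_space A'' by fact
  note h = hopf_isomorphismD[OF \<phi>] and k = hopf_isomorphismD[OF \<psi>]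
  have b: "bil A' fscale (\<lambda>u v. \<psi> u \<otimes>\<^bsub>A''\<^esub> \<psi> v)"
    by (rule bilI) (auto simp: k A''.tens_distrib vector_space_fscale)
  have "bij_betw (\<lambda>x. \<psi> (\<phi> x)) (carrier A) (carrier A'')"
    using bij_betw_trans[OF h(1) k(1)] by (simp add: comp_def)
  then show ?thesis unfolding hopf_isomorphism_def linear_on_def
    using hopf_isomorphism_sweedler[OF \<phi> A.comult_space_axioms A' b] by (auto simp: h k)
qed

text \<open>Every identity for the inverse is the one for \<phi>, read at a preimage; for the
  coproduct the legs are transported by \<open>hopf_isomorphism_sweedler\<close>.\<close>

lemma hopf_isomorphism_sym:
  fixes A :: "('k::field, 'a::ab_group_add, 'm) hopf_scheme" and A' :: "('k, 'b::ab_group_add, 'n) hopf_scheme"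
  assumes \<phi>: "hopf_isomorphism A A' \<phi>" and A: "hopf_core A" and A': "comult_space A'"
  shows "hopf_isomorphism A' A (inv_into (carrier A) \<phi>)"
proof -
  interpret A: hopf_core A by fact
  interpret A': comult_space A' by fact
  note h = hopf_isomorphismD[OF \<phi>]
  define \<psi> where "\<psi> = inv_into (carrier A) \<phi>"
  have b: "bij_betw \<psi> (carrier A') (carrier A)" unfolding \<psi>_def by (rule bij_betw_inv_into[OF h(1)])
  have \<psi>\<phi>: "\<psi> (\<phi> x) = x" if "x \<in> carrier A" for x
    unfolding \<psi>_def using bij_betw_inv_into_left[OF h(1) that] .
  have ex: "\<exists>x\<in>carrier A. y = \<phi> x" if "y \<in> carrier A'" for y using h(1) that by (auto simp: bij_betw_def)
  have add: "\<psi> (y + z) = \<psi> y + \<psi> z" if yz: "y \<in> carrier A'" "z \<in> carrier A'" for y z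
  proof -
    obtain x x' where "x \<in> carrier A" "y = \<phi> x" "x' \<in> carrier A" "z = \<phi> x'" using ex yz by meson
    then show ?thesis using \<psi>\<phi>[of "x + x'"] by (simp add: h \<psi>\<phi>)
  qed
  have scale: "\<psi> (smult A' c y) = smult A c (\<psi> y)" if y: "y \<in> carrier A'" for c y
  proof -
    obtain x where "x \<in> carrier A" "y = \<phi> x" using ex y by meson
    then show ?thesis using \<psi>\<phi>[of "smult A c x"] by (simp add: h \<psi>\<phi>)
  qed
  have mult: "\<psi> (mult A' y z) = mult A (\<psi> y) (\<psi> z)" if yz: "y \<in> carrier A'" "z \<in> carrier A'" for y z
  proof -
    obtain x x' where "x \<in> carrier A" "y = \<phi> x" "x' \<in> carrier A" "z = \<phi> x'" using ex yz by meson
    then show ?thesis using \<psi>\<phi>[of "mult A x x'"] by (simp add: h \<psi>\<phi>)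
  qed
  have bt: "bil A' fscale (\<lambda>u v. \<psi> u \<otimes>\<^bsub>A\<^esub> \<psi> v)"
    by (rule bilI) (auto simp: add scale A.tens_distrib vector_space_fscale)
  have comult: "comult A (\<psi> y) = sweedler A' (\<lambda>u v. \<psi> u \<otimes>\<^bsub>A\<^esub> \<psi> v) y" 
    and counit: "counit A (\<psi> y) = counit A' y" 
    and antipode: "antipode A (\<psi> y) = \<psi> (antipode A' y)" if y: "y \<in> carrier A'" for y
  proof -
    obtain x where x: "x \<in> carrier A" "y = \<phi> x" using ex y by meson
    have "sweedler A' (\<lambda>u v. \<psi> u \<otimes>\<^bsub>A\<^esub> \<psi> v) y = sweedler A (\<lambda>u v. \<psi> (\<phi> u) \<otimes>\<^bsub>A\<^esub> \<psi> (\<phi> v)) x"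
      unfolding x(2) by (rule hopf_isomorphism_sweedler[OF \<phi> A.comult_space_axioms A' bt x(1)])
    also have "\<dots> = comult A x"
      using A.sweedler_cong[of "\<lambda>u v. \<psi> (\<phi> u) \<otimes>\<^bsub>A\<^esub> \<psi> (\<phi> v)" "\<lambda>u v. u \<otimes>\<^bsub>A\<^esub> v"] A.sweedler_tens[OF x(1)] by (simp add: \<psi>\<phi>)
    finally show "comult A (\<psi> y) = sweedler A' (\<lambda>u v. \<psi> u \<otimes>\<^bsub>A\<^esub> \<psi> v) y" by (simp add: x \<psi>\<phi>)
    show "counit A (\<psi> y) = counit A' y" "antipode A (\<psi> y) = \<psi> (antipode A' y)" using x by (simp_all add: h \<psi>\<phi>)
  qed
  have "\<psi> \<one>\<^bsub>A'\<^esub> = \<one>\<^bsub>A\<^esub>" using \<psi>\<phi>[of "\<one>\<^bsub>A\<^esub>"] h(7) by simp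
  then show ?thesis unfolding \<psi>_def[symmetric] hopf_isomorphism_def linear_on_def
    using b add scale mult comult counit antipode by auto
qed

lemma super_isomorphic_refl:
  assumes "hopf_core H" shows "super_isomorphic H H"
proof -
  interpret hopf_core H by fact
  show ?thesis unfolding super_isomorphic_def
    using hopf_isomorphism_refl[OF comult_space_axioms] by blast
qed

lemma super_isomorphic_trans:
  assumes "super_isomorphic H H'" "super_isomorphic H' H''" "hopf_core H" "hopf_core H'" "hopf_core H''"
  shows "super_isomorphic H H''"
proof -
  interpret H': hopf_core H' by fact
  interpret H'': hopf_core H'' by fact
  obtain \<phi> \<psi> where "hopf_isomorphism H H' \<phi>" "\<forall>i. \<forall>x\<in>grade H i. \<phi> x \<in> grade H' i"
    "hopf_isomorphism H' H'' \<psi>" "\<forall>i. \<forall>x\<in>grade H' i. \<psi> x \<in> grade H'' i"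
    using assms(1,2) unfolding super_isomorphic_def by blast
  then show ?thesis unfolding super_isomorphic_def
    using hopf_isomorphism_trans[OF _ _ assms(3) H'.comult_space_axioms H''.comult_space_axioms] by blast
qed

section \<open>The structure maps of a bosonization\<close>

context hopf_superalgebra begin

lemma gradeC: "x \<in> grade H i \<Longrightarrow> x \<in> carrier H"
  and grade_0 [simp]: "0 \<in> grade H i"
proof -
  show 0: "0 \<in> grade H i" for i using V.subspace_0[OF subspace_grade] by blast
  have "x = x + 0" "x = 0 + x" by auto
  then show "x \<in> grade H i \<Longrightarrow> x \<in> carrier H"
    unfolding grade_sum using 0 by (cases i) blast+
qed

lemma homog_part_add:
  assumes "y \<in> grade H i" "z \<in> grade H (i + 1)" shows "homog_part H i (y + z) = y"
  by (rule homog_part_eq[OF vs subspace_grade grade_inter assms])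

lemma homog_part_decomp:
  assumes "x \<in> carrier H"
  shows "homog_part H i x \<in> grade H i" "homog_part H 0 x + homog_part H 1 x = x"
proof -
  obtain y z where x: "x = y + z" "y \<in> grade H 0" "z \<in> grade H 1" using assms grade_sum by auto
  have "homog_part H 0 x = y" "homog_part H 1 x = z"
    using homog_part_add[of y 0 z] homog_part_add[of z 1 y] x by (simp_all add: add.commute)
  then show "homog_part H i x \<in> grade H i" "homog_part H 0 x + homog_part H 1 x = x"
    using x by (cases i; simp)+
qed

lemma homog_part_closed [simp]: "x \<in> carrier H \<Longrightarrow> homog_part H i x \<in> carrier H"
  using homog_part_decomp(1) gradeC by blast

lemma homog_part_grade:
  assumes "x \<in> grade H j" shows "homog_part H i x = (if i = j then x else 0)"
  using homog_part_add[of x j 0] homog_part_add[of 0 "j + 1" x] assms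
  by (cases i; cases j) simp_all

lemma homog_part_zero [simp]: "homog_part H i 0 = 0"
  using homog_part_grade[of 0 i i] by simp

lemma homog_part_homog_part: "x \<in> carrier H \<Longrightarrow> homog_part H i (homog_part H j x) = (if i = j then homog_part H j x else 0)"
  using homog_part_grade[OF homog_part_decomp(1)] by simp

lemma homog_part_distrib:
  assumes x: "x \<in> carrier H"
  shows "y \<in> carrier H \<Longrightarrow> homog_part H i (x + y) = homog_part H i x + homog_part H i y"
    "homog_part H i (c \<odot> x) = c \<odot> homog_part H i x"
proof -
  have s: "homog_part H i x + homog_part H (i + 1) x = x" if "x \<in> carrier H" for x
    using homog_part_decomp(2)[OF that] by (cases i) (simp_all add: add.commute)
  show "homog_part H i (x + y) = homog_part H i x + homog_part H i y" if y: "y \<in> carrier H"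
  proof -
    have "x + y = (homog_part H i x + homog_part H i y) + (homog_part H (i + 1) x + homog_part H (i + 1) y)"
      using s[OF x] s[OF y] by (metis add.assoc add.commute)
    then show ?thesis using homog_part_add homog_part_decomp(1) x y V.subspace_add[OF subspace_grade] by metis
  qed
  have "c \<odot> x = c \<odot> homog_part H i x + c \<odot> homog_part H (i + 1) x"
    using s[OF x] by (metis smult_distrib(1))
  then show "homog_part H i (c \<odot> x) = c \<odot> homog_part H i x"
    using homog_part_add homog_part_decomp(1) x V.subspace_scale[OF subspace_grade] by metis
qed

lemma counit_homog_part: "x \<in> carrier H \<Longrightarrow> counit H (homog_part H d x) = (if d = 0 then counit H x else 0)"
  using counit_grade[OF homog_part_decomp(1)[of x 1]] counit_distrib(1)[of "homog_part H 0 x" "homog_part H 1 x"] homog_part_decomp(2)[of x]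
  by (cases d) simp_all

text \<open>The parity automorphism; in the bosonization it is conjugation by 1#\<sigma>.\<close>

definition par where "par x = homog_part H 0 x - homog_part H 1 x"

lemma par_closed [simp]: "x \<in> carrier H \<Longrightarrow> par x \<in> carrier H" by (simp add: par_def)

lemma par_grade: "x \<in> grade H i \<Longrightarrow> par x = parity_sign i \<odot> x"
  by (cases i) (simp_all add: par_def homog_part_grade smult_distrib)

abbreviation Bos where "Bos \<equiv> bosonization H"

lemma Bos_simps [simp]: "carrier Bos = {f. \<forall>i. f i \<in> carrier H}" "smult Bos = bos_smult H"
  "mult Bos = bos_mult H" "unit_elt Bos = hash \<one> 0" "counit Bos f = (\<Sum>i\<in>UNIV. counit H (f i))"
  by (simp_all add: bosonization_def)

lemma hash_closed [simp]: "h \<in> carrier H \<Longrightarrow> hash h i j \<in> carrier H" by (simp add: hash_def)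

lemma hash_distrib: "hash (x + y) i = hash x i + hash y i" "hash (c \<odot> x) i = bos_smult H c (hash x i)" "hash 0 i = (0 :: bit \<Rightarrow> 'a)"
  by (auto simp: hash_def bos_smult_def fun_eq_iff smult_distrib)

lemma hash_sum: "f = hash (f 0) 0 + hash (f 1) 1"
  by (rule ext, rule bit_induct) (simp_all add: hash_def)

lemma vs_bos: "vector_space (bos_smult H)"
  by unfold_locales (auto simp: bos_smult_def fun_eq_iff smult_distrib)

text \<open>Summation over the degree d of the right factor turns the sign into the identity for i =
  0 and into \<open>par\<close> for i = 1.\<close>

lemma bos_mult_eq:
  assumes "f \<in> carrier Bos" "f' \<in> carrier Bos"
  shows "bos_mult H f f' 0 = f 0 \<cdot> f' 0 + f 1 \<cdot> par (f' 1)" "bos_mult H f f' 1 = f 0 \<cdot> f' 1 + f 1 \<cdot> par (f' 0)"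
proof -
  have c: "f i \<in> carrier H" "f' i \<in> carrier H" for i using assms by auto
  have e: "f i \<cdot> homog_part H 0 (f' j) + f i \<cdot> homog_part H 1 (f' j) = f i \<cdot> f' j" for i j
    using mult_distrib(1)[of "f i" "homog_part H 0 (f' j)" "homog_part H 1 (f' j)"] c homog_part_decomp(2) by simp
  show "bos_mult H f f' 0 = f 0 \<cdot> f' 0 + f 1 \<cdot> par (f' 1)" "bos_mult H f f' 1 = f 0 \<cdot> f' 1 + f 1 \<cdot> par (f' 0)"
    using e[of 0 0] e[of 0 1] c by (simp_all add: bos_mult_def UNIV_bit hash_def par_def smult_distrib mult_distrib)
qed

lemma hash_mult:
  assumes "x \<in> carrier H" "y \<in> carrier H"
  shows "bos_mult H (hash x 0) (hash y j) = hash (x \<cdot> y) j" "bos_mult H (hash x 1) (hash y j) = hash (x \<cdot> par y) (1 + j)"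
proof -
  have [simp]: "par 0 = 0" by (simp add: par_def)
  have h: "hash x i \<in> carrier Bos" "hash y j \<in> carrier Bos" for i using assms by auto
  show "bos_mult H (hash x 0) (hash y j) = hash (x \<cdot> y) j" "bos_mult H (hash x 1) (hash y j) = hash (x \<cdot> par y) (1 + j)"
    using assms by (rule_tac ext, rule_tac bit_induct; (simp only: bos_mult_eq[OF h])?; cases j; simp add: hash_def)+
qed

text \<open>The summand in the coproduct of the i-th component, named so that its bilinearity in the
  legs u and v can be stated once.\<close>

definition bosG where "bosG i u v = (\<Sum>d\<in>UNIV. tens (bos_smult H) (bos_smult H) (hash u (i + d)) (hash (homog_part H d v) i))"

lemma bos_tens_distrib:
  "tens (bos_smult H) (bos_smult H) (x + y) z = tens (bos_smult H) (bos_smult H) x z + tens (bos_smult H) (bos_smult H) y z"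
  "tens (bos_smult H) (bos_smult H) x (y + z) = tens (bos_smult H) (bos_smult H) x y + tens (bos_smult H) (bos_smult H) x z"
  "tens (bos_smult H) (bos_smult H) (bos_smult H c x) y = fscale c (tens (bos_smult H) (bos_smult H) x y)"
  "tens (bos_smult H) (bos_smult H) x (bos_smult H c y) = fscale c (tens (bos_smult H) (bos_smult H) x y)"
  using bilinear_on_tens[OF vs_bos vs_bos] unfolding bilinear_on_def linear_on_def by auto

lemma bil_bosG: "bil H fscale (bosG i)"
  by (rule bilI) (auto simp: bosG_def UNIV_bit hash_distrib homog_part_distrib bos_tens_distrib vector_space_fscale fscale_distrib algebra_simps)

lemma comult_bos: "comult Bos f = (\<Sum>i\<in>UNIV. sweedler H (bosG i) (f i))"
  by (simp add: bosonization_def bosG_def[abs_def])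

lemma subspace_bos: "module.subspace (bos_smult H) (carrier Bos)"
proof -
  interpret VB: vector_space "bos_smult H" by (rule vs_bos)
  show ?thesis by (rule VB.subspaceI) (auto simp: bos_smult_def)
qed

lemma bosG_mem: "u \<in> carrier H \<Longrightarrow> v \<in> carrier H \<Longrightarrow>
  bosG i u v \<in> tensor_space (bos_smult H) (bos_smult H) (carrier Bos) (carrier Bos)"
proof -
  interpret VT: vector_space "fscale :: 'k \<Rightarrow> ('k, bit \<Rightarrow> 'a, bit \<Rightarrow> 'a) tensor \<Rightarrow> _" by (rule vector_space_fscale)
  show "u \<in> carrier H \<Longrightarrow> v \<in> carrier H \<Longrightarrow> ?thesis"
    unfolding bosG_def by (rule VT.subspace_sum[OF subspace_tensor_space[OF vs_bos vs_bos subspace_bos subspace_bos]])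
      (auto intro!: tens_in_tensor_space)
qed

lemma bos_comult_space: "comult_space Bos"
proof (rule comult_space.intro)
  interpret VT: vector_space "fscale :: 'k \<Rightarrow> ('k, bit \<Rightarrow> 'a, bit \<Rightarrow> 'a) tensor \<Rightarrow> _" by (rule vector_space_fscale)
  note st = subspace_tensor_space[OF vs_bos vs_bos subspace_bos subspace_bos]
  show "vector_space (smult Bos)" using vs_bos by simp
  show "module.subspace (smult Bos) (carrier Bos)" using subspace_bos by simp
  show "comult Bos f \<in> tensor_space (smult Bos) (smult Bos) (carrier Bos) (carrier Bos)" if "f \<in> carrier Bos" for f
    unfolding comult_bos Bos_simps(2)
    by (rule VT.subspace_sum[OF st], rule sweedler_mem[OF bil_bosG st bosG_mem]) (use that in auto)
  show "linear_on (smult Bos) fscale (carrier Bos) (comult Bos)"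
    unfolding linear_on_def comult_bos
    by (auto simp: UNIV_bit sweedler_add[OF bil_bosG] sweedler_smult[OF bil_bosG] bos_smult_def fscale_distrib)
qed

lemma bil_hash:
  assumes F: "bil Bos s F"
  shows "bil H s (\<lambda>u v. F (hash u i) (hash (homog_part H d v) j))"
  by (rule bilI[OF bilD(1)[OF F]])
    (use bilD(2-5)[OF F, unfolded Bos_simps] in \<open>simp_all add: hash_distrib homog_part_distrib\<close>)

text \<open>The coproduct of the bosonization is a sum of Sweedler sums over H with values in
  tensors, and the lift of F is moved inside them.\<close>

lemma sweedler_bos:
  assumes F: "bil Bos s F" and f: "f \<in> carrier Bos"
  shows "sweedler Bos F f = (\<Sum>i\<in>UNIV. sweedler H (\<lambda>u v. \<Sum>d\<in>UNIV. F (hash u (i + d)) (hash (homog_part H d v) i)) (f i))"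
proof -
  let ?l = "tensor_lift (bos_smult H) (bos_smult H) (carrier Bos) (carrier Bos) F"
  let ?T = "tensor_space (bos_smult H) (bos_smult H) (carrier Bos) (carrier Bos)"
  have s: "vector_space s" and Fb: "bilinear_on (bos_smult H) (bos_smult H) s (carrier Bos) (carrier Bos) F" using F by (auto simp: bil_def)
  interpret VT: vector_space "fscale :: 'k \<Rightarrow> ('k, bit \<Rightarrow> 'a, bit \<Rightarrow> 'a) tensor \<Rightarrow> _" by (rule vector_space_fscale)
  note st = subspace_tensor_space[OF vs_bos vs_bos subspace_bos subspace_bos]
  have l: "linear_on fscale s ?T ?l" by (rule linear_on_tensor_lift[OF vs_bos vs_bos s subspace_bos subspace_bos Fb])
  have fi: "f i \<in> carrier H" for i using f by simp
  have m: "sweedler H (bosG i) (f i) \<in> ?T" for i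
    by (rule sweedler_mem[OF bil_bosG st bosG_mem fi])
  have hm: "hash u i \<in> carrier Bos" if "u \<in> carrier H" for u i using that by simp
  have t: "?l (tens (bos_smult H) (bos_smult H) (hash u i) (hash v j)) = F (hash u i) (hash v j)"
    "tens (bos_smult H) (bos_smult H) (hash u i) (hash v j) \<in> ?T" if "u \<in> carrier H" "v \<in> carrier H" for u v i j
    by (rule tensor_lift_tens[OF vs_bos vs_bos s subspace_bos subspace_bos Fb hm hm] tens_in_tensor_space[OF hm hm]; rule that)+
  have "sweedler Bos F f = ?l (\<Sum>i\<in>UNIV. sweedler H (bosG i) (f i))" by (simp only: comult_bos Bos_simps(2))
  also have "\<dots> = (\<Sum>i\<in>UNIV. ?l (sweedler H (bosG i) (f i)))"
    using l m unfolding linear_on_def by (simp add: UNIV_bit)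
  also have "\<dots> = (\<Sum>i\<in>UNIV. sweedler H (\<lambda>u v. ?l (bosG i u v)) (f i))"
    by (rule sum.cong[OF refl]) (rule tensor_lift_sweedler[OF vs_bos subspace_bos s Fb bil_bosG bosG_mem fi])
  also have "\<dots> = (\<Sum>i\<in>UNIV. sweedler H (\<lambda>u v. \<Sum>d\<in>UNIV. F (hash u (i + d)) (hash (homog_part H d v) i)) (f i))"
    by (rule sum.cong[OF refl], rule sweedler_cong) (use l t in \<open>simp add: bosG_def linear_on_def UNIV_bit del: Bos_simps\<close>)
  finally show ?thesis .
qed

lemma antipode_bos:
  assumes "f \<in> carrier Bos"
  shows "antipode Bos f = (\<Sum>i\<in>UNIV. \<Sum>d\<in>UNIV. bos_mult H (hash \<one> (d + i)) (hash (antipode H (homog_part H d (f i))) 0))"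
  by (simp add: bosonization_def)

end

lemma vector_space_neg_eq_zero:
  fixes s :: "'k::field \<Rightarrow> 'c::ab_group_add \<Rightarrow> 'c" and x :: 'c
  assumes "vector_space s" "(2::'k) \<noteq> 0" "x = - x"
  shows "x = 0"
proof -
  interpret vector_space s by fact
  have "s 2 x = x + x" using scale_left_distrib[of 1 1 x] by simp
  also have "\<dots> = 0" using assms(3) by (metis add.right_inverse)
  finally show ?thesis using assms(2) by simp
qed

section \<open>A as the bosonization of its coinvariants\<close>

context super_datum begin

sublocale D: hopf_superalgebra D by (rule coinv_hopf_superalgebra)

lemma par_D: "x \<in> B \<Longrightarrow> D.par x = \<gamma> x"
  by (simp add: D.par_def homog_part_D P_diff BC)

lemma bil_graded: "bil A s F \<Longrightarrow> bil A s (\<lambda>u v. F u (P 0 v) + F (u \<cdot> g) (P 1 v))"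
  by (rule bil_add; rule bilI) (simp_all add: bilD P_distrib mult_distrib bilD(1))

text \<open>In Sweedler notation for \<open>B\<close>: \<open>\<Delta>\<^sub>A(b) = \<Sum>\<^sub>d b\<^sub>(\<^sub>1\<^sub>) g\<^sup>d \<otimes> (b\<^sub>(\<^sub>2\<^sub>))\<^sub>d\<close>.\<close>

lemma sweedler_graded:
  assumes F: "bil A s F" and b: "b \<in> B"
  shows "sweedler D (\<lambda>u v. F u (P 0 v) + F (u \<cdot> g) (P 1 v)) b = sweedler A F b"
proof -
  have bC: "b \<in> carrier A" using b by (rule BC)
  have s: "vector_space s" by (rule bilD(1)[OF F])
  have F1: "bil A s (\<lambda>u v. F (Q u) v)" and F2: "bil A s (\<lambda>u v. F (Q u \<cdot> g) v)"
    by (rule bilI; simp add: bilD[OF F] ENQ_distrib mult_distrib s)+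
  have m: "F u (v - w) = F u v - F u w" if "u \<in> carrier A" "v \<in> carrier A" "w \<in> carrier A" for u v w
    using bilD(3)[OF F, of u "v - w" w] that by (simp add: algebra_simps)
  have F1': "bil A s (\<lambda>u v. F (Q u) ((1/2) \<odot> (v + R v)))" and F2': "bil A s (\<lambda>u v. F (Q u \<cdot> g) ((1/2) \<odot> (v - R v)))"
    by (rule bilI; simp add: bilD[OF F] m ENQ_distrib LR_distrib mult_distrib s vector_space_distrib[OF s] algebra_simps)+
  have G1: "bil A s (\<lambda>u v. F (Q (E u)) v)" and G2: "bil A s (\<lambda>u v. F (Q (N u) \<cdot> g) v)"
    by (rule bilI; simp add: bilD[OF F] ENQ_distrib mult_distrib s)+
  have "sweedler D (\<lambda>u v. F u (P 0 v) + F (u \<cdot> g) (P 1 v)) b = sweedler A (\<lambda>u v. F (Q u) (P 0 (Q v)) + F (Q u \<cdot> g) (P 1 (Q v))) b"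
    by (rule sweedler_D[OF bil_bilB[OF bil_graded[OF F]] b])
  \<comment> \<open>On B the operator R is \<gamma>, so the homogeneous parts of Q v are averages
    with R; the exchange rule will send them to E and N on the left leg, where Q (E u) + Q (N u) g
    is u.\<close>
  also have "\<dots> = sweedler A (\<lambda>u v. F (Q u) ((1/2) \<odot> (Q v + R (Q v))) + F (Q u \<cdot> g) ((1/2) \<odot> (Q v - R (Q v)))) b"
    by (rule sweedler_cong) (simp add: P_def R_B smult_distrib)
  also have "\<dots> = sweedler A (\<lambda>u v. F (Q u) ((1/2) \<odot> (v + R v)) + F (Q u \<cdot> g) ((1/2) \<odot> (v - R v))) b"
    by (rule sweedler_on_B(2)[OF bil_add[OF F1' F2'] b])
  also have "\<dots> = sweedler A (\<lambda>u v. F (Q (E u)) v + F (Q (N u) \<cdot> g) v) b"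
    unfolding sweedler_plus[OF F1' F2' bC] sweedler_plus[OF G1 G2 bC] sweedler_E_N_left(1)[OF F1 bC] sweedler_E_N_left(2)[OF F2 bC] ..
  also have "\<dots> = sweedler A F b"
    by (rule sweedler_cong) (simp add: Q_E_N bilD(2)[OF F, symmetric] E_N)
  finally show ?thesis .
qed

lemma EN_decomp:
  assumes "b \<in> B" "c \<in> B" shows "E (b + c \<cdot> g) = b" "N (b + c \<cdot> g) \<cdot> g = c"
  using assms by (simp_all add: ENQ_distrib BC E_N_mult_g)

lemma decompose_B: assumes "x \<in> carrier A" obtains b c where "b \<in> B" "c \<in> B" "x = b + c \<cdot> g"
  using that[of "E x" "N x \<cdot> g"] decomp[OF assms] assms by simp

text \<open>R acts on a homogeneous element of B by the sign of its degree, so one of the two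
  averages in T vanishes and the other is the element itself.\<close>

lemma T_homogeneous: assumes b: "b \<in> B" shows "T (P 0 b) = antipode A (P 0 b)" "T (P 1 b) = g \<cdot> antipode A (P 1 b)"
proof -
  have *: "R (P i b) = parity_sign i \<odot> P i b" for i using b by (simp add: R_B \<gamma>_P BC)
  show "T (P 0 b) = antipode A (P 0 b)" "T (P 1 b) = g \<cdot> antipode A (P 1 b)"
    using b BC[OF b] unfolding T_def * by (simp_all add: smult_distrib half_add antipode_distrib)
qed

lemma antipode_B: assumes b: "b \<in> B" shows "antipode A b = T (P 0 b) + g \<cdot> T (P 1 b)"
  using b BC[OF b] antipode_distrib(1)[of "P 0 b" "P 1 b"] by (simp add: T_homogeneous P_sum)

definition \<Phi> :: "(bit \<Rightarrow> 'a) \<Rightarrow> 'a" where "\<Phi> f = f 0 + f 1 \<cdot> g"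

text \<open>Products correspond because g c = \<gamma>(c) g and \<gamma> is the parity map of B;
  coproducts correspond by \<open>sweedler_graded\<close>, and antipodes by
  \<open>antipode_B\<close> together with S(x g) = g S(x).\<close>

lemma bosonization_isomorphism: "hopf_isomorphism (bosonization D) A \<Phi>"
proof -
  interpret Bos: comult_space "bosonization D" by (rule D.bos_comult_space)
  have fB: "f 0 \<in> B" "f 1 \<in> B" "f 0 \<in> carrier A" "f 1 \<in> carrier A" if "f \<in> carrier (bosonization D)" for f
    using that BC by auto
  have \<Phi>C: "\<Phi> f \<in> carrier A" if "f \<in> carrier (bosonization D)" for f using fB[OF that] by (simp add: \<Phi>_def)
  have hash\<Phi>: "\<Phi> (hash x 0) = x" "\<Phi> (hash x 1) = x \<cdot> g" if "x \<in> carrier A" for x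
    using that by (simp_all add: \<Phi>_def hash_def)
  have add: "\<Phi> (f + f') = \<Phi> f + \<Phi> f'" if "f \<in> carrier (bosonization D)" "f' \<in> carrier (bosonization D)" for f f'
    using fB[OF that(1)] fB[OF that(2)] by (simp add: \<Phi>_def mult_distrib algebra_simps)
  have scale: "\<Phi> (bos_smult D c f) = c \<odot> \<Phi> f" if "f \<in> carrier (bosonization D)" for f c
    using fB[OF that] by (simp add: \<Phi>_def mult_distrib bos_smult_def smult_distrib)
  have mult: "\<Phi> (bos_mult D f f') = \<Phi> f \<cdot> \<Phi> f'" if f: "f \<in> carrier (bosonization D)" and f': "f' \<in> carrier (bosonization D)" for f f'
  proof -
    note c = fB[OF f] fB[OF f']
    have "f 1 \<cdot> g \<cdot> (f' 1 \<cdot> g) = f 1 \<cdot> \<gamma> (f' 1)" "f 1 \<cdot> g \<cdot> f' 0 = f 1 \<cdot> \<gamma> (f' 0) \<cdot> g"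
      using c by (simp_all add: \<gamma>_def mult_assoc gg)
    then show ?thesis using c unfolding \<Phi>_def D.bos_mult_eq[OF f f']
      by (simp add: par_D mult_distrib mult_assoc[symmetric] algebra_simps)
  qed
  have bij: "bij_betw \<Phi> (carrier (bosonization D)) (carrier A)"
  \<comment> \<open>The inverse reads off the components of a in B + B g: these are E a and N a g,
    the second because N a = (N a g) g.\<close>
  proof (rule bij_betw_byWitness[where f' = "\<lambda>a. hash (E a) 0 + hash (N a \<cdot> g) 1"])
    show "\<forall>f\<in>carrier (bosonization D). hash (E (\<Phi> f)) 0 + hash (N (\<Phi> f) \<cdot> g) 1 = f"
      using EN_decomp by (simp add: \<Phi>_def D.hash_sum[symmetric])
    show "\<forall>a\<in>carrier A. \<Phi> (hash (E a) 0 + hash (N a \<cdot> g) 1) = a"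
      by (simp add: \<Phi>_def hash_def E_N)
    show "\<Phi> ` carrier (bosonization D) \<subseteq> carrier A" using \<Phi>C by auto
    show "(\<lambda>a. hash (E a) 0 + hash (N a \<cdot> g) 1) ` carrier A \<subseteq> carrier (bosonization D)"
      by (auto simp: hash_def)
  qed
  have comult: "comult A (\<Phi> f) = sweedler (bosonization D) (\<lambda>u v. \<Phi> u \<otimes>\<^bsub>A\<^esub> \<Phi> v) f" if f: "f \<in> carrier (bosonization D)" for f
  proof -
    note c = fB[OF f]
    have b: "bil (bosonization D) fscale (\<lambda>u v. \<Phi> u \<otimes>\<^bsub>A\<^esub> \<Phi> v)"
      by (rule bilI) (simp_all add: add scale tens_distrib vector_space_fscale del: D.Bos_simps(1))
    have bg: "bil A fscale (\<lambda>u v. (u \<cdot> g) \<otimes>\<^bsub>A\<^esub> (v \<cdot> g))" by (rule bilI) (simp_all add: distrib)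
    have "sweedler (bosonization D) (\<lambda>u v. \<Phi> u \<otimes>\<^bsub>A\<^esub> \<Phi> v) f =
      sweedler D (\<lambda>u v. \<Sum>d\<in>UNIV. \<Phi> (hash u (0 + d)) \<otimes>\<^bsub>A\<^esub> \<Phi> (hash (homog_part D d v) 0)) (f 0)
      + sweedler D (\<lambda>u v. \<Sum>d\<in>UNIV. \<Phi> (hash u (1 + d)) \<otimes>\<^bsub>A\<^esub> \<Phi> (hash (homog_part D d v) 1)) (f 1)"
      unfolding D.sweedler_bos[OF b f] by (simp only: UNIV_bit) simp
    also have "sweedler D (\<lambda>u v. \<Sum>d\<in>UNIV. \<Phi> (hash u (0 + d)) \<otimes>\<^bsub>A\<^esub> \<Phi> (hash (homog_part D d v) 0)) (f 0)
      = sweedler D (\<lambda>u v. u \<otimes>\<^bsub>A\<^esub> P 0 v + ((u \<cdot> g) \<otimes>\<^bsub>A\<^esub> P 1 v)) (f 0)"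
      by (rule tensor_lift_cong) (simp add: UNIV_bit hash\<Phi> BC homog_part_D)
    also have "\<dots> = comult A (f 0)" using sweedler_graded[OF bil_tens c(1)] sweedler_tens[OF c(3)] by simp
    also have "sweedler D (\<lambda>u v. \<Sum>d\<in>UNIV. \<Phi> (hash u (1 + d)) \<otimes>\<^bsub>A\<^esub> \<Phi> (hash (homog_part D d v) 1)) (f 1)
      = sweedler D (\<lambda>u v. (u \<cdot> g) \<otimes>\<^bsub>A\<^esub> (P 0 v \<cdot> g) + ((u \<cdot> g \<cdot> g) \<otimes>\<^bsub>A\<^esub> (P 1 v \<cdot> g))) (f 1)"
      by (rule tensor_lift_cong) (simp add: UNIV_bit hash\<Phi> BC homog_part_D)
    also have "\<dots> = comult A (f 1 \<cdot> g)"
      using sweedler_graded[OF bg c(2)] sweedler_mult_group_like(1)[OF bil_tens g c(4)] sweedler_tens[of "f 1 \<cdot> g"] c by simp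
    finally have *: "sweedler (bosonization D) (\<lambda>u v. \<Phi> u \<otimes>\<^bsub>A\<^esub> \<Phi> v) f = comult A (f 0) + comult A (f 1 \<cdot> g)" .
    have "comult A (\<Phi> f) = comult A (f 0) + comult A (f 1 \<cdot> g)"
      using comult_lin c by (simp add: \<Phi>_def linear_on_def)
    then show ?thesis by (simp only: *)
  qed
  have counit: "counit A (\<Phi> f) = counit (bosonization D) f" if "f \<in> carrier (bosonization D)" for f
    using fB[OF that] by (simp add: \<Phi>_def counit_distrib counit_mult UNIV_bit)
  have antipode: "antipode A (\<Phi> f) = \<Phi> (antipode (bosonization D) f)" if f: "f \<in> carrier (bosonization D)" for f
  proof -
    note c = fB[OF f]
    have h: "hash x i \<in> carrier (bosonization D)" if "x \<in> B" for x i using that by (auto simp: hash_def)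
    have m: "bos_mult D (hash \<one> i) (hash x 0) \<in> carrier (bosonization D)"
      "\<Phi> (bos_mult D (hash \<one> 0) (hash x 0)) = x" "\<Phi> (bos_mult D (hash \<one> 1) (hash x 0)) = g \<cdot> x" if "x \<in> B" for x i
    proof -
      show "bos_mult D (hash \<one> i) (hash x 0) \<in> carrier (bosonization D)"
        using D.hash_mult[of \<one> x 0] that h by (cases i) (simp_all add: par_D BC hash_def)
      show "\<Phi> (bos_mult D (hash \<one> 0) (hash x 0)) = x" "\<Phi> (bos_mult D (hash \<one> 1) (hash x 0)) = g \<cdot> x"
        unfolding mult[OF h[OF B_one] h[OF that]] using that by (simp_all add: hash\<Phi> BC)
    qed
    have t: "antipode D (homog_part D d (f i)) = T (P d (f i))" "T (P d (f i)) \<in> B" for d i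
      using f BC by (simp_all add: homog_part_D antipode_D)
    have "\<Phi> (antipode (bosonization D) f) = (T (P 0 (f 0)) + g \<cdot> T (P 1 (f 0))) + (g \<cdot> T (P 0 (f 1)) + T (P 1 (f 1)))"
      unfolding D.antipode_bos[OF f] UNIV_bit
      using m[OF t(2)] Bos.carrier_closed(2) by (simp add: add t del: D.Bos_simps(1))
    also have "\<dots> = antipode A (f 0) + g \<cdot> antipode A (f 1)"
      using c by (simp add: antipode_B mult_distrib)
    also have "\<dots> = antipode A (\<Phi> f)" using c by (simp add: \<Phi>_def antipode_distrib antipode_mult_g)
    finally show ?thesis ..
  qed
  show ?thesis
    unfolding hopf_isomorphism_def linear_on_def
    using bij add scale mult comult counit antipode by (simp add: hash\<Phi> del: D.Bos_simps(1))
qed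

text \<open>If B had no odd part, \<gamma> would fix B and g, hence all of A = B + B g, and g would
  be central.\<close>

lemma grade_1_nonzero: "grade D 1 \<noteq> {0}"
proof
  assume *: "grade D 1 = {0}"
  have \<gamma>B: "\<gamma> b = b" if "b \<in> B" for b
    using P_grade[OF that, of 1] * P_diff[OF BC[OF that]] P_sum[of b] by simp
  have "g \<cdot> x = x \<cdot> g" if x: "x \<in> carrier A" for x
  proof -
    have "\<gamma> x = \<gamma> (E x + (N x \<cdot> g) \<cdot> g)" using decomp[OF x] by simp
    also have "\<dots> = \<gamma> (E x) + \<gamma> (N x \<cdot> g) \<cdot> g" using x by (simp add: \<gamma>_distrib \<gamma>_mult del: g_cancel)
    also have "\<dots> = x" using \<gamma>B[of "E x"] \<gamma>B[of "N x \<cdot> g"] decomp[OF x] x by simp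
    finally show ?thesis using g_mult(1)[OF x] by simp
  qed
  then show False using not_center by (simp add: center_def)
qed

lemma coinv_superization: "superization A D"
  using coinv_hopf_superalgebra grade_1_nonzero bosonization_isomorphism
  unfolding superization_def hopf_isomorphic_def by blast

end

section \<open>Equivalent data and isomorphic coinvariants\<close>

text \<open>The operators \<gamma>, L, Q and T are built from the datum and the Hopf structure
  alone, so an automorphism that matches the data intertwines them. It therefore restricts to the
  coinvariants and respects their operations and grading.\<close>

lemma coinv_isomorphic_if_equiv:
  fixes A :: "('k::field, 'a::ab_group_add) hopf"
  assumes G: "super_datum A g \<alpha>" and H: "super_datum A h \<beta>"
    and \<phi>: "hopf_isomorphism A A \<phi>" and gh: "\<phi> g = h" and ab: "\<And>a. a \<in> carrier A \<Longrightarrow> \<alpha> a = \<beta> (\<phi> a)"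
  shows "super_isomorphic (coinv A (g, \<alpha>)) (coinv A (h, \<beta>))"
proof -
  interpret G: super_datum A g \<alpha> by fact
  interpret H: super_datum A h \<beta> by fact
  note p = hopf_isomorphismD[OF \<phi>]
  note sw = hopf_isomorphism_sweedler[OF \<phi> G.comult_space_axioms G.comult_space_axioms]
  have pm: "\<phi> (x - y) = \<phi> x - \<phi> y" if "x \<in> carrier A" "y \<in> carrier A" for x y
    using p(4)[of "x - y" y] that by simp
  have \<gamma>: "\<phi> (G.\<gamma> x) = H.\<gamma> (\<phi> x)" if "x \<in> carrier A" for x
    using that by (simp add: G.\<gamma>_def H.\<gamma>_def p gh)
  have L: "\<phi> (G.L x) = H.L (\<phi> x)" if x: "x \<in> carrier A" for x
  proof -
    have "\<phi> (G.L x) = sweedler A (\<lambda>u v. \<phi> (smult A (\<alpha> v) u)) x"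
      unfolding G.L_eq by (rule G.sweedler_hom[OF G.bilL p(2) G.vs G.sub _ x]) simp
    also have "\<dots> = sweedler A (\<lambda>u v. smult A (\<beta> (\<phi> v)) (\<phi> u)) x"
      by (rule G.sweedler_cong) (simp add: p ab)
    also have "\<dots> = H.L (\<phi> x)" unfolding H.L_eq by (rule sw[OF H.bilL x, symmetric])
    finally show ?thesis .
  qed
  have Q: "\<phi> (G.Q x) = H.Q (\<phi> x)" if "x \<in> carrier A" for x
    using that by (simp add: G.Q_def H.Q_def G.E_def H.E_def G.N_def H.N_def p pm gh L)
  have T: "\<phi> (G.T x) = H.T (\<phi> x)" if "x \<in> carrier A" for x
    using that by (simp add: G.T_def H.T_def p(3-9) p(10)[symmetric] pm gh L \<gamma> G.R_eq_\<gamma>L H.R_eq_\<gamma>L)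
  have inj: "inj_on \<phi> (carrier A)" and im: "\<phi> ` carrier A = carrier A" using p(1) by (auto simp: bij_betw_def)
  have B: "\<phi> x \<in> H.B \<longleftrightarrow> x \<in> G.B" if "x \<in> carrier A" for x
    using that L[of x] inj_onD[OF inj, of "G.L x" x] by (auto simp: G.B_def H.B_def p)
  have bij: "bij_betw \<phi> G.B H.B"
  proof (rule bij_betw_imageI)
    show "inj_on \<phi> G.B" by (rule inj_on_subset[OF inj]) (use G.BC in blast)
    show "\<phi> ` G.B = H.B"
    proof
      show "\<phi> ` G.B \<subseteq> H.B" using B G.BC by blast
      show "H.B \<subseteq> \<phi> ` G.B"
      proof
        fix y assume y: "y \<in> H.B"
        then obtain x where "x \<in> carrier A" "y = \<phi> x" using im H.BC by blast
        then show "y \<in> \<phi> ` G.B" using B y by blast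
      qed
    qed
  qed
  have comult: "comult H.D (\<phi> x) = sweedler G.D (\<lambda>u v. \<phi> u \<otimes>\<^bsub>A\<^esub> \<phi> v) x" if x: "x \<in> G.B" for x
  proof -
    have xC: "x \<in> carrier A" using x by (rule G.BC)
    have b: "bil A fscale (\<lambda>u v. H.Q u \<otimes>\<^bsub>A\<^esub> H.Q v)" by (rule bilI) (simp_all add: H.distrib H.ENQ_distrib)
    have b': "bil A fscale (\<lambda>u v. \<phi> u \<otimes>\<^bsub>A\<^esub> \<phi> v)" by (rule bilI) (simp_all add: p G.distrib)
    have "comult H.D (\<phi> x) = sweedler A (\<lambda>u v. H.Q (\<phi> u) \<otimes>\<^bsub>A\<^esub> H.Q (\<phi> v)) x"
      using sw[OF b xC] H.comult_D_B B x xC by simp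
    also have "\<dots> = sweedler A (\<lambda>u v. \<phi> (G.Q u) \<otimes>\<^bsub>A\<^esub> \<phi> (G.Q v)) x"
      by (rule G.sweedler_cong) (simp add: Q)
    also have "\<dots> = sweedler G.D (\<lambda>u v. \<phi> u \<otimes>\<^bsub>A\<^esub> \<phi> v) x"
      by (rule G.sweedler_D[OF G.bil_bilB[OF b'] x, symmetric])
    finally show ?thesis .
  qed
  have "hopf_isomorphism G.D H.D \<phi>"
    unfolding hopf_isomorphism_def linear_on_def
    using bij comult by (auto simp: p G.BC G.antipode_D H.antipode_D T)
  moreover have "\<forall>i. \<forall>x\<in>grade G.D i. \<phi> x \<in> grade H.D i"
    using B G.BC by (auto simp: G.grade_D H.grade_D \<gamma>[symmetric] p)
  ultimately show ?thesis unfolding super_isomorphic_def by blast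
qed

text \<open>An even isomorphism intertwines conjugation by g with conjugation by h, which is what
  makes the extension to A = B + B g multiplicative. For the coproduct,
  \<open>sweedler_graded\<close> expresses sums in A over elements of B through sums in the
  coinvariants, on both sides.\<close>

lemma equiv_if_coinv_isomorphic:
  fixes A :: "('k::field, 'a::ab_group_add) hopf"
  assumes G: "super_datum A g \<alpha>" and H: "super_datum A h \<beta>"
    and "super_isomorphic (coinv A (g, \<alpha>)) (coinv A (h, \<beta>))"
  shows "\<exists>\<phi>. hopf_isomorphism A A \<phi> \<and> \<phi> g = h \<and> (\<forall>a\<in>carrier A. \<alpha> a = \<beta> (\<phi> a))"
proof -
  interpret G: super_datum A g \<alpha> by fact
  interpret H: super_datum A h \<beta> by fact
  obtain \<phi> where \<phi>: "hopf_isomorphism G.D H.D \<phi>" and gr: "\<And>i x. x \<in> grade G.D i \<Longrightarrow> \<phi> x \<in> grade H.D i"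
    using assms(3) unfolding super_isomorphic_def by blast
  note p = hopf_isomorphismD[OF \<phi>, unfolded G.D_simps H.D_simps]
  have pC: "\<phi> b \<in> carrier A" if "b \<in> G.B" for b using p(3)[OF that] H.BC by blast
  have \<phi>P: "\<phi> (G.P i b) = H.P i (\<phi> b)" if b: "b \<in> G.B" for i b
  proof -
    have "G.P i b + G.P (i + 1) b = b"
      using G.P_sum[of b] by (cases i) (simp_all add: add.commute)
    then have "\<phi> b = \<phi> (G.P i b) + \<phi> (G.P (i + 1) b)"
      using p(4)[of "G.P i b" "G.P (i + 1) b"] b by simp
    moreover have "homog_part H.D i (\<phi> (G.P i b) + \<phi> (G.P (i + 1) b)) = \<phi> (G.P i b)"
      by (rule H.D.homog_part_add) (use b in \<open>auto intro!: gr\<close>)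
    ultimately show ?thesis using H.homog_part_D p(3)[OF b] by simp
  qed
  have \<phi>\<gamma>: "\<phi> (G.\<gamma> b) = H.\<gamma> (\<phi> b)" if b: "b \<in> G.B" for b
  proof -
    have "\<phi> (G.P 0 b - G.P 1 b) = \<phi> (G.P 0 b) - \<phi> (G.P 1 b)"
      using p(4)[of "G.P 0 b - G.P 1 b" "G.P 1 b"] b by simp
    then show ?thesis using b by (simp add: G.P_diff G.BC H.P_diff pC \<phi>P)
  qed
  define \<Psi> where "\<Psi> x = \<phi> (G.E x) + mult A (\<phi> (mult A (G.N x) g)) h" for x
  have \<Psi>C [simp]: "\<Psi> x \<in> carrier A" if "x \<in> carrier A" for x using that by (simp add: \<Psi>_def pC)
  have \<phi>0: "\<phi> 0 = 0" using p(4)[of 0 0] by simp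
  have \<Psi>B: "\<Psi> b = \<phi> b" if "b \<in> G.B" for b using that by (simp add: \<Psi>_def \<phi>0)
  have \<Psi>bc: "\<Psi> (b + mult A c g) = \<phi> b + mult A (\<phi> c) h" if "b \<in> G.B" "c \<in> G.B" for b c
    using that by (simp add: \<Psi>_def G.EN_decomp)
  have add: "\<Psi> (x + y) = \<Psi> x + \<Psi> y" and scale: "\<Psi> (smult A c x) = smult A c (\<Psi> x)"
    if "x \<in> carrier A" "y \<in> carrier A" for x y c
    using that by (simp_all add: \<Psi>_def G.ENQ_distrib G.mult_distrib G.smult_distrib p pC algebra_simps)
  have \<Psi>g: "\<Psi> (mult A x g) = mult A (\<Psi> x) h" if x: "x \<in> carrier A" for x
  proof -
    have "\<Psi> (mult A x g) = \<phi> (mult A (G.N x) g) + mult A (\<phi> (G.E x)) h" using x by (simp add: \<Psi>_def G.E_N_mult_g)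
    then show ?thesis using x by (simp add: \<Psi>_def G.mult_distrib pC add.commute)
  qed
  have mult: "\<Psi> (mult A x y) = mult A (\<Psi> x) (\<Psi> y)" if x: "x \<in> carrier A" and y: "y \<in> carrier A" for x y
  proof -
    obtain b c where bc: "b \<in> G.B" "c \<in> G.B" "x = b + mult A c g" using G.decompose_B[OF x] .
    obtain b' c' where bc': "b' \<in> G.B" "c' \<in> G.B" "y = b' + mult A c' g" using G.decompose_B[OF y] .
    note c = bc bc' bc(1,2)[THEN G.BC] bc'(1,2)[THEN G.BC] bc(1,2)[THEN pC] bc'(1,2)[THEN pC]
    have e1: "mult A (mult A c g) (mult A c' g) = mult A c (G.\<gamma> c')" "mult A (mult A c g) b' = mult A (mult A c (G.\<gamma> b')) g"
      using c by (simp_all add: G.\<gamma>_def G.mult_assoc G.gg)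
    have e2: "mult A (mult A (\<phi> c) h) (mult A (\<phi> c') h) = mult A (\<phi> c) (H.\<gamma> (\<phi> c'))" "mult A (mult A (\<phi> c) h) (\<phi> b') = mult A (mult A (\<phi> c) (H.\<gamma> (\<phi> b'))) h"
      using c by (simp_all add: H.\<gamma>_def G.mult_assoc H.gg)
    have "mult A x y = (mult A b b' + mult A c (G.\<gamma> c')) + mult A (mult A b c' + mult A c (G.\<gamma> b')) g"
      using c e1 by (simp add: G.mult_distrib G.mult_assoc[symmetric] algebra_simps)
    then have "\<Psi> (mult A x y) = \<phi> (mult A b b' + mult A c (G.\<gamma> c')) + mult A (\<phi> (mult A b c' + mult A c (G.\<gamma> b'))) h"
      using c by (simp add: \<Psi>bc)
    also have "\<dots> = mult A (\<phi> b + mult A (\<phi> c) h) (\<phi> b' + mult A (\<phi> c') h)"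
      using c e2 by (simp add: p \<phi>\<gamma> G.mult_distrib G.mult_assoc[symmetric] algebra_simps)
    finally show ?thesis using c by (simp add: \<Psi>bc)
  qed
  have one: "\<Psi> \<one>\<^bsub>A\<^esub> = \<one>\<^bsub>A\<^esub>" using \<Psi>B[of "\<one>\<^bsub>A\<^esub>"] p(7) by simp
  have \<Psi>g1: "\<Psi> g = h" using \<Psi>g[of "\<one>\<^bsub>A\<^esub>"] one by simp
  have b\<Psi>: "bil A s (\<lambda>u v. F (\<Psi> u) (\<Psi> v))" if "bil A s F" for s F
    by (rule bilI) (simp_all add: bilD[OF that] add scale)
  have swB: "sweedler A F (\<phi> b) = sweedler A (\<lambda>u v. F (\<Psi> u) (\<Psi> v)) b" if F: "bil A fscale F" and b: "b \<in> G.B"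
    for F :: "'a \<Rightarrow> 'a \<Rightarrow> ('k, 'a, 'a) tensor" and b
  proof -
    have bil: "bil H.D fscale (\<lambda>u v. F u (H.P 0 v) + F (mult A u h) (H.P 1 v))"
      using H.bil_bilB[OF H.bil_graded[OF F]] by (simp add: H.bilB_def bil_def)
    have "sweedler A F (\<phi> b) = sweedler H.D (\<lambda>u v. F u (H.P 0 v) + F (mult A u h) (H.P 1 v)) (\<phi> b)"
      by (rule H.sweedler_graded[OF F p(3)[OF b], symmetric])
    also have "\<dots> = sweedler G.D (\<lambda>u v. F (\<phi> u) (H.P 0 (\<phi> v)) + F (mult A (\<phi> u) h) (H.P 1 (\<phi> v))) b"
      by (rule hopf_isomorphism_sweedler[OF \<phi> G.D.comult_space_axioms H.D.comult_space_axioms bil]) (simp add: b)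
    also have "\<dots> = sweedler G.D (\<lambda>u v. F (\<Psi> u) (\<Psi> (G.P 0 v)) + F (\<Psi> (mult A u g)) (\<Psi> (G.P 1 v))) b"
      by (rule tensor_lift_cong) (simp add: \<Psi>g \<Psi>B \<phi>P G.BC)
    also have "\<dots> = sweedler A (\<lambda>u v. F (\<Psi> u) (\<Psi> v)) b"
      by (rule G.sweedler_graded[OF b\<Psi>[OF F] b])
    finally show ?thesis .
  qed
  have comult: "comult A (\<Psi> x) = sweedler A (\<lambda>u v. \<Psi> u \<otimes>\<^bsub>A\<^esub> \<Psi> v) x" if x: "x \<in> carrier A" for x
  proof -
    obtain b c where bc: "b \<in> G.B" "c \<in> G.B" "x = b + mult A c g" using G.decompose_B[OF x] .
    note c = bc bc(1,2)[THEN G.BC] bc(1,2)[THEN pC]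
    have bh: "bil A fscale (\<lambda>u v. (mult A u h) \<otimes>\<^bsub>A\<^esub> (mult A v h))" by (rule bilI) (simp_all add: G.distrib)
    have "sweedler A (\<lambda>u v. u \<otimes>\<^bsub>A\<^esub> v) (mult A (\<phi> c) h) = sweedler A (\<lambda>u v. (mult A (\<Psi> u) h) \<otimes>\<^bsub>A\<^esub> (mult A (\<Psi> v) h)) c"
      unfolding G.sweedler_mult_group_like(1)[OF G.bil_tens H.g c(7)] by (rule swB[OF bh c(2)])
    also have "\<dots> = sweedler A (\<lambda>u v. (\<Psi> (mult A u g)) \<otimes>\<^bsub>A\<^esub> (\<Psi> (mult A v g))) c"
      by (rule G.sweedler_cong) (simp add: \<Psi>g)
    also have "\<dots> = sweedler A (\<lambda>u v. \<Psi> u \<otimes>\<^bsub>A\<^esub> \<Psi> v) (mult A c g)"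
      by (rule G.sweedler_mult_group_like(1)[OF b\<Psi>[OF G.bil_tens] G.g c(5), symmetric])
    finally have 2: "comult A (mult A (\<phi> c) h) = sweedler A (\<lambda>u v. \<Psi> u \<otimes>\<^bsub>A\<^esub> \<Psi> v) (mult A c g)"
      using G.sweedler_tens c by simp
    have 1: "comult A (\<phi> b) = sweedler A (\<lambda>u v. \<Psi> u \<otimes>\<^bsub>A\<^esub> \<Psi> v) b"
      using swB[OF G.bil_tens c(1)] G.sweedler_tens c by simp
    have "comult A (\<Psi> x) = comult A (\<phi> b) + comult A (mult A (\<phi> c) h)"
      using c G.comult_lin by (simp add: \<Psi>bc linear_on_def)
    also have "\<dots> = sweedler A (\<lambda>u v. \<Psi> u \<otimes>\<^bsub>A\<^esub> \<Psi> v) x"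
      unfolding 1 2 c(3) by (rule G.sweedler_add[OF b\<Psi>[OF G.bil_tens], symmetric]) (use c in simp_all)
    finally show ?thesis .
  qed
  have counit: "counit A (\<Psi> x) = counit A x" if x: "x \<in> carrier A" for x
  proof -
    obtain b c where "b \<in> G.B" "c \<in> G.B" "x = b + mult A c g" using G.decompose_B[OF x] .
    then show ?thesis by (simp add: \<Psi>bc G.counit_distrib G.counit_mult pC G.BC p(9))
  qed
  \<comment> \<open>On B the antipode of A is expressed by T, by g and by homogeneous parts. T is
    the antipode of the coinvariants there, so \<phi> respects each ingredient.\<close>
  have SB: "antipode A (\<phi> b) = \<Psi> (antipode A b)" if b: "b \<in> G.B" for b
  proof -
    have T: "\<phi> (G.T y) = H.T (\<phi> y)" if "y \<in> G.B" for y
      using p(10)[OF that] that by (simp add: G.antipode_D H.antipode_D G.BC pC)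
    have "\<Psi> (antipode A b) = \<Psi> (G.T (G.P 0 b)) + mult A h (\<Psi> (G.T (G.P 1 b)))"
      using b G.BC[OF b] by (simp add: G.antipode_B add mult \<Psi>g1)
    also have "\<dots> = H.T (H.P 0 (\<phi> b)) + mult A h (H.T (H.P 1 (\<phi> b)))"
      using b by (simp add: \<Psi>B T \<phi>P G.BC)
    also have "\<dots> = antipode A (\<phi> b)" using H.antipode_B p(3)[OF b] by simp
    finally show ?thesis ..
  qed
  have antipode: "antipode A (\<Psi> x) = \<Psi> (antipode A x)" if x: "x \<in> carrier A" for x
  proof -
    obtain b c where "b \<in> G.B" "c \<in> G.B" "x = b + mult A c g" using G.decompose_B[OF x] .
    then show ?thesis
      by (simp add: \<Psi>bc G.antipode_distrib pC G.BC G.antipode_mult_g H.antipode_mult_g SB add mult \<Psi>g1 \<Psi>B)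
  qed
  have bij: "bij_betw \<Psi> (carrier A) (carrier A)"
  proof (rule bij_betw_imageI)
    have inj: "inj_on \<phi> G.B" and im: "\<phi> ` G.B = H.B" using p(1) by (auto simp: bij_betw_def)
    show "inj_on \<Psi> (carrier A)"
    proof (rule inj_onI)
      fix x y assume x: "x \<in> carrier A" and y: "y \<in> carrier A" and eq: "\<Psi> x = \<Psi> y"
      obtain b c where bc: "b \<in> G.B" "c \<in> G.B" "x = b + mult A c g" using G.decompose_B[OF x] .
      obtain b' c' where bc': "b' \<in> G.B" "c' \<in> G.B" "y = b' + mult A c' g" using G.decompose_B[OF y] .
      have eq': "\<phi> b + mult A (\<phi> c) h = \<phi> b' + mult A (\<phi> c') h" using eq bc bc' by (simp add: \<Psi>bc)
      have "\<phi> b = \<phi> b'" "\<phi> c = \<phi> c'"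
        using H.EN_decomp[of "\<phi> b" "\<phi> c"] H.EN_decomp[of "\<phi> b'" "\<phi> c'"] p(3) bc bc' unfolding eq' by auto
      then show "x = y" using inj_onD[OF inj] bc bc' by blast
    qed
    show "\<Psi> ` carrier A = carrier A"
    proof
      show "\<Psi> ` carrier A \<subseteq> carrier A" by auto
      show "carrier A \<subseteq> \<Psi> ` carrier A"
      proof
        fix y assume "y \<in> carrier A"
        then obtain b' c' where bc': "b' \<in> H.B" "c' \<in> H.B" "y = b' + mult A c' h" by (rule H.decompose_B)
        obtain b c where "b \<in> G.B" "c \<in> G.B" "b' = \<phi> b" "c' = \<phi> c" using bc' im by blast
        then have "y = \<Psi> (b + mult A c g)" "b + mult A c g \<in> carrier A" using bc' by (simp_all add: \<Psi>bc G.BC)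
        then show "y \<in> \<Psi> ` carrier A" by blast
      qed
    qed
  qed
  \<comment> \<open>Both characters agree with the counit on their coinvariants and take the value
    -1 at g and h, respectively.\<close>
  have \<alpha>: "\<alpha> x = \<beta> (\<Psi> x)" if x: "x \<in> carrier A" for x
  proof -
    obtain b c where "b \<in> G.B" "c \<in> G.B" "x = b + mult A c g" using G.decompose_B[OF x] .
    then show ?thesis
      by (simp add: \<Psi>bc G.\<alpha>_distrib H.\<alpha>_distrib pC G.BC G.\<alpha>g H.\<alpha>g G.\<alpha>_B H.\<alpha>_B p(3) p(9))
  qed
  have "hopf_isomorphism A A \<Psi>"
    unfolding hopf_isomorphism_def linear_on_def
    using bij add scale mult one comult counit antipode by auto
  then show ?thesis using \<Psi>g1 \<alpha> by blast
qed

section \<open>The super-datum of a superization\<close>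

locale superized = hopf_algebra A + H: hopf_superalgebra H
  for A :: "('k::field, 'a::ab_group_add) hopf" (structure) and H :: "('k, 'h::ab_group_add) super_hopf" +
  fixes \<psi> :: "(bit \<Rightarrow> 'h) \<Rightarrow> 'a"
  assumes two: "(2::'k) \<noteq> 0" and odd: "grade H 1 \<noteq> {0}" and \<psi>: "hopf_isomorphism (bosonization H) A \<psi>"
begin

lemmas iso = hopf_isomorphismD[OF \<psi>]

definition \<theta> where "\<theta> x = \<psi> (hash x 0)"
definition s where "s = \<psi> (hash \<one>\<^bsub>H\<^esub> 1)"
text \<open>The restriction makes the function extensional on the carrier, as membership in
  \<open>characters\<close> demands.\<close>

definition \<alpha> where "\<alpha> = restrict (\<lambda>a. let f = inv_into (carrier H.Bos) \<psi> a in counit H (f 0) - counit H (f 1)) (carrier A)"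

lemma hB [simp]: "x \<in> carrier H \<Longrightarrow> hash x i \<in> carrier H.Bos" by simp

lemma \<psi>_hash_closed [simp]: "x \<in> carrier H \<Longrightarrow> \<psi> (hash x i) \<in> carrier A"
  using iso(3) hB by blast

lemma \<theta>C [simp]: "x \<in> carrier H \<Longrightarrow> \<theta> x \<in> carrier A" and sC [simp]: "s \<in> carrier A"
  by (simp_all add: \<theta>_def s_def)

lemma lin_\<psi>_hash: "lin H (smult A) (\<lambda>x. \<psi> (hash x i))"
  by (rule linI[OF vs]) (use iso(4,5) hB in \<open>simp_all add: H.hash_distrib del: H.Bos_simps(1)\<close>)

lemmas \<psi>_hash_distrib = linD(2,3)[OF lin_\<psi>_hash]

lemma \<psi>_hash_minus: "x \<in> carrier H \<Longrightarrow> \<psi> (hash (- x) i) = - \<psi> (hash x i)"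
  using \<psi>_hash_distrib(2)[of x "-1" i] by (simp add: H.smult_distrib smult_distrib)

lemma \<theta>_distrib: "x \<in> carrier H \<Longrightarrow> y \<in> carrier H \<Longrightarrow> \<theta> (x + y) = \<theta> x + \<theta> y"
  "x \<in> carrier H \<Longrightarrow> \<theta> (c \<odot>\<^bsub>H\<^esub> x) = c \<odot> \<theta> x"
  by (simp_all add: \<theta>_def \<psi>_hash_distrib)

lemma \<theta>_mult: "x \<in> carrier H \<Longrightarrow> y \<in> carrier H \<Longrightarrow> \<theta> (x \<cdot>\<^bsub>H\<^esub> y) = \<theta> x \<cdot> \<theta> y"
  using iso(6)[OF hB hB, of x y 0 0] H.hash_mult(1)[of x y 0] by (simp add: \<theta>_def)

lemma \<theta>_one: "\<theta> \<one>\<^bsub>H\<^esub> = \<one>" using iso(7) by (simp add: \<theta>_def)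

lemma par_one: "H.par \<one>\<^bsub>H\<^esub> = \<one>\<^bsub>H\<^esub>" using H.par_grade[OF H.unit_grade] by (simp add: H.smult_distrib)

lemma \<theta>_s: "x \<in> carrier H \<Longrightarrow> \<theta> x \<cdot> s = \<psi> (hash x 1)" and s_\<theta>: "x \<in> carrier H \<Longrightarrow> s \<cdot> \<theta> x = \<psi> (hash (H.par x) 1)"
  and ss: "s \<cdot> s = \<one>"
proof -
  show "\<theta> x \<cdot> s = \<psi> (hash x 1)" if "x \<in> carrier H"
    using iso(6)[OF hB hB, of x "\<one>\<^bsub>H\<^esub>" 0 1] H.hash_mult(1)[of x "\<one>\<^bsub>H\<^esub>" 1] that by (simp add: \<theta>_def s_def)
  show "s \<cdot> \<theta> x = \<psi> (hash (H.par x) 1)" if "x \<in> carrier H"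
    using iso(6)[OF hB hB, of "\<one>\<^bsub>H\<^esub>" x 1 0] H.hash_mult(2)[of "\<one>\<^bsub>H\<^esub>" x 0] that by (simp add: \<theta>_def s_def)
  show "s \<cdot> s = \<one>"
    using iso(6)[OF hB hB, of "\<one>\<^bsub>H\<^esub>" "\<one>\<^bsub>H\<^esub>" 1 1] H.hash_mult(2)[of "\<one>\<^bsub>H\<^esub>" "\<one>\<^bsub>H\<^esub>" 1] iso(7) by (simp add: s_def par_one)
qed

lemma s_\<theta>_s: "x \<in> carrier H \<Longrightarrow> s \<cdot> \<theta> x \<cdot> s = \<theta> (H.par x)"
  by (simp add: s_\<theta> \<theta>_s[symmetric] mult_assoc ss)

lemma decompose:
  assumes "a \<in> carrier A"
  obtains x y where "x \<in> carrier H" "y \<in> carrier H" "a = \<theta> x + \<psi> (hash y 1)"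
proof -
  obtain f where f: "f \<in> carrier H.Bos" "a = \<psi> f" using iso(1) assms by (auto simp: bij_betw_def)
  then have c: "f 0 \<in> carrier H" "f 1 \<in> carrier H" by simp_all
  have "a = \<psi> (hash (f 0) 0 + hash (f 1) 1)" using f H.hash_sum by metis
  also have "\<dots> = \<theta> (f 0) + \<psi> (hash (f 1) 1)" using iso(4)[OF hB hB] c by (simp add: \<theta>_def)
  finally show ?thesis using that c by blast
qed

lemma decompose_unique:
  assumes "x \<in> carrier H" "y \<in> carrier H" "x' \<in> carrier H" "y' \<in> carrier H"
    and eq: "\<theta> x + \<psi> (hash y 1) = \<theta> x' + \<psi> (hash y' 1)"
  shows "x = x'" "y = y'"
proof -
  have m: "hash u 0 + hash v 1 \<in> carrier H.Bos" if "u \<in> carrier H" "v \<in> carrier H" for u v using that by simp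
  have "\<psi> (hash x 0 + hash y 1) = \<psi> (hash x' 0 + hash y' 1)"
    using iso(4)[OF hB hB] assms by (simp add: \<theta>_def)
  then have e: "hash x 0 + hash y 1 = hash x' 0 + hash y' 1"
    using iso(1) m assms(1-4) by (auto simp: bij_betw_def simp del: H.Bos_simps dest: inj_onD)
  show "x = x'" using fun_cong[OF e, of 0] by (simp add: hash_def)
  show "y = y'" using fun_cong[OF e, of 1] by (simp add: hash_def)
qed

lemma \<alpha>_eq: assumes "x \<in> carrier H" "y \<in> carrier H"
  shows "\<alpha> (\<theta> x + \<psi> (hash y 1)) = counit H x - counit H y"
proof -
  have m: "hash x 0 + hash y 1 \<in> carrier H.Bos" using assms by simp
  have "\<theta> x + \<psi> (hash y 1) = \<psi> (hash x 0 + hash y 1)"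
    using iso(4)[OF hB hB] assms by (simp add: \<theta>_def)
  then show ?thesis
    using bij_betw_inv_into_left[OF iso(1) m] iso(3)[OF m] by (simp add: \<alpha>_def Let_def hash_def)
qed

lemma \<alpha>_hash [simp]: assumes "x \<in> carrier H"
  shows "\<alpha> (\<theta> x) = counit H x" "\<alpha> (\<psi> (hash x 1)) = - counit H x"
proof -
  have z: "\<psi> (hash 0 i) = 0" for i using \<psi>_hash_distrib(1)[of 0 0 i] by simp
  show "\<alpha> (\<theta> x) = counit H x" "\<alpha> (\<psi> (hash x 1)) = - counit H x"
    using \<alpha>_eq[of x 0] \<alpha>_eq[of 0 x] assms z by (simp_all add: \<theta>_def H.counit_distrib)
qed

lemma \<alpha>_distrib: "a \<in> carrier A \<Longrightarrow> b \<in> carrier A \<Longrightarrow> \<alpha> (a + b) = \<alpha> a + \<alpha> b" 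
  "a \<in> carrier A \<Longrightarrow> \<alpha> (c \<odot> a) = c * \<alpha> a"
proof -
  show "\<alpha> (a + b) = \<alpha> a + \<alpha> b" if a: "a \<in> carrier A" and b: "b \<in> carrier A"
  proof -
    obtain x y where xy: "x \<in> carrier H" "y \<in> carrier H" "a = \<theta> x + \<psi> (hash y 1)" by (rule decompose[OF a])
    obtain x' y' where xy': "x' \<in> carrier H" "y' \<in> carrier H" "b = \<theta> x' + \<psi> (hash y' 1)" by (rule decompose[OF b])
    have "a + b = \<theta> (x + x') + \<psi> (hash (y + y') 1)" using xy xy' by (simp add: \<theta>_distrib \<psi>_hash_distrib algebra_simps)
    then show ?thesis using xy xy' by (simp add: \<alpha>_eq H.counit_distrib)
  qed
  show "\<alpha> (c \<odot> a) = c * \<alpha> a" if a: "a \<in> carrier A"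
  proof -
    obtain x y where xy: "x \<in> carrier H" "y \<in> carrier H" "a = \<theta> x + \<psi> (hash y 1)" by (rule decompose[OF a])
    have "c \<odot> a = \<theta> (c \<odot>\<^bsub>H\<^esub> x) + \<psi> (hash (c \<odot>\<^bsub>H\<^esub> y) 1)" using xy by (simp add: \<theta>_distrib \<psi>_hash_distrib smult_distrib)
    then show ?thesis using xy by (simp add: \<alpha>_eq H.counit_distrib right_diff_distrib)
  qed
qed

lemma counit_par: "x \<in> carrier H \<Longrightarrow> counit H (H.par x) = counit H x"
  by (simp add: H.par_def H.counit_distrib H.counit_homog_part)

text \<open>Reordering a product moves s past elements of H and thereby applies \<open>par\<close>,
  which the counit ignores; only the number of factors s contributes a sign.\<close>

lemma \<alpha>_mult: 
  assumes a: "a \<in> carrier A" and b: "b \<in> carrier A" shows "\<alpha> (a \<cdot> b) = \<alpha> a * \<alpha> b"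
proof -
  obtain x y where xy: "x \<in> carrier H" "y \<in> carrier H" "a = \<theta> x + \<psi> (hash y 1)" by (rule decompose[OF a])
  obtain x' y' where xy': "x' \<in> carrier H" "y' \<in> carrier H" "b = \<theta> x' + \<psi> (hash y' 1)" by (rule decompose[OF b])
  note c = xy(1,2) xy'(1,2)
  have "s \<cdot> \<theta> x' = \<theta> (H.par x') \<cdot> s" "s \<cdot> (\<theta> y' \<cdot> s) = \<theta> (H.par y')"
    using c s_\<theta>_s[of y'] mult_assoc[of s "\<theta> y'" s] by (simp_all add: s_\<theta> \<theta>_s)
  then have "a \<cdot> b = \<theta> (x \<cdot>\<^bsub>H\<^esub> x' + y \<cdot>\<^bsub>H\<^esub> H.par y') + \<psi> (hash (x \<cdot>\<^bsub>H\<^esub> y' + y \<cdot>\<^bsub>H\<^esub> H.par x') 1)"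
    using c by (simp add: xy(3) xy'(3) \<theta>_s[symmetric] \<theta>_distrib \<theta>_mult mult_distrib mult_assoc algebra_simps)
  then show ?thesis using c xy(3) xy'(3) by (simp add: \<alpha>_eq H.counit_distrib H.counit_mult counit_par algebra_simps)
qed

text \<open>The coproducts of x#e and x#\<sigma>, transported to A: the parity of the right leg
  shifts the power of \<sigma> on the left leg.\<close>

lemma sweedler_\<psi>:
  assumes F: "bil A t F" and x: "x \<in> carrier H"
  shows "sweedler A F (\<theta> x) = sweedler H (\<lambda>u v. F (\<theta> u) (\<theta> (homog_part H 0 v)) + F (\<psi> (hash u 1)) (\<theta> (homog_part H 1 v))) x"
    "sweedler A F (\<psi> (hash x 1)) = sweedler H (\<lambda>u v. F (\<psi> (hash u 1)) (\<psi> (hash (homog_part H 0 v) 1)) + F (\<theta> u) (\<psi> (hash (homog_part H 1 v) 1))) x"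
proof -
  have b: "bil H.Bos t (\<lambda>u v. F (\<psi> u) (\<psi> v))"
    by (rule bilI) (use iso(3-5) in \<open>simp_all add: bilD[OF F] del: H.Bos_simps\<close>)
  have b0: "bil H t (\<lambda>u v. \<Sum>d\<in>UNIV. F (\<psi> (hash u (i + d))) (\<psi> (hash (homog_part H d v) i)))" for i
    using H.bil_add[OF H.bil_hash[OF b] H.bil_hash[OF b]] by (simp add: UNIV_bit)
  have z: "sweedler H G 0 = 0" if "bil H t G" for G
    using H.sweedler_add[OF that, of 0 0] by simp
  have e: "sweedler A F (\<psi> f) = (\<Sum>i\<in>UNIV. sweedler H (\<lambda>u v. \<Sum>d\<in>UNIV. F (\<psi> (hash u (i + d))) (\<psi> (hash (homog_part H d v) i))) (f i))"
    if f: "f \<in> carrier H.Bos" for f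
    using hopf_isomorphism_sweedler[OF \<psi> H.bos_comult_space comult_space_axioms F f] H.sweedler_bos[OF b f] by simp
  have h: "hash x 0 0 = x" "hash x 0 1 = 0" "hash x 1 0 = 0" "hash x 1 1 = x" by (simp_all add: hash_def)
  show "sweedler A F (\<theta> x) = sweedler H (\<lambda>u v. F (\<theta> u) (\<theta> (homog_part H 0 v)) + F (\<psi> (hash u 1)) (\<theta> (homog_part H 1 v))) x"
    "sweedler A F (\<psi> (hash x 1)) = sweedler H (\<lambda>u v. F (\<psi> (hash u 1)) (\<psi> (hash (homog_part H 0 v) 1)) + F (\<theta> u) (\<psi> (hash (homog_part H 1 v) 1))) x"
    using e[OF hB[OF x], of 0] e[OF hB[OF x], of 1] z[OF b0[of 0]] z[OF b0[of 1]] by (simp_all add: UNIV_bit h \<theta>_def)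
qed

lemma bilL: "bil A (smult A) (\<lambda>u v. \<alpha> v \<odot> u)" and bilR: "bil A (smult A) (\<lambda>u v. \<alpha> u \<odot> v)"
  by (rule bilI; simp add: \<alpha>_distrib smult_distrib vs mult.commute)+

lemma lin_\<theta>: "lin H (smult A) \<theta>" by (rule linI[OF vs]) (simp_all add: \<theta>_distrib)

text \<open>Here \<alpha> sits on the right leg. The counit vanishes on odd elements, so only the
  even part of v survives, and a factor \<sigma> on that leg contributes the sign.\<close>

lemma act_left: assumes x: "x \<in> carrier H"
  shows "act_left A \<alpha> (\<theta> x) = \<theta> x" "act_left A \<alpha> (\<psi> (hash x 1)) = - \<psi> (hash x 1)"
proof -
  have "act_left A \<alpha> (\<theta> x) = sweedler H (\<lambda>u v. counit H v \<odot> \<theta> u) x"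
    unfolding act_left_def sweedler_\<psi>(1)[OF bilL x]
    by (rule H.sweedler_cong) (simp add: H.counit_homog_part smult_distrib)
  also have "\<dots> = \<theta> x" by (rule H.sweedler_counit_right[OF lin_\<theta> x])
  finally show "act_left A \<alpha> (\<theta> x) = \<theta> x" .
  have "act_left A \<alpha> (\<psi> (hash x 1)) = sweedler H (\<lambda>u v. counit H v \<odot> (- \<psi> (hash u 1))) x"
    unfolding act_left_def sweedler_\<psi>(2)[OF bilL x]
    by (rule H.sweedler_cong) (simp add: H.counit_homog_part smult_distrib)
  also have "\<dots> = - \<psi> (hash x 1)"
    by (rule H.sweedler_counit_right[OF _ x]) (rule linI[OF vs]; simp add: \<psi>_hash_distrib smult_distrib)
  finally show "act_left A \<alpha> (\<psi> (hash x 1)) = - \<psi> (hash x 1)" .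
qed

lemma par_distrib: "x \<in> carrier H \<Longrightarrow> y \<in> carrier H \<Longrightarrow> H.par (x + y) = H.par x + H.par y"
  "x \<in> carrier H \<Longrightarrow> H.par (c \<odot>\<^bsub>H\<^esub> x) = c \<odot>\<^bsub>H\<^esub> H.par x"
  by (simp_all add: H.par_def H.homog_part_distrib H.smult_distrib algebra_simps)

text \<open>Here \<alpha> sits on the left leg, whose power of \<sigma> depends on the parity of v;
  the resulting signs turn v into \<open>par\<close> v.\<close>

lemma act_right: assumes x: "x \<in> carrier H"
  shows "act_right A (\<theta> x) \<alpha> = \<theta> (H.par x)" "act_right A (\<psi> (hash x 1)) \<alpha> = - \<psi> (hash (H.par x) 1)"
proof -
  have m: "\<theta> (H.par v) = \<theta> (homog_part H 0 v) + - \<theta> (homog_part H 1 v)"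
    "\<psi> (hash (H.par v) 1) = \<psi> (hash (homog_part H 0 v) 1) + - \<psi> (hash (homog_part H 1 v) 1)" if "v \<in> carrier H" for v
    using that \<psi>_hash_distrib(1)[of "homog_part H 0 v" "- homog_part H 1 v"] \<psi>_hash_minus
    by (simp_all add: H.par_def \<theta>_def)
  have "act_right A (\<theta> x) \<alpha> = sweedler H (\<lambda>u v. counit H u \<odot> \<theta> (H.par v)) x"
    unfolding act_right_def sweedler_\<psi>(1)[OF bilR x]
    by (rule H.sweedler_cong) (simp add: m smult_distrib)
  also have "\<dots> = \<theta> (H.par x)"
    by (rule H.sweedler_counit_left[OF _ x]) (rule linI[OF vs]; simp add: par_distrib \<theta>_distrib)
  finally show "act_right A (\<theta> x) \<alpha> = \<theta> (H.par x)" .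
  have "act_right A (\<psi> (hash x 1)) \<alpha> = sweedler H (\<lambda>u v. counit H u \<odot> (- \<psi> (hash (H.par v) 1))) x"
    unfolding act_right_def sweedler_\<psi>(2)[OF bilR x]
    by (rule H.sweedler_cong) (simp add: m smult_distrib)
  also have "\<dots> = - \<psi> (hash (H.par x) 1)"
    by (rule H.sweedler_counit_left[OF _ x]) (rule linI[OF vs]; simp add: par_distrib \<psi>_hash_distrib smult_distrib)
  finally show "act_right A (\<psi> (hash x 1)) \<alpha> = - \<psi> (hash (H.par x) 1)" .
qed

lemma counit_\<psi>: assumes "x \<in> carrier H" shows "counit A (\<psi> (hash x i)) = counit H x"
  using iso(9)[OF hB[OF assms, of i]] assms by (cases i) (simp_all add: UNIV_bit hash_def H.counit_distrib)

lemma s_\<alpha>_super_data: "(s, \<alpha>) \<in> super_data A"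
proof -
  have bt: "bil A fscale (\<lambda>u v. u \<otimes>\<^bsub>A\<^esub> v)" by (rule bil_tens)
  have par0: "H.par 0 = 0" by (simp add: H.par_def)
  have one: "homog_part H 0 \<one>\<^bsub>H\<^esub> = \<one>\<^bsub>H\<^esub>" "homog_part H 1 \<one>\<^bsub>H\<^esub> = 0"
    using H.homog_part_grade[OF H.unit_grade] by simp_all
  have z: "\<psi> (hash 0 i) = 0" for i using \<psi>_hash_distrib(1)[of 0 0 i] by simp
  have gl: "s \<in> group_like A"
  proof -
    have b: "bil H fscale (\<lambda>u v. \<psi> (hash u 1) \<otimes>\<^bsub>A\<^esub> \<psi> (hash (homog_part H 0 v) 1) + (\<theta> u \<otimes>\<^bsub>A\<^esub> \<psi> (hash (homog_part H 1 v) 1)))"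
      by (rule bilI) (simp_all add: \<psi>_hash_distrib \<theta>_distrib H.homog_part_distrib tens_distrib vector_space_fscale fscale_distrib algebra_simps)
    have "comult A s = sweedler A (\<lambda>u v. u \<otimes>\<^bsub>A\<^esub> v) s" by (simp add: sweedler_tens)
    also have "\<dots> = sweedler H (\<lambda>u v. \<psi> (hash u 1) \<otimes>\<^bsub>A\<^esub> \<psi> (hash (homog_part H 0 v) 1) + (\<theta> u \<otimes>\<^bsub>A\<^esub> \<psi> (hash (homog_part H 1 v) 1))) \<one>\<^bsub>H\<^esub>"
      unfolding s_def by (rule sweedler_\<psi>(2)[OF bt]) simp
    also have "\<dots> = s \<otimes>\<^bsub>A\<^esub> s + (\<theta> \<one>\<^bsub>H\<^esub> \<otimes>\<^bsub>A\<^esub> 0)"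
      unfolding H.sweedler_one[OF b] by (simp only: one z s_def)
    also have "\<theta> \<one>\<^bsub>H\<^esub> \<otimes>\<^bsub>A\<^esub> 0 = 0" using tens_distrib(2)[of "\<theta> \<one>\<^bsub>H\<^esub>" 0 0] by (metis add_cancel_right_right)
    finally show ?thesis using counit_\<psi>[of "\<one>\<^bsub>H\<^esub>" 1] by (simp add: group_like_def s_def)
  qed
  have \<alpha>one: "\<alpha> \<one> = 1" using \<alpha>_hash(1)[of "\<one>\<^bsub>H\<^esub>"] by (simp add: \<theta>_one)
  have \<alpha>s: "\<alpha> s = - 1" using \<alpha>_hash(2)[of "\<one>\<^bsub>H\<^esub>"] by (simp add: s_def)
  have ne: "(-1 :: 'k) \<noteq> 1" using two by (metis add.left_inverse one_add_one)
  have ch: "\<alpha> \<in> characters A"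
    using \<alpha>_distrib \<alpha>_mult \<alpha>one by (simp add: characters_def linear_on_def) (simp add: \<alpha>_def)
  have s1: "s \<noteq> \<one>" using \<alpha>s \<alpha>one ne by auto
  have \<alpha>e: "\<alpha> \<noteq> restrict (counit A) (carrier A)"
    using \<alpha>s ne group_likeD[OF gl] by (metis restrict_apply')
  have conv: "convolution A \<alpha> \<alpha> = restrict (counit A) (carrier A)"
  proof -
    have b: "bil A (*) (\<lambda>u v. \<alpha> u * \<alpha> v)"
      by (rule bilI) (simp_all add: \<alpha>_distrib vector_space_mult algebra_simps)
    have lc: "lin H (*) (counit H)" by (rule linI) (simp_all add: H.counit_distrib vector_space_mult)
    have 0: "sweedler A (\<lambda>u v. \<alpha> u * \<alpha> v) (\<theta> x) = counit H x" if x: "x \<in> carrier H" for x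
    proof -
      have "sweedler A (\<lambda>u v. \<alpha> u * \<alpha> v) (\<theta> x) = sweedler H (\<lambda>u v. counit H u * counit H v) x"
        unfolding sweedler_\<psi>(1)[OF b x] by (rule H.sweedler_cong) (simp add: H.counit_homog_part)
      then show ?thesis using H.sweedler_counit_left[OF lc x] by simp
    qed
    have 1: "sweedler A (\<lambda>u v. \<alpha> u * \<alpha> v) (\<psi> (hash x 1)) = counit H x" if x: "x \<in> carrier H" for x
    proof -
      have "sweedler A (\<lambda>u v. \<alpha> u * \<alpha> v) (\<psi> (hash x 1)) = sweedler H (\<lambda>u v. counit H u * counit H v) x"
        unfolding sweedler_\<psi>(2)[OF b x] by (rule H.sweedler_cong) (simp add: H.counit_homog_part)
      then show ?thesis using H.sweedler_counit_left[OF lc x] by simp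
    qed
    have "sweedler A (\<lambda>u v. \<alpha> u * \<alpha> v) a = counit A a" if a: "a \<in> carrier A" for a
    proof -
      obtain x y where xy: "x \<in> carrier H" "y \<in> carrier H" "a = \<theta> x + \<psi> (hash y 1)" by (rule decompose[OF a])
      have "sweedler A (\<lambda>u v. \<alpha> u * \<alpha> v) a = counit H x + counit H y"
        unfolding xy(3) using sweedler_add[OF b] xy 0 1 by simp
      then show ?thesis using xy counit_\<psi> by (simp add: counit_distrib \<theta>_def)
    qed
    then show ?thesis by (auto simp: convolution_def restrict_def)
  qed
  \<comment> \<open>A nonzero odd h anticommutes with s under the embedding; commuting with s as
    well would give h = - h, which forces h = 0 as 2 is invertible.\<close>
  have nc: "s \<notin> center A"
  proof
    assume "s \<in> center A"
    then have comm: "s \<cdot> a = a \<cdot> s" if "a \<in> carrier A" for a using that by (simp add: center_def)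
    obtain h where h: "h \<in> grade H 1" "h \<noteq> 0" using odd H.grade_0[of 1] by blast
    have hC: "h \<in> carrier H" by (rule H.gradeC[OF h(1)])
    have "H.par h = - h" using H.par_grade[OF h(1)] by (simp add: H.smult_distrib)
    then have "\<theta> 0 + \<psi> (hash (- h) 1) = \<theta> 0 + \<psi> (hash h 1)"
      using comm[of "\<theta> h"] hC by (simp add: s_\<theta> \<theta>_s)
    then have "- h = h" by (rule decompose_unique(2)[rotated 4]) (use hC in simp_all)
    then show False using vector_space_neg_eq_zero[OF H.vs two, of h] h(2) by simp
  qed
  \<comment> \<open>On H#e the left action is trivial and both sides apply \<open>par\<close>; on
    H#\<sigma> the signs of the two actions cancel.\<close>
  have act: "act_right A (act_left A \<alpha> a) \<alpha> = s \<cdot> a \<cdot> s" if a: "a \<in> carrier A" for a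
  proof -
    have l: "linear_on (smult A) (smult A) (carrier A) (act_left A \<alpha>)" "linear_on (smult A) (smult A) (carrier A) (\<lambda>a. act_right A a \<alpha>)"
      using sweedler_linear[OF bilL] sweedler_linear[OF bilR] by (simp_all add: lin_def linear_on_def act_left_def act_right_def)
    have add: "act_left A \<alpha> (a + b) = act_left A \<alpha> a + act_left A \<alpha> b" "act_right A (a + b) \<alpha> = act_right A a \<alpha> + act_right A b \<alpha>"
       "act_right A (c \<odot> b) \<alpha> = c \<odot> act_right A b \<alpha>"
      if "a \<in> carrier A" "b \<in> carrier A" for a b c using l that by (simp_all add: linear_on_def)
    obtain x y where xy: "x \<in> carrier H" "y \<in> carrier H" "a = \<theta> x + \<psi> (hash y 1)" by (rule decompose[OF a])
    have neg: "act_right A (- \<psi> (hash y 1)) \<alpha> = \<psi> (hash (H.par y) 1)"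
      using add(3)[of 0 "\<psi> (hash y 1)" "-1"] act_right(2)[of y] xy by (simp add: smult_distrib)
    have "s \<cdot> (\<theta> y \<cdot> s) \<cdot> s = \<theta> (H.par y) \<cdot> s"
      using s_\<theta>_s[of y] xy by (simp add: mult_assoc[symmetric])
    then have "s \<cdot> a \<cdot> s = \<theta> (H.par x) + \<psi> (hash (H.par y) 1)"
      using xy s_\<theta>_s by (simp add: \<theta>_s[symmetric] mult_distrib)
    moreover have "act_right A (\<theta> x - \<psi> (hash y 1)) \<alpha> = \<theta> (H.par x) + \<psi> (hash (H.par y) 1)"
      using add(2)[of "\<theta> x" "- \<psi> (hash y 1)"] neg act_right(1)[of x] xy by simp
    ultimately show ?thesis using xy by (simp add: add(1) act_left)
  qed
  show ?thesis using gl ch s1 ss \<alpha>e conv \<alpha>s nc act by (simp add: super_data_def admissible_data_def)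
qed

text \<open>The left action of \<alpha> is 1 on H#e and -1 on H#\<sigma>, so its fixed space is the
  image of \<theta>. In the coproduct, Q sends u#\<sigma> to \<theta> u and so undoes the shift of
  the power of \<sigma>; the two parities of the right leg then recombine.\<close>

lemma isomorphic_coinv: "super_isomorphic H (coinv A (s, \<alpha>))"
proof -
  interpret S: super_datum A s \<alpha> by unfold_locales (rule two, rule s_\<alpha>_super_data)
  have L: "S.L (\<theta> x) = \<theta> x" "S.L (\<psi> (hash x 1)) = - \<psi> (hash x 1)" if "x \<in> carrier H" for x
    using that by (simp_all add: S.L_def act_left)
  have \<theta>B: "\<theta> x \<in> S.B" if "x \<in> carrier H" for x using that L by (simp add: S.B_def)
  have \<gamma>: "S.\<gamma> (\<theta> x) = \<theta> (H.par x)" if "x \<in> carrier H" for x using that by (simp add: S.\<gamma>_def s_\<theta>_s)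
  have z: "\<psi> (hash 0 i) = 0" for i using \<psi>_hash_distrib(1)[of 0 0 i] by simp
  have inj: "x = y" if "x \<in> carrier H" "y \<in> carrier H" "\<theta> x = \<theta> y" for x y
    using decompose_unique(1)[of x 0 y 0] that by simp
  have bij: "bij_betw \<theta> (carrier H) S.B"
  proof (rule bij_betw_imageI)
    show "inj_on \<theta> (carrier H)" using inj by (auto intro: inj_onI)
    show "\<theta> ` carrier H = S.B"
    proof
      show "\<theta> ` carrier H \<subseteq> S.B" using \<theta>B by auto
      show "S.B \<subseteq> \<theta> ` carrier H"
      proof
        fix b assume b: "b \<in> S.B"
        obtain x y where xy: "x \<in> carrier H" "y \<in> carrier H" "b = \<theta> x + \<psi> (hash y 1)" using decompose[OF S.BC[OF b]] .
        have "\<psi> (hash y 1) = - \<psi> (hash y 1)" using S.LB[OF b] xy L by (simp add: S.LR_distrib)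
        then have "\<psi> (hash y 1) = 0" by (rule S.neg_eq_imp_zero)
        then show "b \<in> \<theta> ` carrier H" using xy by auto
      qed
    qed
  qed
  have comult: "comult S.D (\<theta> x) = sweedler H (\<lambda>u v. \<theta> u \<otimes>\<^bsub>A\<^esub> \<theta> v) x" if x: "x \<in> carrier H" for x
  proof -
    have bt: "bil A fscale (\<lambda>u v. S.Q u \<otimes>\<^bsub>A\<^esub> S.Q v)" by (rule bilI) (simp_all add: S.distrib S.ENQ_distrib)
    have "comult S.D (\<theta> x) = sweedler A (\<lambda>u v. S.Q u \<otimes>\<^bsub>A\<^esub> S.Q v) (\<theta> x)" by (rule S.comult_D_B[OF \<theta>B[OF x]])
    also have "\<dots> = sweedler H (\<lambda>u v. \<theta> u \<otimes>\<^bsub>A\<^esub> \<theta> v) x"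
      unfolding sweedler_\<psi>(1)[OF bt x]
    proof (rule H.sweedler_cong)
      fix u v assume uv: "u \<in> carrier H" "v \<in> carrier H"
      have "S.Q (\<psi> (hash u 1)) = \<theta> u" using S.Q_mult_g[of "\<theta> u"] uv \<theta>B by (simp add: \<theta>_s)
      moreover have "\<theta> v = \<theta> (homog_part H 0 v) + \<theta> (homog_part H 1 v)"
        using uv \<theta>_distrib(1)[of "homog_part H 0 v" "homog_part H 1 v"] by (simp add: H.homog_part_decomp(2))
      ultimately show "S.Q (\<theta> u) \<otimes>\<^bsub>A\<^esub> S.Q (\<theta> (homog_part H 0 v)) + (S.Q (\<psi> (hash u 1)) \<otimes>\<^bsub>A\<^esub> S.Q (\<theta> (homog_part H 1 v))) = \<theta> u \<otimes>\<^bsub>A\<^esub> \<theta> v"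
        using uv \<theta>B by (simp only: S.Q_B H.homog_part_closed tens_distrib)
    qed
    finally show ?thesis .
  qed
  have antipode: "antipode S.D (\<theta> x) = \<theta> (antipode H x)" if x: "x \<in> carrier H" for x
  proof -
    have P: "S.P i (\<theta> x) = \<theta> (homog_part H i x)" for i
    proof -
      have "x = homog_part H 0 x + homog_part H 1 x" using H.homog_part_decomp(2)[OF x] by simp
      then have "\<theta> x = \<theta> (homog_part H 0 x) + \<theta> (homog_part H 1 x)"
        using \<theta>_distrib(1)[of "homog_part H 0 x" "homog_part H 1 x"] x by simp
      moreover have "S.\<gamma> (\<theta> (homog_part H i x)) = parity_sign i \<odot> \<theta> (homog_part H i x)" for i
        using \<gamma> x H.par_grade[OF H.homog_part_decomp(1)[OF x]] by (simp add: \<theta>_distrib)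
      then have "\<theta> (homog_part H i x) \<in> grade S.D i" for i using x by (simp add: S.grade_D \<theta>B)
      ultimately have "homog_part S.D i (\<theta> x) = \<theta> (homog_part H i x)"
        using S.D.homog_part_add[of "\<theta> (homog_part H i x)" i "\<theta> (homog_part H (i + 1) x)"] by (cases i) (simp_all add: add.commute)
      then show ?thesis using S.homog_part_D \<theta>B[OF x] by simp
    qed
    \<comment> \<open>In the antipode of y#e the odd part acquires the factor s on the left. The
      second formula of \<open>T_homogeneous\<close> multiplies by s again, and s s = 1 removes
      it.\<close>
    have A0: "antipode A (\<theta> y) = \<theta> (antipode H (homog_part H 0 y)) + s \<cdot> \<theta> (antipode H (homog_part H 1 y))" if y: "y \<in> carrier H" for y
    proof -
      have h: "hash y 0 0 = y" "hash y 0 1 = 0" by (simp_all add: hash_def)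
      have m: "bos_mult H (hash \<one>\<^bsub>H\<^esub> i) (hash x 0) \<in> carrier H.Bos" if "x \<in> carrier H" for i x
        using H.hash_mult[of "\<one>\<^bsub>H\<^esub>" x 0] that by (cases i) (simp_all add: hash_def)
      have m0: "bos_mult H (hash \<one>\<^bsub>H\<^esub> i) (hash 0 0) = 0" for i
        using H.hash_mult[of "\<one>\<^bsub>H\<^esub>" 0 0] by (cases i) (simp_all add: H.par_def H.hash_distrib(3))
      have \<psi>m: "\<psi> (bos_mult H (hash \<one>\<^bsub>H\<^esub> 0) (hash x 0)) = \<theta> x" "\<psi> (bos_mult H (hash \<one>\<^bsub>H\<^esub> 1) (hash x 0)) = s \<cdot> \<theta> x" if "x \<in> carrier H" for x
        using iso(6)[OF hB hB, of "\<one>\<^bsub>H\<^esub>" x _ 0] that by (simp_all add: \<theta>_def[symmetric] s_def[symmetric] \<theta>_one)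
      have "antipode A (\<theta> y) = \<psi> (antipode H.Bos (hash y 0))" unfolding \<theta>_def by (rule iso(10)[OF hB[OF y]])
      also have "antipode H.Bos (hash y 0) = bos_mult H (hash \<one>\<^bsub>H\<^esub> 0) (hash (antipode H (homog_part H 0 y)) 0)
           + bos_mult H (hash \<one>\<^bsub>H\<^esub> 1) (hash (antipode H (homog_part H 1 y)) 0)"
        unfolding H.antipode_bos[OF hB[OF y]] by (simp add: UNIV_bit h H.antipode_distrib(4) m0)
      also have "\<psi> \<dots> = \<theta> (antipode H (homog_part H 0 y)) + s \<cdot> \<theta> (antipode H (homog_part H 1 y))"
        using iso(4)[OF m m] \<psi>m y by simp
      finally show ?thesis .
    qed
    have "antipode S.D (\<theta> x) = S.T (S.P 0 (\<theta> x)) + S.T (S.P 1 (\<theta> x))"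
      using x S.T_distrib(1)[of "S.P 0 (\<theta> x)" "S.P 1 (\<theta> x)"] by (simp add: S.antipode_D S.P_sum)
    also have "\<dots> = antipode A (\<theta> (homog_part H 0 x)) + s \<cdot> antipode A (\<theta> (homog_part H 1 x))"
      using S.T_homogeneous[OF \<theta>B[OF x]] by (simp add: P)
    also have "\<dots> = \<theta> (antipode H (homog_part H 0 x)) + \<theta> (antipode H (homog_part H 1 x))"
    proof -
      have "\<theta> 0 = 0" by (simp add: \<theta>_def z)
      then show ?thesis using x by (simp add: A0 H.homog_part_homog_part H.antipode_distrib(4))
    qed
    also have "\<dots> = \<theta> (antipode H x)"
      using x H.antipode_distrib(1)[of "homog_part H 0 x" "homog_part H 1 x"]
      by (simp add: H.homog_part_decomp(2) \<theta>_distrib(1)[symmetric])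
    finally show ?thesis .
  qed
  have "hopf_isomorphism H S.D \<theta>"
    unfolding hopf_isomorphism_def linear_on_def
    using bij comult antipode counit_\<psi>[of _ 0] by (simp add: \<theta>_distrib \<theta>_mult \<theta>_one) (simp add: \<theta>_def)
  moreover have "\<theta> x \<in> grade S.D i" if "x \<in> grade H i" for i x
    using that H.gradeC[OF that] \<theta>B \<gamma> H.par_grade[OF that] by (simp add: S.grade_D \<theta>_distrib)
  ultimately show ?thesis unfolding super_isomorphic_def by blast
qed

end

section \<open>Isomorphism classes of Hopf superalgebras\<close>

text \<open>The inverse is even because \<phi> preserves homogeneous parts: if \<phi> x has degree
  i, then x and its part of degree i have the same image, so they are equal.\<close>

lemma super_isomorphic_sym:
  assumes "super_isomorphic H H'" "hopf_superalgebra H" "hopf_superalgebra H'"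
  shows "super_isomorphic H' H"
proof -
  interpret H: hopf_superalgebra H by fact
  interpret H': hopf_superalgebra H' by fact
  obtain \<phi> where \<phi>: "hopf_isomorphism H H' \<phi>" and gr: "\<And>i x. x \<in> grade H i \<Longrightarrow> \<phi> x \<in> grade H' i"
    using assms(1) unfolding super_isomorphic_def by blast
  note p = hopf_isomorphismD[OF \<phi>]
  let ?\<psi> = "inv_into (carrier H) \<phi>"
  have "?\<psi> y \<in> grade H i" if y: "y \<in> grade H' i" for i y
  proof -
    have "y \<in> carrier H'" by (rule H'.gradeC[OF y])
    then obtain x where x: "x \<in> carrier H" "y = \<phi> x" using p(1) by (auto simp: bij_betw_def)
    have xs: "x = homog_part H i x + homog_part H (i + 1) x"
      using H.homog_part_decomp(2)[OF x(1)] by (cases i) (simp_all add: add.commute)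
    have "y = \<phi> (homog_part H i x) + \<phi> (homog_part H (i + 1) x)"
      using p(4)[of "homog_part H i x" "homog_part H (i + 1) x"] xs x by simp
    then have "homog_part H' i y = \<phi> (homog_part H i x)"
      using H'.homog_part_add gr H.homog_part_decomp(1)[OF x(1)] by simp
    then have "\<phi> x = \<phi> (homog_part H i x)" using H'.homog_part_grade[OF y, of i] x by simp
    then have "x = homog_part H i x"
      using p(1) x by (auto simp: bij_betw_def dest: inj_onD)
    then have "x \<in> grade H i" using H.homog_part_decomp(1)[OF x(1), of i] by simp
    then show ?thesis using bij_betw_inv_into_left[OF p(1) x(1)] x(2) by simp
  qed
  then show ?thesis unfolding super_isomorphic_def
    using hopf_isomorphism_sym[OF \<phi> H.hopf_core_axioms H'.comult_space_axioms] by blast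
qed

lemma super_iso_class_eqI:
  fixes H H' :: "('k::field, 'a::ab_group_add) super_hopf"
  assumes "super_isomorphic H H'" "hopf_superalgebra H" "hopf_superalgebra H'"
  shows "super_iso_class H = super_iso_class H'"
proof -
  have core: "hopf_superalgebra X \<Longrightarrow> hopf_core X" for X :: "('k, 'a) super_hopf" by (simp add: hopf_superalgebra_def)
  have "super_isomorphic X Z" if "super_isomorphic X Y" "super_isomorphic Y Z" "hopf_superalgebra X" "hopf_superalgebra Y" "hopf_superalgebra Z"
    for X Y Z :: "('k, 'a) super_hopf" using super_isomorphic_trans that core by blast
  then show ?thesis using assms super_isomorphic_sym[OF assms] unfolding super_iso_class_def by blast
qed

section \<open>The bijection\<close>

lemma two_neq_zero_if_CHAR:
  assumes "CHAR('k::field) \<noteq> 2" shows "(2::'k) \<noteq> 0"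
proof
  assume "(2::'k) = 0"
  then have "CHAR('k) dvd 2" using of_nat_eq_0_iff_char_dvd[where 'a='k, of 2] by simp
  then have "CHAR('k) \<le> 2" "CHAR('k) \<noteq> 0"
    using dvd_imp_le[of "CHAR('k)" 2] by (simp, metis dvd_0_left_iff zero_neq_numeral)
  moreover have "CHAR('k) \<noteq> 1" by simp
  ultimately show False using assms by arith
qed

text \<open>Surjectivity up to isomorphism. H lives in an arbitrary ambient type, so that this
  covers both the image of the bijection and the last conjunct of the theorem.\<close>

lemma superization_cases:
  fixes A :: "('k::field, 'a::ab_group_add) hopf" and H :: "('k, 'h::ab_group_add) super_hopf"
  assumes "(2::'k) \<noteq> 0" "hopf_algebra A" "superization A H"
  obtains d where "d \<in> super_data A" "super_isomorphic (coinv A d) H"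
proof -
  from assms(3) obtain \<psi> where H: "hopf_superalgebra H" "grade H 1 \<noteq> {0}" "hopf_isomorphism (bosonization H) A \<psi>"
    unfolding superization_def hopf_isomorphic_def by blast
  interpret S: superized A H \<psi>
    by (intro superized.intro superized_axioms.intro) (fact assms(1,2) H)+
  interpret D: super_datum A S.s S.\<alpha>
    by (intro super_datum.intro super_datum_axioms.intro) (fact assms(1,2) S.s_\<alpha>_super_data)+
  show ?thesis
    by (rule that[OF S.s_\<alpha>_super_data super_isomorphic_sym[OF S.isomorphic_coinv H(1) D.coinv_hopf_superalgebra]])
qed

context
  fixes A :: "('k::field, 'a::ab_group_add) hopf"
  assumes two: "(2::'k) \<noteq> 0" and A: "hopf_algebra A"
begin

lemma superization_coinv:
  assumes "d \<in> super_data A" shows "superization A (coinv A d)"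
proof -
  obtain g \<alpha> where d: "d = (g, \<alpha>)" by (cases d)
  interpret super_datum A g \<alpha>
    using assms d by (intro super_datum.intro super_datum_axioms.intro two A) simp
  show ?thesis using coinv_superization d by simp
qed

lemma coinv_hopf_superalgebra:
  assumes "d \<in> super_data A" shows "hopf_superalgebra (coinv A d)"
  using superization_coinv[OF assms] by (simp add: superization_def)

text \<open>The two preceding constructions, restriction and extension of isomorphisms, show that
  the relation on data is the pullback of isomorphism of coinvariants; well-definedness and
  injectivity both rest on this.\<close>

lemma super_data_equiv_iff:
  "(d, d') \<in> super_data_equiv A \<longleftrightarrow>
    d \<in> super_data A \<and> d' \<in> super_data A \<and> super_isomorphic (coinv A d) (coinv A d')"
proof -
  obtain g \<alpha> where d: "d = (g, \<alpha>)" by (cases d)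
  obtain h \<beta> where d': "d' = (h, \<beta>)" by (cases d')
  have S: "super_datum A g \<alpha>" if "(g, \<alpha>) \<in> super_data A" for g \<alpha>
    using that by (intro super_datum.intro super_datum_axioms.intro two A)
  show ?thesis
    using coinv_isomorphic_if_equiv[OF S S] equiv_if_coinv_isomorphic[OF S S]
    unfolding d d' super_data_equiv_def by blast
qed

lemma super_iso_class_coinv_eq_iff:
  assumes "d \<in> super_data A" "d' \<in> super_data A"
  shows "super_iso_class (coinv A d) = super_iso_class (coinv A d') \<longleftrightarrow> (d, d') \<in> super_data_equiv A"
proof
  assume "super_iso_class (coinv A d) = super_iso_class (coinv A d')"
  moreover have "coinv A d' \<in> super_iso_class (coinv A d')"
    using coinv_hopf_superalgebra[OF assms(2)] super_isomorphic_refl[of "coinv A d'"]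
    by (simp add: super_iso_class_def hopf_superalgebra_def)
  ultimately have "coinv A d' \<in> super_iso_class (coinv A d)" by simp
  then show "(d, d') \<in> super_data_equiv A"
    using assms by (simp add: super_data_equiv_iff super_iso_class_def)
next
  assume "(d, d') \<in> super_data_equiv A"
  then show "super_iso_class (coinv A d) = super_iso_class (coinv A d')"
    by (intro super_iso_class_eqI coinv_hopf_superalgebra assms) (simp add: super_data_equiv_iff)
qed

text \<open>On super-data the relation is the kernel of the map to isomorphism classes, and kernels
  of maps are equivalence relations.\<close>

lemma equiv_super_data: "equiv (super_data A) (super_data_equiv A)"
proof (rule equivI)
  show "super_data_equiv A \<subseteq> super_data A \<times> super_data A" by (auto simp: super_data_equiv_iff)
  have iff: "(d, d') \<in> super_data_equiv A \<longleftrightarrow> d \<in> super_data A \<and> d' \<in> super_data A \<and>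
      super_iso_class (coinv A d) = super_iso_class (coinv A d')" for d d'
    using super_iso_class_coinv_eq_iff super_data_equiv_iff by blast
  show "refl_on (super_data A) (super_data_equiv A)" by (auto simp: refl_on_def iff)
  show "sym (super_data_equiv A)" "trans (super_data_equiv A)"
    by (auto simp: sym_def trans_def iff)
qed

end

(* The isomorphism classes in the bijection are those of Hopf superalgebras in the ambient type 'a
   of A.  The last conjunct, where 'h is arbitrary, says that no isomorphism class is lost by
   this restriction. *)

theorem mainTheorem5:
  fixes A :: "('k::field, 'a::ab_group_add) hopf"
  assumes "CHAR('k) \<noteq> 2"
    and "hopf_algebra A"
  shows "equiv (super_data A) (super_data_equiv A)
    \<and> (\<forall>d\<in>super_data A. superization A (coinv A d))
    \<and> (\<lambda>d. super_iso_class (coinv A d)) respects (super_data_equiv A)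
    \<and> bij_betw (\<lambda>X. the_elem ((\<lambda>d. super_iso_class (coinv A d)) ` X))
        (super_data A // super_data_equiv A) (superization_classes A)
    \<and> (\<forall>H :: ('k, 'h::ab_group_add) super_hopf.
        superization A H \<longrightarrow> (\<exists>d\<in>super_data A. super_isomorphic (coinv A d) H))"
proof (intro conjI ballI allI impI)
  have two: "(2::'k) \<noteq> 0" using assms(1) by (rule two_neq_zero_if_CHAR)
  note super = superization_coinv[OF two assms(2)]
    and class_iff = super_iso_class_coinv_eq_iff[OF two assms(2)]
  let ?cls = "\<lambda>d. super_iso_class (coinv A d)"
  show eq: "equiv (super_data A) (super_data_equiv A)"
    by (rule equiv_super_data[OF two assms(2)])
  show "superization A (coinv A d)" if "d \<in> super_data A" for d
    by (rule super[OF that])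
  have rel: "d \<in> super_data A" "d' \<in> super_data A" if "(d, d') \<in> super_data_equiv A" for d d'
    using that by (auto simp: super_data_equiv_def)
  show resp: "?cls respects (super_data_equiv A)"
    by (rule congruentI) (use class_iff rel in blast)
  show "\<exists>d\<in>super_data A. super_isomorphic (coinv A d) H" if "superization A H"
    for H :: "('k, 'h) super_hopf"
    using superization_cases[OF two assms(2) that] by blast
  \<comment> \<open>The induced map on the quotient takes the element of the image of a class; the
    map on data is constant on classes, so that image is a singleton.\<close>
  have elem: "the_elem (?cls ` (super_data_equiv A `` {d})) = ?cls d" if "d \<in> super_data A" for d
  proof -
    have "(d, d) \<in> super_data_equiv A" using that class_iff by blast
    then have "?cls ` (super_data_equiv A `` {d}) = {?cls d}"
      using class_iff rel by blast
    then show ?thesis by simp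
  qed
  show "bij_betw (\<lambda>X. the_elem (?cls ` X)) (super_data A // super_data_equiv A) (superization_classes A)"
  proof (rule bij_betw_imageI)
    show "inj_on (\<lambda>X. the_elem (?cls ` X)) (super_data A // super_data_equiv A)"
    proof (rule inj_onI)
      fix X Y assume "X \<in> super_data A // super_data_equiv A" "Y \<in> super_data A // super_data_equiv A"
        and XY: "the_elem (?cls ` X) = the_elem (?cls ` Y)"
      then obtain d d' where d: "d \<in> super_data A" "X = super_data_equiv A `` {d}"
        and d': "d' \<in> super_data A" "Y = super_data_equiv A `` {d'}" by (auto elim!: quotientE)
      then have "(d, d') \<in> super_data_equiv A" using XY elem class_iff by simp
      then show "X = Y" unfolding d(2) d'(2) by (rule equiv_class_eq[OF eq])
    qed
    have "(\<lambda>X. the_elem (?cls ` X)) ` (super_data A // super_data_equiv A) = ?cls ` super_data A"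
      using elem by (auto simp: quotient_def image_iff)
    also have "\<dots> = superization_classes A"
    proof
      show "?cls ` super_data A \<subseteq> superization_classes A"
        using super by (auto simp: superization_classes_def)
      show "superization_classes A \<subseteq> ?cls ` super_data A"
      proof
        fix C assume "C \<in> superization_classes A"
        then obtain H :: "('k, 'a) super_hopf" where H: "superization A H" "C = super_iso_class H"
          by (auto simp: superization_classes_def)
        obtain d where d: "d \<in> super_data A" "super_isomorphic (coinv A d) H"
          by (rule superization_cases[OF two assms(2) H(1)])
        have "?cls d = super_iso_class H"
          by (rule super_iso_class_eqI[OF d(2)]) (use super[OF d(1)] H(1) in \<open>simp_all add: superization_def\<close>)
        then show "C \<in> ?cls ` super_data A" using H(2) d(1) by blast
      qed
    qed
    finally show "(\<lambda>X. the_elem (?cls ` X)) ` (super_data A // super_data_equiv A) = superization_classes A" .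
  qed
qed

end
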